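(* Let $b\in H^{1/2}(\Gamma_1)$, $q\in L^2(0,T;Q)$ and $g\in L^2(0,T;H)$ for every $T>0$, and let $q_\infty\in Q$, $g_\infty\in H$. Put $$F_1(t)=e^{\lambda_0t}\|g(t)-g_\infty\|_H^2,\qquad F_2(t)=e^{\lambda_0t}\|\gamma_0\|^2\|q(t)-q_\infty\|_Q^2 .$$ If $F_1\in L^1(0,\infty)$ and $F_2\in L^1(0,\infty)$, then for all $t\geq 0$ $$\|u_{bqg}(t)-u_\infty\|_H^2\le\|u_{bqg}(0)-u_\infty\|_H^2e^{-\lambda_0t}+\frac{2e^{-\lambda_0t}}{\lambda_0}\left(\|F_1\|_{L^1(0,\infty)}+\|F_2\|_{L^1(0,\infty)}\right),$$ and therefore $\lim_{t\to+\infty}u_{bqg}(t)=u_\infty$ strongly in $H$ (exponentially).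
   Context: $\Omega\subset\mathbb{R}^n$ is a bounded domain with regular boundary $\Gamma=\Gamma_1\cup\Gamma_2$, $\Gamma_1,\Gamma_2$ disjoint with positive $(n-1)$-dimensional measure. Put $V=H^1(\Omega)$, $V_0=\{v\in V: v|_{\Gamma_1}=0\}$, $H=L^2(\Omega)$, $Q=L^2(\Gamma_2)$, $a(u,v)=\int_\Omega\nabla u\cdot\nabla v\,dx$. $\gamma_0$ is the trace operator $V\to Q$ with $\|\gamma_0\|=\sup_{v\in V\setminus\{0\}}\|\gamma_0(v)\|_Q/\|v\|_V$, and $\lambda_0>0$ is the coerciveness constant of $a$ on $V_0$: $a(v,v)\ge\lambda_0\|v\|_V^2$ for all $v\in V_0$. Let $v_b\in V$ with $v_b=b$ on $\Gamma_1$; data and domain are sufficiently smooth for the problems below to have unique solutions. $u_{bqg}$ is the unique function such that for every $T>0$: $u_{bqg}-v_b\in L^2(0,T;V_0)$, $\dot u_{bqg}\in L^2(0,T;V_0')$, $u_{bqg}(0)=v_b$ and, for a.e. $t$, $\langle\dot u_{bqg}(t),v\rangle+a(u_{bqg}(t),v)=(g(t),v)_H-(q(t),v)_Q$ for all $v\in V_0$. $u_\infty$ is the unique element of $V$ with $u_\infty=b$ on $\Gamma_1$ and $a(u_\infty,v)=(g_\infty,v)_H-(q_\infty,v)_Q$ for all $v\in V_0$ (traces are understood on $\Gamma_2$). *)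

theory Defs
  imports "HOL-Analysis.Analysis"
begin

text \<open>
  Elements of \<open>L\<^sup>2\<close> and Sobolev spaces are represented by functions; two functions denote the same
  element iff they agree almost everywhere, so the \<open>norms\<close> below are seminorms on representatives,
  and values outside the domain are irrelevant.
\<close>

section \<open>Square-integrable functions\<close>

definition L2 :: "'a measure \<Rightarrow> ('a \<Rightarrow> real) set" where
  "L2 M = {f \<in> borel_measurable M. integrable M (\<lambda>x. (f x)\<^sup>2)}"

definition L2_inner :: "'a measure \<Rightarrow> ('a \<Rightarrow> real) \<Rightarrow> ('a \<Rightarrow> real) \<Rightarrow> real" where
  "L2_inner M f g = (\<integral>x. f x * g x \<partial>M)"

definition L2_norm :: "'a measure \<Rightarrow> ('a \<Rightarrow> real) \<Rightarrow> real" where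
  "L2_norm M f = sqrt (\<integral>x. (f x)\<^sup>2 \<partial>M)"


section \<open>Test functions, weak gradients and the Sobolev space \<open>H\<^sup>1\<close>\<close>

primrec Ck :: "nat \<Rightarrow> ('a::euclidean_space \<Rightarrow> real) \<Rightarrow> bool" where
  "Ck 0 f \<longleftrightarrow> continuous_on UNIV f"
| "Ck (Suc k) f \<longleftrightarrow> (\<forall>x. f differentiable (at x)) \<and>
     (\<forall>i\<in>Basis. Ck k (\<lambda>x. frechet_derivative f (at x) i))"

definition test_function :: "'a::euclidean_space set \<Rightarrow> ('a \<Rightarrow> real) \<Rightarrow> bool" where
  "test_function \<Omega> \<phi> \<longleftrightarrow> (\<forall>k. Ck k \<phi>) \<and>
     compact (closure {x. \<phi> x \<noteq> 0}) \<and> closure {x. \<phi> x \<noteq> 0} \<subseteq> \<Omega>"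

definition is_weak_gradient ::
    "'a::euclidean_space set \<Rightarrow> ('a \<Rightarrow> real) \<Rightarrow> ('a \<Rightarrow> 'a) \<Rightarrow> bool" where
  "is_weak_gradient \<Omega> v G \<longleftrightarrow>
     G \<in> borel_measurable (lebesgue_on \<Omega>) \<and>
     integrable (lebesgue_on \<Omega>) (\<lambda>x. (norm (G x))\<^sup>2) \<and>
     (\<forall>\<phi> i. test_function \<Omega> \<phi> \<and> i \<in> Basis \<longrightarrow>
        (\<integral>x. v x * frechet_derivative \<phi> (at x) i \<partial>lebesgue_on \<Omega>) =
        - (\<integral>x. (G x \<bullet> i) * \<phi> x \<partial>lebesgue_on \<Omega>))"

definition H1 :: "'a::euclidean_space set \<Rightarrow> ('a \<Rightarrow> real) set" where
  "H1 \<Omega> = {v \<in> L2 (lebesgue_on \<Omega>). \<exists>G. is_weak_gradient \<Omega> v G}"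

definition weak_grad :: "'a::euclidean_space set \<Rightarrow> ('a \<Rightarrow> real) \<Rightarrow> 'a \<Rightarrow> 'a" where
  "weak_grad \<Omega> v = (SOME G. is_weak_gradient \<Omega> v G)"

definition H1_norm :: "'a::euclidean_space set \<Rightarrow> ('a \<Rightarrow> real) \<Rightarrow> real" where
  "H1_norm \<Omega> v = sqrt ((L2_norm (lebesgue_on \<Omega>) v)\<^sup>2 +
     (\<integral>x. (norm (weak_grad \<Omega> v x))\<^sup>2 \<partial>lebesgue_on \<Omega>))"

definition dirichlet_form ::
    "'a::euclidean_space set \<Rightarrow> ('a \<Rightarrow> real) \<Rightarrow> ('a \<Rightarrow> real) \<Rightarrow> real" where
  "dirichlet_form \<Omega> u v = (\<integral>x. weak_grad \<Omega> u x \<bullet> weak_grad \<Omega> v x \<partial>lebesgue_on \<Omega>)"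


section \<open>Surface measure and regular boundaries\<close>

text \<open>
  \<open>k\<close>-dimensional Hausdorff measure, normalised so that it agrees with \<open>k\<close>-dimensional area. Empty
  covering sets cost nothing, which has to be said because \<open>0 ^ 0 = 1\<close>.
\<close>

definition hausdorff_gauge :: "nat \<Rightarrow> 'a::metric_space set \<Rightarrow> ennreal" where
  "hausdorff_gauge k C =
     (if C = {} then 0 else ennreal (unit_ball_vol (real k) * (diameter C / 2) ^ k))"

definition hausdorff_pre :: "nat \<Rightarrow> real \<Rightarrow> 'a::metric_space set \<Rightarrow> ennreal" where
  "hausdorff_pre k \<delta> A =
     (INF C \<in> {C :: nat \<Rightarrow> 'a set. A \<subseteq> (\<Union>i. C i) \<and> (\<forall>i. bounded (C i) \<and> diameter (C i) \<le> \<delta>)}.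
        \<Sum>i. hausdorff_gauge k (C i))"

definition hausdorff_outer :: "nat \<Rightarrow> 'a::metric_space set \<Rightarrow> ennreal" where
  "hausdorff_outer k A = (SUP \<delta>\<in>{0<..}. hausdorff_pre k \<delta> A)"

definition hausdorff_measure :: "nat \<Rightarrow> 'a::metric_space measure" where
  "hausdorff_measure k =
     measure_of UNIV (lambda_system UNIV UNIV (hausdorff_outer k)) (hausdorff_outer k)"

text \<open>
  The Hausdorff outer measure is indeed an outer measure, so \<open>measure_of\<close> does not fall back to the
  zero measure.
\<close>

lemma hausdorff_pre_empty: "\<delta> > 0 \<Longrightarrow> hausdorff_pre k \<delta> ({} :: 'a::metric_space set) = 0"
proof -
  assume "\<delta> > 0"
  then have "hausdorff_pre k \<delta> ({} :: 'a set) \<le> (\<Sum>i::nat. hausdorff_gauge k ({} :: 'a set))"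
    unfolding hausdorff_pre_def using \<open>\<delta> > 0\<close> by (intro INF_lower) auto
  then show ?thesis by (simp add: hausdorff_gauge_def)
qed

lemma hausdorff_pre_mono: "A \<subseteq> B \<Longrightarrow> hausdorff_pre k \<delta> A \<le> hausdorff_pre k \<delta> B"
  unfolding hausdorff_pre_def by (rule INF_superset_mono) auto

lemma hausdorff_pre_UN: "hausdorff_pre k \<delta> (\<Union>i. A i) \<le> (\<Sum>i::nat. hausdorff_pre k \<delta> (A i))"
proof (rule ennreal_le_epsilon)
  fix e :: real
  assume fin: "(\<Sum>i. hausdorff_pre k \<delta> (A i)) < top" and e: "0 < e"
  have "\<exists>C. (A i \<subseteq> (\<Union>j::nat. C j) \<and> (\<forall>j. bounded (C j) \<and> diameter (C j) \<le> \<delta>)) \<and>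
      (\<Sum>j. hausdorff_gauge k (C j)) < hausdorff_pre k \<delta> (A i) + ennreal (e * (1/2)^Suc i)" for i
  proof -
    have "hausdorff_pre k \<delta> (A i) \<noteq> top"
      using ennreal_suminf_lessD[OF fin, of i] by auto
    then have "hausdorff_pre k \<delta> (A i) < hausdorff_pre k \<delta> (A i) + ennreal (e * (1/2)^Suc i)"
      using e by (auto simp add: less_top)
    then show ?thesis unfolding hausdorff_pre_def INF_less_iff by blast
  qed
  then obtain C where C: "\<And>i. A i \<subseteq> (\<Union>j::nat. C i j)"
      "\<And>i j. bounded (C i j) \<and> diameter (C i j) \<le> \<delta>"
      "\<And>i. (\<Sum>j. hausdorff_gauge k (C i j)) < hausdorff_pre k \<delta> (A i) + ennreal (e * (1/2)^Suc i)"
    by metis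
  define D where "D = (\<lambda>m. C (fst (prod_decode m)) (snd (prod_decode m)))"
  have D: "C i j = D (prod_encode (i,j))" for i j by (simp add: D_def)
  have "hausdorff_pre k \<delta> (\<Union>i. A i) \<le> (\<Sum>m. hausdorff_gauge k (D m))"
    unfolding hausdorff_pre_def
  proof (rule INF_lower, rule CollectI, intro conjI allI)
    show "(\<Union>i. A i) \<subseteq> (\<Union>m. D m)"
    proof
      fix x assume "x \<in> (\<Union>i. A i)"
      then obtain i j where "x \<in> C i j" using C(1) by blast
      then have "x \<in> D (prod_encode (i, j))" by (simp only: D)
      then show "x \<in> (\<Union>m. D m)" by blast
    qed
    show "bounded (D m)" "diameter (D m) \<le> \<delta>" for m
      using C(2) by (simp_all add: D_def)
  qed
  also have "\<dots> = (\<Sum>i. \<Sum>j. hausdorff_gauge k (C i j))"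
    using suminf_ennreal_2dimen[of "\<lambda>i. (\<Sum>j. hausdorff_gauge k (C i j))" "\<lambda>(i,j). hausdorff_gauge k (C i j)"]
    by (simp add: D_def comp_def case_prod_beta)
  also have "\<dots> \<le> (\<Sum>i. hausdorff_pre k \<delta> (A i) + ennreal (e * (1/2)^Suc i))"
    using C(3) by (intro suminf_le) (auto intro: less_imp_le)
  also have "\<dots> = (\<Sum>i. hausdorff_pre k \<delta> (A i)) + (\<Sum>i. ennreal (e * (1/2)^Suc i))"
    by (rule suminf_add[symmetric]) auto
  also have "(\<Sum>i. ennreal (e * (1/2)^Suc i)) = ennreal e"
    using sums_mult[OF power_half_series, of e] e by (intro suminf_ennreal_eq) simp_all
  finally show "hausdorff_pre k \<delta> (\<Union>i. A i) \<le> (\<Sum>i. hausdorff_pre k \<delta> (A i)) + ennreal e" .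
qed

lemma outer_measure_space_hausdorff:
  "outer_measure_space UNIV (hausdorff_outer k :: 'a::metric_space set \<Rightarrow> ennreal)"
  unfolding outer_measure_space_def
proof (intro conjI)
  show "positive UNIV (hausdorff_outer k :: 'a set \<Rightarrow> ennreal)"
    unfolding positive_def hausdorff_outer_def
    by (rule SUP_eq_const) (auto simp: hausdorff_pre_empty)
  show "increasing UNIV (hausdorff_outer k :: 'a set \<Rightarrow> ennreal)"
    unfolding increasing_def hausdorff_outer_def by (intro ballI impI SUP_mono' hausdorff_pre_mono)
  show "countably_subadditive UNIV (hausdorff_outer k :: 'a set \<Rightarrow> ennreal)"
    unfolding countably_subadditive_def
  proof (intro allI impI)
    fix A :: "nat \<Rightarrow> 'a set"
    show "hausdorff_outer k (\<Union>i. A i) \<le> (\<Sum>i. hausdorff_outer k (A i))"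
      unfolding hausdorff_outer_def[of k "\<Union>i. A i"]
    proof (rule SUP_least)
      fix \<delta> :: real assume "\<delta> \<in> {0<..}"
      have "hausdorff_pre k \<delta> (\<Union>i. A i) \<le> (\<Sum>i. hausdorff_pre k \<delta> (A i))" by (rule hausdorff_pre_UN)
      also have "\<dots> \<le> (\<Sum>i. hausdorff_outer k (A i))"
        unfolding hausdorff_outer_def by (intro suminf_le SUP_upper \<open>\<delta> \<in> _\<close>) auto
      finally show "hausdorff_pre k \<delta> (\<Union>i. A i) \<le> (\<Sum>i. hausdorff_outer k (A i))" .
    qed
  qed
qed

lemma
  fixes A :: "'a::metric_space set"
  shows sets_hausdorff_measure:
      "sets (hausdorff_measure k :: 'a measure) = lambda_system UNIV UNIV (hausdorff_outer k)"
    and emeasure_hausdorff_measure: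
      "A \<in> sets (hausdorff_measure k) \<Longrightarrow> emeasure (hausdorff_measure k) A = hausdorff_outer k A"
proof -
  interpret S: sigma_algebra UNIV "UNIV :: 'a set set"
    using sigma_algebra_Pow[of "UNIV :: 'a set"] by simp
  have M: "measure_space UNIV (lambda_system UNIV UNIV (hausdorff_outer k))
      (hausdorff_outer k :: 'a set \<Rightarrow> ennreal)"
    using outer_measure_space_hausdorff by (rule S.caratheodory_lemma)
  then have sa: "sigma_algebra UNIV (lambda_system UNIV UNIV (hausdorff_outer k :: 'a set \<Rightarrow> ennreal))"
    by (simp add: measure_space_def)
  show s: "sets (hausdorff_measure k :: 'a measure) = lambda_system UNIV UNIV (hausdorff_outer k)"
    unfolding hausdorff_measure_def by (rule sigma_algebra.sets_measure_of_eq[OF sa])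
  show "emeasure (hausdorff_measure k) A = hausdorff_outer k A" if "A \<in> sets (hausdorff_measure k)"
    unfolding hausdorff_measure_def
    by (rule emeasure_measure_of_sigma[OF sa]) (use M that s in \<open>auto simp: measure_space_def\<close>)
qed

definition surface_on :: "'a::euclidean_space set \<Rightarrow> 'a measure" where
  "surface_on A = restrict_space (hausdorff_measure (DIM('a) - 1)) A"

text \<open>
  Near each boundary point the set is, in suitable Cartesian coordinates with vertical direction
  \<open>e\<close>, the part of a ball lying strictly above the graph of a Lipschitz function \<open>\<psi>\<close> on the
  hyperplane orthogonal to \<open>e\<close>.
\<close>

definition lipschitz_boundary :: "'a::euclidean_space set \<Rightarrow> bool" where
  "lipschitz_boundary \<Omega> \<longleftrightarrow>
     (\<forall>x0 \<in> frontier \<Omega>. \<exists>e r L \<psi>. norm e = 1 \<and> r > 0 \<and> L-lipschitz_on {y. y \<bullet> e = 0} \<psi> \<and>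
        (\<forall>x \<in> ball x0 r. x \<in> \<Omega> \<longleftrightarrow> \<psi> (x - (x \<bullet> e) *\<^sub>R e) < x \<bullet> e))"

definition regular_domain :: "'a::euclidean_space set \<Rightarrow> bool" where
  "regular_domain \<Omega> \<longleftrightarrow>
     open \<Omega> \<and> connected \<Omega> \<and> \<Omega> \<noteq> {} \<and> bounded \<Omega> \<and> lipschitz_boundary \<Omega>"


section \<open>Traces\<close>

text \<open>
  The trace operator, characterised as in the trace theorem: the bounded linear operator from
  \<open>H\<^sup>1(\<Omega>)\<close> to \<open>L\<^sup>2\<close> of the boundary that restricts functions continuous up to the boundary.
  On a Lipschitz domain it exists and, by density, is unique up to null sets.
\<close>

definition is_trace_operator ::
    "'a::euclidean_space set \<Rightarrow> (('a \<Rightarrow> real) \<Rightarrow> 'a \<Rightarrow> real) \<Rightarrow> bool" where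
  "is_trace_operator \<Omega> \<gamma> \<longleftrightarrow>
     (\<forall>v\<in>H1 \<Omega>. \<gamma> v \<in> L2 (surface_on (frontier \<Omega>))) \<and>
     (\<forall>u\<in>H1 \<Omega>. \<forall>v\<in>H1 \<Omega>. AE x in surface_on (frontier \<Omega>).
        \<gamma> (\<lambda>y. u y + v y) x = \<gamma> u x + \<gamma> v x) \<and>
     (\<forall>v\<in>H1 \<Omega>. \<forall>c. AE x in surface_on (frontier \<Omega>). \<gamma> (\<lambda>y. c * v y) x = c * \<gamma> v x) \<and>
     (\<exists>C. \<forall>v\<in>H1 \<Omega>. L2_norm (surface_on (frontier \<Omega>)) (\<gamma> v) \<le> C * H1_norm \<Omega> v) \<and>
     (\<forall>v\<in>H1 \<Omega>. continuous_on (closure \<Omega>) v \<longrightarrow>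
        (AE x in surface_on (frontier \<Omega>). \<gamma> v x = v x))"

definition trace_norm ::
    "'a::euclidean_space set \<Rightarrow> 'a set \<Rightarrow> (('a \<Rightarrow> real) \<Rightarrow> 'a \<Rightarrow> real) \<Rightarrow> real" where
  "trace_norm \<Omega> \<Gamma>2 \<gamma> =
     (SUP v \<in> {v \<in> H1 \<Omega>. H1_norm \<Omega> v \<noteq> 0}. L2_norm (surface_on \<Gamma>2) (\<gamma> v) / H1_norm \<Omega> v)"

definition V0 ::
    "'a::euclidean_space set \<Rightarrow> 'a set \<Rightarrow> (('a \<Rightarrow> real) \<Rightarrow> 'a \<Rightarrow> real) \<Rightarrow> ('a \<Rightarrow> real) set" where
  "V0 \<Omega> \<Gamma>1 \<gamma> = {v \<in> H1 \<Omega>. AE x in surface_on \<Gamma>1. \<gamma> v x = 0}"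

text \<open>
  \<open>H\<^bsup>1/2\<^esup>\<close> by the Gagliardo seminorm; on an \<open>(n-1)\<close>-dimensional surface the exponent of the
  distance is \<open>(n - 1) + 2 * (1/2) = n\<close>.
\<close>

definition H_half :: "'a::euclidean_space set \<Rightarrow> ('a \<Rightarrow> real) set" where
  "H_half A = {b \<in> L2 (surface_on A).
     (\<integral>\<^sup>+x. \<integral>\<^sup>+y. ennreal ((b x - b y)\<^sup>2 / dist x y ^ DIM('a)) \<partial>surface_on A \<partial>surface_on A) < \<infinity>}"


section \<open>Spaces of vector-valued functions of time\<close>

text \<open>
  Here \<open>X\<close> is a set of representatives of a normed space and \<open>N\<close> its norm. Strong (Bochner)
  measurability is a.e. approximability by simple functions with values in \<open>X\<close>.
\<close>

definition strongly_measurable ::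
    "'t measure \<Rightarrow> 'c::minus set \<Rightarrow> ('c \<Rightarrow> real) \<Rightarrow> ('t \<Rightarrow> 'c) \<Rightarrow> bool" where
  "strongly_measurable M X N f \<longleftrightarrow> (AE t in M. f t \<in> X) \<and>
     (\<exists>s :: nat \<Rightarrow> 't \<Rightarrow> 'c. (\<forall>k. simple_function M (s k) \<and> s k ` space M \<subseteq> X) \<and>
        (AE t in M. (\<lambda>k. N (s k t - f t)) \<longlonglongrightarrow> 0))"

definition bochner_L2 ::
    "'t measure \<Rightarrow> 'c::minus set \<Rightarrow> ('c \<Rightarrow> real) \<Rightarrow> ('t \<Rightarrow> 'c) set" where
  "bochner_L2 M X N =
     {f. strongly_measurable M X N f \<and> (\<integral>\<^sup>+t. ennreal ((N (f t))\<^sup>2) \<partial>M) < \<infinity>}"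

definition dual_space :: "('a \<Rightarrow> real) set \<Rightarrow> (('a \<Rightarrow> real) \<Rightarrow> real) \<Rightarrow> (('a \<Rightarrow> real) \<Rightarrow> real) set" where
  "dual_space X N = {F.
     (\<forall>u\<in>X. \<forall>v\<in>X. F (\<lambda>x. u x + v x) = F u + F v) \<and>
     (\<forall>v\<in>X. \<forall>c. F (\<lambda>x. c * v x) = c * F v) \<and>
     (\<exists>C. \<forall>v\<in>X. \<bar>F v\<bar> \<le> C * N v)}"

definition dual_norm ::
    "('a \<Rightarrow> real) set \<Rightarrow> (('a \<Rightarrow> real) \<Rightarrow> real) \<Rightarrow> (('a \<Rightarrow> real) \<Rightarrow> real) \<Rightarrow> real" where
  "dual_norm X N F = (SUP v \<in> {v \<in> X. N v \<le> 1}. \<bar>F v\<bar>)"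

text \<open>
  \<open>u'\<close> is the distributional derivative of \<open>u\<close> on \<open>(0,T)\<close> as a function with values in the dual of
  \<open>X\<close>, an element \<open>h\<close> of \<open>L\<^sup>2(\<Omega>)\<close> being identified with the functional \<open>v \<mapsto> (h,v)\<close>. The vector-valued
  identity \<open>\<integral> u' \<phi> = - \<integral> u \<phi>'\<close> is tested against the elements of \<open>X\<close>.
\<close>

definition is_time_derivative ::
    "'a::euclidean_space set \<Rightarrow> ('a \<Rightarrow> real) set \<Rightarrow> real \<Rightarrow>
     (real \<Rightarrow> 'a \<Rightarrow> real) \<Rightarrow> (real \<Rightarrow> ('a \<Rightarrow> real) \<Rightarrow> real) \<Rightarrow> bool" where
  "is_time_derivative \<Omega> X T u u' \<longleftrightarrow>
     (\<forall>\<phi> v. test_function {0<..<T} \<phi> \<and> v \<in> X \<longrightarrow>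
        (\<integral>t. u' t v * \<phi> t \<partial>lebesgue_on {0<..<T}) =
        - (\<integral>t. L2_inner (lebesgue_on \<Omega>) (u t) v * deriv \<phi> t \<partial>lebesgue_on {0<..<T}))"


section \<open>The stationary and the evolution problem\<close>

definition stationary_solution ::
    "'a::euclidean_space set \<Rightarrow> 'a set \<Rightarrow> 'a set \<Rightarrow> (('a \<Rightarrow> real) \<Rightarrow> 'a \<Rightarrow> real) \<Rightarrow>
     ('a \<Rightarrow> real) \<Rightarrow> ('a \<Rightarrow> real) \<Rightarrow> ('a \<Rightarrow> real) \<Rightarrow> ('a \<Rightarrow> real) \<Rightarrow> bool" where
  "stationary_solution \<Omega> \<Gamma>1 \<Gamma>2 \<gamma> b q g u \<longleftrightarrow>
     u \<in> H1 \<Omega> \<and> (AE x in surface_on \<Gamma>1. \<gamma> u x = b x) \<and>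
     (\<forall>v\<in>V0 \<Omega> \<Gamma>1 \<gamma>. dirichlet_form \<Omega> u v =
        L2_inner (lebesgue_on \<Omega>) g v - L2_inner (surface_on \<Gamma>2) q (\<gamma> v))"

text \<open>
  The evolution solution \<open>u\<close> is identified with its representative in \<open>C([0,\<infinity>); L\<^sup>2(\<Omega>))\<close>, which is
  what gives a meaning to \<open>u(0)\<close> and to \<open>u(t)\<close> for every (not just almost every) \<open>t\<close>.
\<close>

definition evolution_solution ::
    "'a::euclidean_space set \<Rightarrow> 'a set \<Rightarrow> 'a set \<Rightarrow> (('a \<Rightarrow> real) \<Rightarrow> 'a \<Rightarrow> real) \<Rightarrow>
     ('a \<Rightarrow> real) \<Rightarrow> (real \<Rightarrow> 'a \<Rightarrow> real) \<Rightarrow> (real \<Rightarrow> 'a \<Rightarrow> real) \<Rightarrow> (real \<Rightarrow> 'a \<Rightarrow> real) \<Rightarrow> bool" where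
  "evolution_solution \<Omega> \<Gamma>1 \<Gamma>2 \<gamma> vb q g u \<longleftrightarrow>
     (\<forall>t\<ge>0. u t \<in> L2 (lebesgue_on \<Omega>)) \<and>
     (\<forall>t\<ge>0. ((\<lambda>s. L2_norm (lebesgue_on \<Omega>) (u s - u t)) \<longlongrightarrow> 0) (at t within {0..})) \<and>
     (AE x in lebesgue_on \<Omega>. u 0 x = vb x) \<and>
     (\<exists>u'. \<forall>T>0.
        (\<lambda>t. u t - vb) \<in> bochner_L2 (lebesgue_on {0<..<T}) (V0 \<Omega> \<Gamma>1 \<gamma>) (H1_norm \<Omega>) \<and>
        u' \<in> bochner_L2 (lebesgue_on {0<..<T}) (dual_space (V0 \<Omega> \<Gamma>1 \<gamma>) (H1_norm \<Omega>))
               (dual_norm (V0 \<Omega> \<Gamma>1 \<gamma>) (H1_norm \<Omega>)) \<and>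
        is_time_derivative \<Omega> (V0 \<Omega> \<Gamma>1 \<gamma>) T u u' \<and>
        (AE t in lebesgue_on {0<..<T}. \<forall>v\<in>V0 \<Omega> \<Gamma>1 \<gamma>.
           u' t v + dirichlet_form \<Omega> (u t) v =
           L2_inner (lebesgue_on \<Omega>) (g t) v - L2_inner (surface_on \<Gamma>2) (q t) (\<gamma> v)))"

end

theory Submission
  imports Defs "HOL-Real_Asymp.Real_Asymp"
begin

text \<open>
  Write \<open>w = u - u\<^sub>\<infinity>\<close>. Testing the difference of the two problems with \<open>w(t)\<close> and using coercivity
  and Young's inequality gives \<open>2\<langle>w', w\<rangle> \<le> -\<lambda>\<^sub>0\<parallel>w\<parallel>\<^sub>H\<^sup>2 + (2/\<lambda>\<^sub>0) e\<^bsup>-\<lambda>\<^sub>0t\<^esup> (F\<^sub>1 + F\<^sub>2)\<close>, so everything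
  rests on the chain rule for \<open>\<parallel>w(t)\<parallel>\<^sub>H\<^sup>2\<close> when only \<open>w \<in> L\<^sup>2(V\<^sub>0)\<close> and \<open>w' \<in> L\<^sup>2(V\<^sub>0')\<close>. Instead of mollifying
  in time, integrate \<open>\<parallel>w(t)\<parallel>\<^sup>2 - \<parallel>w(t-h)\<parallel>\<^sup>2 \<le> 2 (w(t) - w(t-h), w(t))\<close> over \<open>t\<close>, divide by \<open>h\<close> and
  let \<open>h \<rightarrow> 0\<close>. The right-hand side is \<open>2h\<close> times the backward average of \<open>w'\<close> applied to \<open>w(t)\<close>. As backward
  averaging is a contraction of \<open>L\<^sup>2\<close>, \<open>e\<^bsup>\<lambda>\<^sub>0t\<^esup>w\<close> may be replaced by a \<open>V\<^sub>0\<close>-valued simple function, and then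
  only weak \<open>L\<^sup>2\<close> convergence of backward averages of scalar functions is needed.

  The Dirichlet form is bilinear because weak gradients are unique almost everywhere, which is the
  fundamental lemma of the calculus of variations.
\<close>

section \<open>Smooth functions\<close>

text \<open>The obstacle is that the time derivative is known only against a fixed \<open>v\<close>
  in \<open>V0\<close>, whereas \<open>w(t)\<close> moves with \<open>t\<close>. A simple function
  bridges this: each of its finitely many values is an admissible \<open>v\<close>, but its level
  sets are merely measurable. Hence averages must converge weakly on all measurable sets, not only
  on intervals. The averages look backward because the increment of the square is bounded above by
  testing with the later value, and an upper bound is enough. They require \<open>h < a\<close>, so
  the energy inequality lives on compact subintervals of \<open>(0,T)\<close>; time 0 is reached
  last, by continuity in H. The weight \<open>exp(lambda0 t)\<close> is built into the approximated
  function, so the inequality comes out already integrated and no Gronwall argument follows.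
  Coercivity gives \<open>2 lambda0\<close>; two uses of Young's inequality cost
  \<open>lambda0 / 2\<close> each and produce the factor \<open>2 / lambda0\<close>; the remaining
  \<open>lambda0\<close> is the decay rate. Both test-function arguments, in space and in time, rest
  on explicit smooth functions made from \<open>exp(-1/x)\<close>.\<close>

lemma has_derivative_imp_Ck_Suc:
  assumes "\<And>x. (f has_derivative f' x) (at x)" "\<And>i. i \<in> Basis \<Longrightarrow> Ck k (\<lambda>x. f' x i)"
  shows "Ck (Suc k) f"
proof -
  have "frechet_derivative f (at x) = f' x" for x
    using frechet_derivative_at[OF assms(1)] by simp
  then show ?thesis using assms by (auto simp: differentiable_def)
qed

lemma Ck_Suc_imp_Ck: "Ck (Suc k) f \<Longrightarrow> Ck k f"
proof (induction k arbitrary: f)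
  case 0
  then show ?case
    by (auto intro!: differentiable_imp_continuous_on simp: differentiable_on_def)
next
  case (Suc k)
  then show ?case by (metis Ck.simps(2))
qed

lemma Ck_imp_continuous_on: "Ck k f \<Longrightarrow> continuous_on S f"
proof (induction k arbitrary: f)
  case 0
  then show ?case by (auto intro: continuous_on_subset)
next
  case (Suc k)
  then show ?case using Ck_Suc_imp_Ck by blast
qed

lemma Ck_const [simp]: "Ck k (\<lambda>x. c)"
proof (induction k arbitrary: c)
  case 0
  then show ?case by simp
next
  case (Suc k)
  then show ?case by (intro has_derivative_imp_Ck_Suc[where f' = "\<lambda>_ _. 0"]) auto
qed

lemma Ck_Suc_has_derivative:
  "Ck (Suc k) f \<Longrightarrow> (f has_derivative frechet_derivative f (at x)) (at x)"
  using frechet_derivative_works by auto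

lemma Ck_add: "Ck k f \<Longrightarrow> Ck k g \<Longrightarrow> Ck k (\<lambda>x. f x + g x)"
proof (induction k arbitrary: f g)
  case 0
  then show ?case by (auto intro: continuous_intros)
next
  case (Suc k)
  show ?case
    by (rule has_derivative_imp_Ck_Suc[OF has_derivative_add
          [OF Ck_Suc_has_derivative[OF Suc.prems(1)] Ck_Suc_has_derivative[OF Suc.prems(2)]]])
       (use Suc in auto)
qed

lemma Ck_mult: "Ck k f \<Longrightarrow> Ck k g \<Longrightarrow> Ck k (\<lambda>x. f x * g x)"
proof (induction k arbitrary: f g)
  case 0
  then show ?case by (auto intro: continuous_intros)
next
  case (Suc k)
  \<comment> \<open>The product rule leaves one factor undifferentiated, so both functions are also
    needed at the lower order \<open>k\<close>.\<close>
  note fg = Ck_Suc_imp_Ck[OF Suc.prems(1)] Ck_Suc_imp_Ck[OF Suc.prems(2)]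
  show ?case
    by (rule has_derivative_imp_Ck_Suc[OF has_derivative_mult
          [OF Ck_Suc_has_derivative[OF Suc.prems(1)] Ck_Suc_has_derivative[OF Suc.prems(2)]]])
       (use Suc.prems fg in \<open>auto intro!: Ck_add Suc.IH\<close>)
qed

lemma Ck_cmult: "Ck k f \<Longrightarrow> Ck k (\<lambda>x. c * f x)"
  by (rule Ck_mult) auto

lemma Ck_minus: "Ck k f \<Longrightarrow> Ck k (\<lambda>x. - f x)"
  using Ck_cmult[of k f "- 1"] by simp

lemma Ck_prod:
  assumes "finite I" "\<And>i. i \<in> I \<Longrightarrow> Ck k (f i)"
  shows "Ck k (\<lambda>x. \<Prod>i\<in>I. f i x)"
  using assms by (induction I rule: finite_induct) (auto intro: Ck_mult)

lemma Ck_inverse: "Ck k f \<Longrightarrow> (\<And>x. f x \<noteq> 0) \<Longrightarrow> Ck k (\<lambda>x. inverse (f x))"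
proof (induction k)
  case 0
  then show ?case by (auto intro: continuous_intros)
next
  case (Suc k)
  \<comment> \<open>The derivative of \<open>1/f\<close> contains \<open>1/f\<close> again, one
    order lower; the induction hypothesis supplies it.\<close>
  have inv: "Ck k (\<lambda>x. inverse (f x))"
    using Suc Ck_Suc_imp_Ck by blast
  have d: "((\<lambda>x. inverse (f x)) has_derivative
      (\<lambda>h. - (inverse (f x) * (frechet_derivative f (at x) h * inverse (f x))))) (at x)" for x
    using Deriv.has_derivative_inverse[OF Suc.prems(2) Ck_Suc_has_derivative[OF Suc.prems(1)], of x]
    by (simp add: mult.assoc)
  show ?case
    by (rule has_derivative_imp_Ck_Suc[OF d]) (use Suc.prems inv in \<open>auto intro!: Ck_mult Ck_minus\<close>)
qed

text \<open>This special chain rule suffices: every test function below is built by sums, products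
  and inverses from functions of one real variable composed with affine functionals.\<close>

lemma Ck_compose_affine:
  fixes g :: "real \<Rightarrow> real"
  shows "Ck k g \<Longrightarrow> Ck k (\<lambda>x. g (x \<bullet> v + d))"
proof (induction k arbitrary: g)
  case 0
  then show ?case
    by (auto intro!: continuous_intros continuous_on_compose2[of UNIV g])
next
  case (Suc k)
  \<comment> \<open>On the line a derivative is multiplication by its value at 1, the only basis
    vector. This isolates a scalar function of order \<open>k\<close> for the induction
    hypothesis.\<close>
  have lin: "frechet_derivative g (at y) h = h * frechet_derivative g (at y) 1" for y h
    using linear_cmul[OF has_derivative_linear[OF Ck_Suc_has_derivative[OF Suc.prems]], of y h 1] by simp
  have d: "((\<lambda>x. g (x \<bullet> v + d)) has_derivative
      (\<lambda>h. (h \<bullet> v) * frechet_derivative g (at (x \<bullet> v + d)) 1)) (at x)" for x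
  proof -
    have "((\<lambda>x. x \<bullet> v + d) has_derivative (\<lambda>h. h \<bullet> v)) (at x)"
      by (auto intro!: derivative_eq_intros)
    from has_derivative_compose[OF this Ck_Suc_has_derivative[OF Suc.prems]]
    show ?thesis by (subst (asm) lin)
  qed
  show ?case
    by (rule has_derivative_imp_Ck_Suc[OF d]) (use Suc in \<open>auto intro!: Ck_cmult\<close>)
qed

section \<open>Smooth transition functions from \<open>exp(-1/x)\<close>\<close>

definition smooth_ramp :: "real poly \<Rightarrow> real \<Rightarrow> real" where
  "smooth_ramp p x = (if x > 0 then poly p (inverse x) * exp (- inverse x) else 0)"

lemma tendsto_poly_div_exp: "((\<lambda>y. poly p y * exp (- y)) \<longlongrightarrow> (0::real)) at_top"
proof -
  have "((\<lambda>y. \<Sum>i\<le>degree p. coeff p i * (y ^ i / exp y)) \<longlongrightarrow> (\<Sum>i\<le>degree p. coeff p i * 0)) at_top"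
    by (intro tendsto_sum tendsto_mult tendsto_const tendsto_power_div_exp_0)
  moreover have "(\<Sum>i\<le>degree p. coeff p i * (y ^ i / exp y)) = poly p y * exp (- y)" for y
    by (simp add: poly_altdef sum_distrib_right exp_minus divide_inverse mult.assoc)
  ultimately show ?thesis by simp
qed

lemma smooth_ramp_tendsto_0: "(smooth_ramp p \<longlongrightarrow> 0) (at_right 0)"
proof (rule Lim_transform_eventually)
  show "((\<lambda>x. poly p (inverse x) * exp (- inverse x)) \<longlongrightarrow> 0) (at_right 0)"
    by (rule filterlim_compose[OF tendsto_poly_div_exp filterlim_inverse_at_top_right])
  show "\<forall>\<^sub>F x in at_right 0. poly p (inverse x) * exp (- inverse x) = smooth_ramp p x"
    by (simp add: smooth_ramp_def eventually_at_right_less eventually_mono[OF eventually_at_right_less])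
qed

text \<open>With \<open>y = 1/x\<close> one has \<open>d/dx = - y^2 d/dy\<close>, which sends
  \<open>p(y) exp(-y)\<close> to \<open>y^2 (p - p')(y) exp(-y)\<close>. The polynomial parameter
  makes the family closed under differentiation, so smoothness follows by one induction over all
  \<open>p\<close>.\<close>

lemma has_field_derivative_smooth_ramp:
  "(smooth_ramp p has_field_derivative smooth_ramp ([:0,0,1:] * (p - pderiv p)) x) (at x)"
proof -
  consider "x > 0" | "x < 0" | "x = 0" by linarith
  then show ?thesis
  proof cases
    case 1
    have "((\<lambda>x. poly p (inverse x) * exp (- inverse x)) has_field_derivative
        smooth_ramp ([:0,0,1:] * (p - pderiv p)) x) (at x)"
      using 1 by (auto intro!: derivative_eq_intros simp: smooth_ramp_def algebra_simps power2_eq_square)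
    then show ?thesis
      by (rule has_field_derivative_transform_within_open[where S = "{0<..}"])
         (use 1 in \<open>auto simp: smooth_ramp_def\<close>)
  next
    case 2
    have "((\<lambda>x. 0) has_field_derivative smooth_ramp ([:0,0,1:] * (p - pderiv p)) x) (at x)"
      using 2 by (simp add: smooth_ramp_def)
    then show ?thesis
      by (rule has_field_derivative_transform_within_open[where S = "{..<0}"])
         (use 2 in \<open>auto simp: smooth_ramp_def\<close>)
  next
    case 3
    have "((\<lambda>h. smooth_ramp p h / h) \<longlongrightarrow> 0) (at_right 0)"
    \<comment> \<open>At 0 the difference quotient multiplies by \<open>1/x\<close>, which is again
      a ramp, with polynomial \<open>y p(y)\<close>.\<close>
    proof (rule Lim_transform_eventually[OF smooth_ramp_tendsto_0[of "[:0,1:] * p"]])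
      show "\<forall>\<^sub>F x in at_right 0. smooth_ramp ([:0, 1:] * p) x = smooth_ramp p x / x"
        by (rule eventually_mono[OF eventually_at_right_less]) (simp add: smooth_ramp_def field_simps)
    qed
    moreover have "((\<lambda>h. smooth_ramp p h / h) \<longlongrightarrow> 0) (at_left 0)"
    proof (rule Lim_transform_eventually[OF tendsto_const])
      show "\<forall>\<^sub>F x in at_left 0. 0 = smooth_ramp p x / x"
        by (auto simp: eventually_at_filter smooth_ramp_def intro!: always_eventually)
    qed
    ultimately have "((\<lambda>h. smooth_ramp p h / h) \<longlongrightarrow> 0) (at 0)"
      using filterlim_split_at_real by blast
    then show ?thesis using 3 by (simp add: DERIV_def smooth_ramp_def)
  qed
qed

lemma Ck_smooth_ramp: "Ck k (smooth_ramp p)"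
proof (induction k arbitrary: p)
  case 0
  have "isCont (smooth_ramp p) x" for x
    using has_field_derivative_smooth_ramp DERIV_isCont by blast
  then show ?case by (simp add: continuous_at_imp_continuous_on)
next
  case (Suc k)
  show ?case
    by (rule has_derivative_imp_Ck_Suc[OF has_field_derivative_smooth_ramp[unfolded has_field_derivative_def]])
       (use Suc in simp)
qed

abbreviation "ramp \<equiv> smooth_ramp 1"

lemma ramp_simps: "x > 0 \<Longrightarrow> ramp x = exp (- inverse x)" "x \<le> 0 \<Longrightarrow> ramp x = 0"
  and ramp_bounds: "0 \<le> ramp x" "ramp x \<le> 1"
  by (auto simp: smooth_ramp_def)

lemma mono_ramp: "x \<le> y \<Longrightarrow> ramp x \<le> ramp y"
  by (auto simp: smooth_ramp_def le_imp_inverse_le)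

definition smooth_step :: "real \<Rightarrow> real" where
  "smooth_step t = ramp t * inverse (ramp t + ramp (1 - t))"

lemma ramp_sum_pos: "ramp t + ramp (1 - t) > 0"
proof (cases "t > 0")
  case True
  then have "ramp t > 0" by (simp add: ramp_simps)
  then show ?thesis using ramp_bounds(1)[of "1 - t"] by linarith
next
  case False
  then have "ramp (1 - t) > 0" by (simp add: ramp_simps)
  then show ?thesis using ramp_bounds(1)[of t] by linarith
qed

lemma Ck_smooth_step: "Ck k smooth_step"
proof -
  have "Ck k (\<lambda>t. ramp (1 - t))"
    using Ck_compose_affine[OF Ck_smooth_ramp, of k 1 "-1::real" 1] by (simp add: add.commute)
  then have "Ck k (\<lambda>t. ramp t * inverse (ramp t + ramp (1 - t)))"
    using ramp_sum_pos[THEN less_imp_neq] by (intro Ck_mult Ck_inverse Ck_add Ck_smooth_ramp) auto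
  then show ?thesis by (simp add: smooth_step_def[abs_def])
qed

lemma smooth_step_eq_0: "t \<le> 0 \<Longrightarrow> smooth_step t = 0"
  and smooth_step_eq_1: "t \<ge> 1 \<Longrightarrow> smooth_step t = 1"
  using ramp_sum_pos[of t] by (auto simp: smooth_step_def ramp_simps)

lemma smooth_step_bounds: "0 \<le> smooth_step t" "smooth_step t \<le> 1"
  using ramp_sum_pos[of t] ramp_bounds(1)[of t] ramp_bounds(1)[of "1 - t"]
  by (auto simp: smooth_step_def divide_inverse[symmetric] divide_le_eq_1)

lemma mono_smooth_step:
  assumes "s \<le> t"
  shows "smooth_step s \<le> smooth_step t"
proof -
  \<comment> \<open>This is the claim after cross-multiplication, the common term
    \<open>ramp s * ramp t\<close> being cancelled.\<close>
  have "ramp s * ramp (1 - t) \<le> ramp t * ramp (1 - s)"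
    using assms by (intro mult_mono mono_ramp ramp_bounds) auto
  then show ?thesis
    using ramp_sum_pos[of t] ramp_sum_pos[of s]
    by (simp add: smooth_step_def divide_inverse[symmetric] frac_le_eq divide_le_0_iff field_simps)
qed

section \<open>The fundamental lemma of the calculus of variations\<close>

text \<open>Dynkin's argument: open boxes are stable under intersection and generate the Borel sets.
  Case \<open>null\<close> then reaches Lebesgue sets, each of which differs from a Borel set within
  a null set. It serves twice: for vanishing integrals and for weak convergence.\<close>

lemma lebesgue_set_induct_box [consumes 1, case_names box empty compl union null]:
  fixes A :: "'a::euclidean_space set"
  assumes A: "A \<in> sets lebesgue"
    and box: "\<And>a b. P (box a b)"
    and empty: "P {}"
    and compl: "\<And>A. A \<in> sets lebesgue \<Longrightarrow> P A \<Longrightarrow> P (- A)"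
    and union: "\<And>A :: nat \<Rightarrow> 'a set. disjoint_family A \<Longrightarrow> range A \<subseteq> sets lebesgue \<Longrightarrow>
      (\<And>i. P (A i)) \<Longrightarrow> P (\<Union>i. A i)"
    and null: "\<And>A B. A \<in> sets lebesgue \<Longrightarrow> B \<in> sets lebesgue \<Longrightarrow>
      (AE x in lebesgue. x \<in> A \<longleftrightarrow> x \<in> B) \<Longrightarrow> P A \<Longrightarrow> P B"
  shows "P A"
proof -
  let ?G = "range (\<lambda>(a, b). box a b) :: 'a set set"
  have sets_eq: "sets borel = sigma_sets UNIV ?G"
    by (subst borel_eq_box) (simp add: sets_measure_of)
  have leb: "S \<in> sets lebesgue" if "S \<in> sigma_sets UNIV ?G" for S
    using that unfolding sets_eq[symmetric] by simp
  have borel: "P S" if "S \<in> sets borel" for S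
  proof -
    have "Int_stable ?G"
      by (auto simp: Int_stable_def box_Int_box)
    moreover have "?G \<subseteq> Pow UNIV" by simp
    moreover have "S \<in> sigma_sets UNIV ?G" using that sets_eq by simp
    ultimately show ?thesis
    proof (induction rule: sigma_sets_induct_disjoint)
      case (compl A)
      then show ?case using assms(4)[of A] leb by (simp add: Compl_eq_Diff_UNIV)
    next
      case (union A)
      then show ?case using assms(5)[of A] leb by blast
    qed (use box empty in auto)
  qed
  obtain S N N' where A_eq: "A = S \<union> N" and S: "S \<in> sets lborel" "N' \<in> null_sets lborel" "N \<subseteq> N'"
    using A by (elim sets_completionE) blast
  show ?thesis
  proof (rule null[OF _ A _ borel])
    have "AE x in lebesgue. x \<notin> N'"
      using S(2) by (intro AE_completion AE_not_in)
    then show "AE x in lebesgue. (x \<in> S) = (x \<in> A)"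
      using S(3) A_eq by (auto elim!: eventually_mono)
  qed (use S in auto)
qed

text \<open>The integral over the whole space enters through complements, whose integral is the
  total minus that over the set. A function whose integrals agree with those of 0 on every
  measurable set is 0 almost everywhere.\<close>

lemma AE_zero_if_box_integrals_zero:
  fixes h :: "'a::euclidean_space \<Rightarrow> real"
  assumes h: "integrable lebesgue h"
    and zero: "\<And>a b. (\<integral>x\<in>box a b. h x \<partial>lebesgue) = 0" "(\<integral>x. h x \<partial>lebesgue) = 0"
  shows "AE x in lebesgue. h x = 0"
proof (rule density_unique_real[OF h])
  have si: "set_integrable lebesgue S h" if "S \<in> sets lebesgue" for S
    using h that unfolding set_integrable_def by (intro integrable_mult_indicator)
  fix A :: "'a set" assume "A \<in> sets lebesgue"
  then have "(\<integral>x\<in>A. h x \<partial>lebesgue) = 0"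
  proof (induction rule: lebesgue_set_induct_box)
    case (box a b)
    show ?case by (rule zero)
  next
    case empty
    show ?case by (simp add: set_lebesgue_integral_def)
  next
    case (compl A)
    have "(\<integral>x\<in>A \<union> - A. h x \<partial>lebesgue) = (\<integral>x\<in>A. h x \<partial>lebesgue) + (\<integral>x\<in>-A. h x \<partial>lebesgue)"
      using compl sets.compl_sets[of A lebesgue]
      by (intro set_integral_Un si) (auto simp: Compl_eq_Diff_UNIV)
    then show ?case using compl zero(2) set_integral_space[OF h] by simp
  next
    case (union A)
    then have "(\<integral>x\<in>(\<Union>i. A i). h x \<partial>lebesgue) = (\<Sum>i. \<integral>x\<in>A i. h x \<partial>lebesgue)"
      by (intro lebesgue_integral_countable_add si) (auto simp: disjoint_family_on_def)
    then show ?case using union by simp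
  next
    case (null A B)
    have "(\<integral>x\<in>A. h x \<partial>lebesgue) = (\<integral>x\<in>B. h x \<partial>lebesgue)"
      unfolding set_lebesgue_integral_def using null(1-3) h
      by (intro integral_cong_AE) (auto elim!: eventually_mono simp: indicator_def)
    then show ?case using null by simp
  qed
  then show "(\<integral>x\<in>A. h x \<partial>lebesgue) = (\<integral>x\<in>A. 0 \<partial>lebesgue)" by simp
qed simp

text \<open>The factor \<open>n\<close> steepens the ramps: \<open>ramp (n s)\<close> tends to 1 for
  \<open>s > 0\<close> and is 0 otherwise. This gives smooth functions, bounded by 1, tending to the
  indicator of the open box without any mollification.\<close>

definition box_bump :: "'a \<Rightarrow> 'a \<Rightarrow> nat \<Rightarrow> 'a::euclidean_space \<Rightarrow> real" where
  "box_bump a b n x =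
     (\<Prod>i\<in>Basis. ramp (real n * (x \<bullet> i - a \<bullet> i)) * ramp (real n * (b \<bullet> i - x \<bullet> i)))"

lemma Ck_box_bump: "Ck k (box_bump a b n)"
proof -
  have "Ck k (\<lambda>x. ramp (x \<bullet> (real n *\<^sub>R i) + (- (real n * (a \<bullet> i)))) *
      ramp (x \<bullet> (- (real n *\<^sub>R i)) + real n * (b \<bullet> i)))" for i
    by (intro Ck_mult Ck_compose_affine Ck_smooth_ramp)
  then have "Ck k (\<lambda>x. \<Prod>i\<in>Basis. ramp (x \<bullet> (real n *\<^sub>R i) + (- (real n * (a \<bullet> i)))) *
      ramp (x \<bullet> (- (real n *\<^sub>R i)) + real n * (b \<bullet> i)))"
    by (intro Ck_prod) auto
  then show ?thesis by (simp add: box_bump_def[abs_def] algebra_simps)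
qed

lemma box_bump_bounds: "0 \<le> box_bump a b n x" "box_bump a b n x \<le> 1"
  unfolding box_bump_def
  by (auto intro!: prod_nonneg prod_le_1 mult_nonneg_nonneg mult_le_one ramp_bounds)

lemma box_bump_eq_0:
  assumes "x \<notin> box a b"
  shows "box_bump a b n x = 0"
proof -
  obtain i where i: "i \<in> Basis" "x \<bullet> i - a \<bullet> i \<le> 0 \<or> b \<bullet> i - x \<bullet> i \<le> 0"
    using assms by (auto simp: mem_box not_less)
  then have "ramp (real n * (x \<bullet> i - a \<bullet> i)) * ramp (real n * (b \<bullet> i - x \<bullet> i)) = 0"
    using mult_nonneg_nonpos[of "real n"] by (auto simp: ramp_simps(2))
  then show ?thesis
    unfolding box_bump_def prod_zero_iff[OF finite_Basis] using i(1) by blast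
qed

lemma box_bump_tendsto: "(\<lambda>n. box_bump a b n x) \<longlonglongrightarrow> indicator (box a b) x"
proof (cases "x \<in> box a b")
  case True
  have r: "(\<lambda>n. ramp (real n * s)) \<longlonglongrightarrow> 1" if "s > 0" for s
  proof (rule Lim_transform_eventually)
    have "(\<lambda>n. exp (- (inverse s * inverse (real n)))) \<longlonglongrightarrow> exp (- (inverse s * 0))"
      by (intro tendsto_intros lim_inverse_n)
    then show "(\<lambda>n. exp (- (inverse s * inverse (real n)))) \<longlonglongrightarrow> 1" by simp
    show "\<forall>\<^sub>F n in sequentially. exp (- (inverse s * inverse (real n))) = ramp (real n * s)"
      using eventually_gt_at_top[of 0] by (rule eventually_mono) (use that in \<open>simp add: ramp_simps\<close>)
  qed
  have "(\<lambda>n. box_bump a b n x) \<longlonglongrightarrow> (\<Prod>i\<in>(Basis::'a set). 1 * 1)"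
    unfolding box_bump_def by (intro tendsto_prod tendsto_mult r) (use True in \<open>auto simp: mem_box\<close>)
  then show ?thesis using True by simp
next
  case False
  then show ?thesis by (simp add: box_bump_eq_0)
qed

lemma test_function_box_bump:
  assumes "cbox a b \<subseteq> \<Omega>"
  shows "test_function \<Omega> (box_bump a b n)"
proof -
  have "{x. box_bump a b n x \<noteq> 0} \<subseteq> cbox a b"
    using box_bump_eq_0 box_subset_cbox by blast
  then have "closure {x. box_bump a b n x \<noteq> 0} \<subseteq> cbox a b"
    by (intro closure_minimal) auto
  then show ?thesis
    using assms Ck_box_bump unfolding test_function_def
    by (metis bounded_cbox bounded_subset closed_closure compact_eq_bounded_closed subset_trans)
qed

text \<open>The bumps of a box increase to its indicator, so \<open>g\<close> has vanishing integral over every box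
  inside the domain.\<close>

lemma fundamental_lemma_calculus_of_variations:
  fixes g :: "'a::euclidean_space \<Rightarrow> real"
  assumes \<Omega>: "open \<Omega>" and g: "integrable (lebesgue_on \<Omega>) g"
    and zero: "\<And>\<phi>. test_function \<Omega> \<phi> \<Longrightarrow> (\<integral>x. g x * \<phi> x \<partial>lebesgue_on \<Omega>) = 0"
  shows "AE x in lebesgue_on \<Omega>. g x = 0"
proof -
  have \<Omega>_leb: "\<Omega> \<in> sets lebesgue" using \<Omega> by simp
  have box0: "(\<integral>x. g x * indicator (box a b) x \<partial>lebesgue_on \<Omega>) = 0" if "cbox a b \<subseteq> \<Omega>" for a b
  proof -
    have "(\<lambda>n. \<integral>x. g x * box_bump a b n x \<partial>lebesgue_on \<Omega>) \<longlonglongrightarrow>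
        (\<integral>x. g x * indicator (box a b) x \<partial>lebesgue_on \<Omega>)"
    proof (rule integral_dominated_convergence[where w = "\<lambda>x. \<bar>g x\<bar>"])
      have "box_bump a b n \<in> borel_measurable (lebesgue_on \<Omega>)" for n
        using Ck_imp_continuous_on[OF Ck_box_bump]
        by (intro continuous_imp_measurable_on_sets_lebesgue \<Omega>_leb)
      then show "(\<lambda>x. g x * box_bump a b n x) \<in> borel_measurable (lebesgue_on \<Omega>)" for n
        using g by auto
      have "indicat_real (box a b) \<in> borel_measurable (lebesgue_on \<Omega>)"
        by (intro measurable_restrict_space1 borel_measurable_indicator) auto
      then show "(\<lambda>x. g x * indicator (box a b) x) \<in> borel_measurable (lebesgue_on \<Omega>)"
        using g by auto
      show "AE x in lebesgue_on \<Omega>. (\<lambda>n. g x * box_bump a b n x) \<longlonglongrightarrow> g x * indicator (box a b) x"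
        by (intro AE_I2 tendsto_intros box_bump_tendsto)
      show "AE x in lebesgue_on \<Omega>. norm (g x * box_bump a b n x) \<le> \<bar>g x\<bar>" for n
        by (intro AE_I2) (simp add: abs_mult box_bump_bounds mult_left_le)
    qed (use g in auto)
    then show ?thesis
      by (simp add: zero[OF test_function_box_bump[OF that]] LIMSEQ_const_iff)
  qed
  \<comment> \<open>Cutting \<open>g\<close> down to one box inside the domain and extending by zero
    gives a function on the whole space, where the criterion for box integrals applies.\<close>
  have cb: "AE x in lebesgue. x \<in> cbox c d \<longrightarrow> g x = 0" if "cbox c d \<subseteq> \<Omega>" for c d
  proof -
    have sub: "box c d \<subseteq> \<Omega>" using that box_subset_cbox by blast
    define h where "h = (\<lambda>x. indicator \<Omega> x *\<^sub>R (g x * indicator (box c d) x))"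
    have "integrable (lebesgue_on \<Omega>) (\<lambda>x. g x * indicator (box c d) x)"
      using sub by (intro integrable_real_mult_indicator g)
        (auto simp: sets_restrict_space_iff \<Omega>_leb)
    then have h: "integrable lebesgue h"
      unfolding h_def using \<Omega>_leb by (subst integrable_restrict_space[symmetric]) auto
    \<comment> \<open>Two boxes meet in a box, and its closed version still lies in
      \<open>cbox c d\<close>, hence in \<Omega>, so \<open>box0\<close> applies.\<close>
    have h_box: "(\<integral>x. h x * indicator (box a b) x \<partial>lebesgue) = 0" for a b
    proof -
      obtain p r where pr: "cbox a b \<inter> cbox c d = cbox p r" "box a b \<inter> box c d = box p r"
        unfolding Int_interval box_Int_box by blast
      have "(\<integral>x. h x * indicator (box a b) x \<partial>lebesgue) =
          (\<integral>x. indicator \<Omega> x *\<^sub>R (g x * indicator (box p r) x) \<partial>lebesgue)"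
        unfolding pr(2)[symmetric] by (simp add: h_def indicator_inter_arith ac_simps)
      also have "\<dots> = 0"
        using \<Omega>_leb box0[of p r] pr that by (subst integral_restrict_space[symmetric]) auto
      finally show ?thesis .
    qed
    \<comment> \<open>Since \<open>h\<close> has bounded support, its integral over the whole space
      is one over a large box.\<close>
    obtain a where a: "box c d \<subseteq> box (- a) a"
      using bounded_subset_box_symmetric[OF bounded_box] by blast
    have "(\<integral>x. h x \<partial>lebesgue) = (\<integral>x. h x * indicator (box (- a) a) x \<partial>lebesgue)"
      using a by (intro Bochner_Integration.integral_cong) (auto simp: h_def indicator_def)
    then have "AE x in lebesgue. h x = 0"
      using h_box by (intro AE_zero_if_box_integrals_zero[OF h])
        (auto simp: set_lebesgue_integral_def mult.commute)
    \<comment> \<open>\<open>h\<close> sees only the open box; the faces are null.\<close>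
    moreover have "AE x in lebesgue. x \<notin> cbox c d - box c d"
      using negligible_frontier_interval[of c d]
      by (intro AE_not_in) (simp add: negligible_iff_null_sets)
    ultimately show ?thesis
      by eventually_elim (use sub in \<open>auto simp: h_def indicator_def split: if_splits\<close>)
  qed
  \<comment> \<open>\<open>I\<close> indexes the closed boxes with rational corners inside \<Omega>.
    They cover \<Omega> and are countably many, so their exceptional null sets can be
    united.\<close>
  define l u :: "('a \<Rightarrow> real \<times> real) \<Rightarrow> 'a" where
    "l f = (\<Sum>i\<in>Basis. fst (f i) *\<^sub>R i)" and "u f = (\<Sum>i\<in>Basis. snd (f i) *\<^sub>R i)" for f
  define I where "I = {f \<in> Basis \<rightarrow>\<^sub>E \<rat> \<times> \<rat>. cbox (l f) (u f) \<subseteq> \<Omega>}"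
  have "countable I"
    unfolding I_def
    by (rule countable_subset[OF _ countable_PiE[of Basis "\<lambda>_. \<rat> \<times> \<rat>"]])
       (auto simp: countable_rat)
  then have "AE x in lebesgue. \<forall>f\<in>I. x \<in> cbox (l f) (u f) \<longrightarrow> g x = 0"
    using cb by (subst AE_ball_countable) (auto simp: I_def)
  moreover have "\<Omega> = (\<Union>f\<in>I. cbox (l f) (u f))"
    using open_UNION_cbox[OF \<Omega>] by (simp add: I_def l_def u_def)
  ultimately have "AE x in lebesgue. x \<in> \<Omega> \<longrightarrow> g x = 0"
    by (auto elim!: eventually_mono)
  then show ?thesis
    using \<Omega>_leb by (simp add: AE_restrict_space_iff)
qed

section \<open>Semi-inner products on \<open>L\<^sup>2\<close> and \<open>H\<^sup>1\<close>\<close>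

text \<open>The spaces are proper subsets of a function type and their norms are only seminorms,
  because elements are representatives. The type classes for normed spaces therefore do not fit, and
  the carrier is made explicit.\<close>

locale function_space =
  fixes X :: "('b \<Rightarrow> real) set"
  assumes zero_mem: "(\<lambda>x. 0) \<in> X"
    and add_mem: "u \<in> X \<Longrightarrow> v \<in> X \<Longrightarrow> (\<lambda>x. u x + v x) \<in> X"
    and scale_mem: "u \<in> X \<Longrightarrow> (\<lambda>x. c * u x) \<in> X"
begin

lemma diff_mem: "u \<in> X \<Longrightarrow> v \<in> X \<Longrightarrow> u - v \<in> X"
  using add_mem[of u "\<lambda>x. (-1) * v x"] scale_mem[of v "-1"] by (simp add: fun_diff_def)

end

locale seminormed_space = function_space X
  for X :: "('b \<Rightarrow> real) set" +
  fixes N :: "('b \<Rightarrow> real) \<Rightarrow> real"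
  assumes norm_triangle: "u \<in> X \<Longrightarrow> v \<in> X \<Longrightarrow> N (\<lambda>x. u x + v x) \<le> N u + N v"
    and norm_scale: "u \<in> X \<Longrightarrow> N (\<lambda>x. c * u x) = \<bar>c\<bar> * N u"
begin

lemma norm_zero: "N (\<lambda>x. 0) = 0"
  using norm_scale[OF zero_mem, of 0] by simp

lemma norm_diff_commute: "u \<in> X \<Longrightarrow> v \<in> X \<Longrightarrow> N (u - v) = N (v - u)"
  using norm_scale[of "v - u" "-1"] diff_mem[of v u] by (simp add: fun_diff_def)

lemma norm_diff_triangle:
  "u \<in> X \<Longrightarrow> v \<in> X \<Longrightarrow> w \<in> X \<Longrightarrow> N (u - w) \<le> N (u - v) + N (v - w)"
  using norm_triangle[of "u - v" "v - w"] diff_mem by (simp add: fun_diff_def)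

lemma norm_nonneg: "u \<in> X \<Longrightarrow> 0 \<le> N u"
  using norm_triangle[of u "\<lambda>x. (-1) * u x"] scale_mem[of u "-1"] norm_scale[of u "-1"] norm_zero
  by simp

lemma norm_reverse_triangle:
  assumes "u \<in> X" "v \<in> X"
  shows "\<bar>N u - N v\<bar> \<le> N (u - v)"
proof -
  have "N u \<le> N (u - v) + N v" "N v \<le> N (v - u) + N u"
    using norm_diff_triangle[OF assms(1,2) zero_mem] norm_diff_triangle[OF assms(2,1) zero_mem]
    by (simp_all add: fun_diff_def)
  then show ?thesis using norm_diff_commute[OF assms] by simp
qed

lemma norm_diff_le: "u \<in> X \<Longrightarrow> v \<in> X \<Longrightarrow> N (u - v) \<le> N u + N v"
  using norm_triangle[of u "\<lambda>x. (-1) * v x"] scale_mem[of v "-1"] norm_scale[of v "-1"]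
  by (simp add: fun_diff_def)

end

locale semi_inner_space = function_space X
  for X :: "('b \<Rightarrow> real) set" +
  fixes B :: "('b \<Rightarrow> real) \<Rightarrow> ('b \<Rightarrow> real) \<Rightarrow> real"
  assumes inner_add: "u \<in> X \<Longrightarrow> v \<in> X \<Longrightarrow> w \<in> X \<Longrightarrow> B (\<lambda>x. u x + v x) w = B u w + B v w"
    and inner_scale: "u \<in> X \<Longrightarrow> w \<in> X \<Longrightarrow> B (\<lambda>x. c * u x) w = c * B u w"
    and inner_commute: "u \<in> X \<Longrightarrow> v \<in> X \<Longrightarrow> B u v = B v u"
    and inner_nonneg: "u \<in> X \<Longrightarrow> 0 \<le> B u u"
begin

lemma inner_diff:
  assumes "u \<in> X" "v \<in> X" "w \<in> X"
  shows "B (u - v) w = B u w - B v w"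
  using inner_add[of u "\<lambda>x. (-1) * v x" w] scale_mem[of v "-1"] inner_scale[of v w "-1"] assms
  by (simp add: fun_diff_def)

lemma inner_add_self:
  assumes "u \<in> X" "v \<in> X"
  shows "B (\<lambda>x. u x + t * v x) (\<lambda>x. u x + t * v x) = B u u + 2 * t * B u v + t\<^sup>2 * B v v"
proof -
  note m = scale_mem[OF assms(2), of t]
  note a = add_mem[OF assms(1) m]
  have 1: "B u (\<lambda>x. u x + t * v x) = B u u + t * B u v"
    using inner_add[OF assms(1) m assms(1)] inner_scale[OF assms(2,1)]
      inner_commute[OF assms(1) a] inner_commute[OF assms] by simp
  have 2: "B v (\<lambda>x. u x + t * v x) = B u v + t * B v v"
    using inner_add[OF assms(1) m assms(2)] inner_scale[OF assms(2,2)]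
      inner_commute[OF assms(2) a] by simp
  show ?thesis
    using inner_add[OF assms(1) m a] inner_scale[OF assms(2) a, of t] 1 2
    by (simp add: algebra_simps power2_eq_square)
qed

lemma Cauchy_Schwarz_square:
  assumes "u \<in> X" "v \<in> X"
  shows "(B u v)\<^sup>2 \<le> B u u * B v v"
proof -
  have q: "0 \<le> B u u + 2 * t * B u v + t\<^sup>2 * B v v" for t
    using inner_nonneg[OF add_mem[OF assms(1) scale_mem[OF assms(2)]], of t]
      inner_add_self[OF assms] by simp
  show ?thesis
  proof (cases "B v v = 0")
    case True
    have "B u v = 0"
    proof (rule ccontr)
      assume nz: "B u v \<noteq> 0"
      \<comment> \<open>When \<open>B v v = 0\<close> the quadratic is affine in \<open>t\<close>;
        this \<open>t\<close> gives it the value -1.\<close>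
      have "2 * (- (B u u + 1) / (2 * B u v)) * B u v = - (B u u + 1)"
        using nz by simp
      then show False
        using q[of "- (B u u + 1) / (2 * B u v)"] True by simp
    qed
    then show ?thesis using True by simp
  next
    case False
    then have pos: "B v v > 0" using inner_nonneg[OF assms(2)] by linarith
    \<comment> \<open>The quadratic at its minimiser, multiplied by \<open>B v v\<close>.\<close>
    have "0 \<le> B v v * (B u u + 2 * (- (B u v / B v v)) * B u v + (- (B u v / B v v))\<^sup>2 * B v v)"
      using q[of "- (B u v / B v v)"] pos by (intro mult_nonneg_nonneg) auto
    also have "\<dots> = B u u * B v v - (B u v)\<^sup>2"
      using pos by (simp add: field_simps power2_eq_square)
    finally show ?thesis by simp
  qed
qed

lemma Cauchy_Schwarz:
  assumes "u \<in> X" "v \<in> X"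
  shows "\<bar>B u v\<bar> \<le> sqrt (B u u) * sqrt (B v v)"
  using real_sqrt_le_mono[OF Cauchy_Schwarz_square[OF assms]] by (simp add: real_sqrt_mult)

sublocale seminormed_space X "\<lambda>u. sqrt (B u u)"
proof
  fix u v assume uv: "u \<in> X" "v \<in> X"
  have "B (\<lambda>x. u x + v x) (\<lambda>x. u x + v x) = B u u + 2 * B u v + B v v"
    using inner_add_self[OF uv, of 1] by simp
  also have "\<dots> \<le> (sqrt (B u u) + sqrt (B v v))\<^sup>2"
    using Cauchy_Schwarz[OF uv] inner_nonneg[OF uv(1)] inner_nonneg[OF uv(2)]
    by (simp add: power2_sum)
  finally show "sqrt (B (\<lambda>x. u x + v x) (\<lambda>x. u x + v x)) \<le> sqrt (B u u) + sqrt (B v v)"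
    using inner_nonneg[OF uv(1)] inner_nonneg[OF uv(2)] by (intro real_le_lsqrt) auto
next
  fix u c assume u: "u \<in> X"
  have "B (\<lambda>x. c * u x) (\<lambda>x. c * u x) = c\<^sup>2 * B u u"
    using inner_scale[OF u scale_mem[OF u]] inner_commute[OF u scale_mem[OF u]] inner_scale[OF u u]
    by (simp add: power2_eq_square)
  then show "sqrt (B (\<lambda>x. c * u x) (\<lambda>x. c * u x)) = \<bar>c\<bar> * sqrt (B u u)"
    by (simp add: real_sqrt_mult)
qed

end

section \<open>Square-integrable functions over an arbitrary measure\<close>

lemma integrable_mult_L2:
  assumes "f \<in> L2 M" "g \<in> L2 M"
  shows "integrable M (\<lambda>x. f x * g x)"
proof (rule Bochner_Integration.integrable_bound)
  show "integrable M (\<lambda>x. (f x)\<^sup>2 + (g x)\<^sup>2)"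
    using assms by (auto simp: L2_def)
  show "AE x in M. norm (f x * g x) \<le> norm ((f x)\<^sup>2 + (g x)\<^sup>2)"
  proof (rule AE_I2)
    fix x
    show "norm (f x * g x) \<le> norm ((f x)\<^sup>2 + (g x)\<^sup>2)"
      using sum_squares_bound[of "\<bar>f x\<bar>" "\<bar>g x\<bar>"] mult_nonneg_nonneg[of "\<bar>f x\<bar>" "\<bar>g x\<bar>"]
      unfolding real_norm_def abs_mult power2_abs by linarith
  qed
qed (use assms in \<open>auto simp: L2_def\<close>)

lemma semi_inner_space_L2: "semi_inner_space (L2 M) (L2_inner M)"
proof
  fix u v w :: "'a \<Rightarrow> real" and c :: real
  assume u: "u \<in> L2 M"
  show "(\<lambda>x. c * u x) \<in> L2 M"
    using u by (auto simp: L2_def power_mult_distrib)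
  show "0 \<le> L2_inner M u u"
    by (simp add: L2_inner_def)
  assume v: "v \<in> L2 M"
  show "(\<lambda>x. u x + v x) \<in> L2 M"
    using u v integrable_mult_L2[OF u v] by (auto simp: L2_def power2_sum mult.assoc)
  show "L2_inner M u v = L2_inner M v u"
    by (simp add: L2_inner_def mult.commute)
  show "L2_inner M (\<lambda>x. c * u x) v = c * L2_inner M u v"
    by (simp add: L2_inner_def mult.assoc)
  assume w: "w \<in> L2 M"
  show "L2_inner M (\<lambda>x. u x + v x) w = L2_inner M u w + L2_inner M v w"
    using integrable_mult_L2[OF u w] integrable_mult_L2[OF v w]
    by (simp add: L2_inner_def distrib_right)
qed (simp add: L2_def)

lemma L2_norm_eq: "L2_norm M = (\<lambda>f. sqrt (L2_inner M f f))"
  by (simp add: fun_eq_iff L2_norm_def L2_inner_def power2_eq_square)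

text \<open>The measure stays free, so this one interpretation serves the domain, the boundary and
  time intervals alike.\<close>

interpretation L2: semi_inner_space "L2 M" "L2_inner M"
  rewrites "\<And>f. sqrt (L2_inner M f f) = L2_norm M f"
  by (auto simp: L2_norm_eq semi_inner_space_L2)

text \<open>Outside the closed support the function vanishes on an open set, so its derivative does
  too; on the compact support continuity gives the bound.\<close>

lemma test_function_derivative:
  assumes \<phi>: "test_function \<Omega> \<phi>" and i: "i \<in> Basis"
  shows "continuous_on UNIV (\<lambda>x. frechet_derivative \<phi> (at x) i)"
    and "\<exists>C. \<forall>x. \<bar>frechet_derivative \<phi> (at x) i\<bar> \<le> C"
proof -
  let ?K = "closure {x. \<phi> x \<noteq> 0}" and ?d = "\<lambda>x. frechet_derivative \<phi> (at x) i"
  have "Ck (Suc 0) \<phi>" using \<phi> by (simp only: test_function_def)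
  then show cont: "continuous_on UNIV ?d"
    using i by simp
  have "?d x = 0" if "x \<notin> ?K" for x
  proof -
    have "(\<phi> has_derivative (\<lambda>h. 0)) (at x)"
      by (rule has_derivative_transform_within_open[where f = "\<lambda>x. 0" and s = "- ?K"])
         (use that closure_subset[of "{x. \<phi> x \<noteq> 0}"] in auto)
    then show ?thesis by (simp add: frechet_derivative_at[symmetric])
  qed
  moreover have "compact (?d ` ?K)"
    using \<phi> cont by (intro compact_continuous_image) (auto simp: test_function_def intro: continuous_on_subset)
  then obtain C where "\<forall>y\<in>?d ` ?K. norm y \<le> C"
    using compact_imp_bounded bounded_iff by metis
  ultimately have "\<bar>?d x\<bar> \<le> max C 0" for x
    by (cases "x \<in> ?K") (auto simp: le_max_iff_disj)
  then show "\<exists>C. \<forall>x. \<bar>?d x\<bar> \<le> C" by blast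
qed

lemma test_function_continuous: "test_function \<Omega> \<phi> \<Longrightarrow> continuous_on UNIV \<phi>"
  using Ck_imp_continuous_on unfolding test_function_def by blast

lemma test_function_bounded:
  assumes \<phi>: "test_function \<Omega> \<phi>"
  shows "\<exists>C. \<forall>x. \<bar>\<phi> x\<bar> \<le> C"
proof -
  let ?K = "closure {x. \<phi> x \<noteq> 0}"
  have "compact (\<phi> ` ?K)"
    using \<phi> test_function_continuous[OF \<phi>]
    by (intro compact_continuous_image) (auto simp: test_function_def intro: continuous_on_subset)
  then obtain C where C: "\<forall>y\<in>\<phi> ` ?K. norm y \<le> C"
    using compact_imp_bounded bounded_iff by metis
  have "\<bar>\<phi> x\<bar> \<le> max C 0" for x
    using C closure_subset[of "{x. \<phi> x \<noteq> 0}"] by (cases "\<phi> x = 0") (auto simp: le_max_iff_disj)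
  then show ?thesis by blast
qed

lemma integrable_mult_continuous_bounded:
  fixes g \<psi> :: "'a::euclidean_space \<Rightarrow> real"
  assumes S: "S \<in> sets lebesgue" and g: "integrable (lebesgue_on S) g"
    and \<psi>: "continuous_on UNIV \<psi>" "\<exists>C. \<forall>x. \<bar>\<psi> x\<bar> \<le> C"
  shows "integrable (lebesgue_on S) (\<lambda>x. g x * \<psi> x)"
proof -
  obtain C where C: "\<And>x. \<bar>\<psi> x\<bar> \<le> C" using \<psi>(2) by blast
  have [measurable]: "\<psi> \<in> borel_measurable (lebesgue_on S)"
    using \<psi>(1) S by (intro continuous_imp_measurable_on_sets_lebesgue continuous_on_subset[OF \<psi>(1)]) auto
  have "integrable (lebesgue_on S) (\<lambda>x. C * g x)" using g by simp
  then show ?thesis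
    by (rule Bochner_Integration.integrable_bound)
       (use g C in \<open>auto intro!: AE_I2 mult_right_mono intro: order_trans[OF _ abs_ge_self]
         simp: abs_mult mult.commute[of "\<bar>g _\<bar>"]\<close>)
qed

lemma L2_imp_integrable:
  assumes "finite_measure M" "f \<in> L2 M"
  shows "integrable M f"
proof -
  interpret finite_measure M by fact
  have "(\<lambda>x. 1) \<in> L2 M" by (simp add: L2_def)
  from integrable_mult_L2[OF assms(2) this] show ?thesis by simp
qed

text \<open>Boundedness makes the measure finite, so that functions in \<open>L2\<close> and
  components of weak gradients are integrable. The fundamental lemma is stated for integrable
  functions.\<close>

locale bounded_open_set =
  fixes \<Omega> :: "'a::euclidean_space set"
  assumes open_\<Omega>: "open \<Omega>" and bounded_\<Omega>: "bounded \<Omega>"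
begin

lemma sets_\<Omega>: "\<Omega> \<in> sets lebesgue"
  using open_\<Omega> by simp

lemma finite_measure_\<Omega>: "finite_measure (lebesgue_on \<Omega>)"
proof (rule finite_measureI)
  have "emeasure lebesgue \<Omega> < top"
    using bounded_set_imp_lmeasurable[OF bounded_\<Omega> sets_\<Omega>] unfolding fmeasurable_def infinity_ennreal_def by blast
  then show "emeasure (lebesgue_on \<Omega>) (space (lebesgue_on \<Omega>)) \<noteq> \<infinity>"
    using sets_\<Omega> by (simp add: emeasure_restrict_space)
qed

lemma integrable_weak_gradient_component:
  assumes "is_weak_gradient \<Omega> v G"
  shows "integrable (lebesgue_on \<Omega>) (\<lambda>x. G x \<bullet> i)"
proof -
  have G: "G \<in> borel_measurable (lebesgue_on \<Omega>)" "integrable (lebesgue_on \<Omega>) (\<lambda>x. (norm (G x))\<^sup>2)"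
    using assms by (auto simp: is_weak_gradient_def)
  then have "(\<lambda>x. norm (G x)) \<in> L2 (lebesgue_on \<Omega>)" by (simp add: L2_def)
  then have "integrable (lebesgue_on \<Omega>) (\<lambda>x. norm (G x))"
    by (rule L2_imp_integrable[OF finite_measure_\<Omega>])
  then have "integrable (lebesgue_on \<Omega>) G" using G(1) integrable_norm_iff by blast
  then show ?thesis by simp
qed

lemma weak_gradient_AE_unique:
  assumes G: "is_weak_gradient \<Omega> v G" and H: "is_weak_gradient \<Omega> v H"
  shows "AE x in lebesgue_on \<Omega>. G x = H x"
proof -
  have "AE x in lebesgue_on \<Omega>. G x \<bullet> i - H x \<bullet> i = 0" if i: "i \<in> Basis" for i
  proof (rule fundamental_lemma_calculus_of_variations[OF open_\<Omega>])
    note int = integrable_weak_gradient_component[OF G, of i] integrable_weak_gradient_component[OF H, of i]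
    show "integrable (lebesgue_on \<Omega>) (\<lambda>x. G x \<bullet> i - H x \<bullet> i)"
      using int by simp
    fix \<phi> assume \<phi>: "test_function \<Omega> \<phi>"
    note int\<phi> = int[THEN integrable_mult_continuous_bounded[OF sets_\<Omega> _
          test_function_continuous[OF \<phi>] test_function_bounded[OF \<phi>]]]
    have "(\<integral>x. v x * frechet_derivative \<phi> (at x) i \<partial>lebesgue_on \<Omega>) =
        - (\<integral>x. (F x \<bullet> i) * \<phi> x \<partial>lebesgue_on \<Omega>)" if "is_weak_gradient \<Omega> v F" for F
      using that \<phi> i by (simp add: is_weak_gradient_def)
    from this[OF G] this[OF H]
    have "(\<integral>x. (G x \<bullet> i) * \<phi> x \<partial>lebesgue_on \<Omega>) = (\<integral>x. (H x \<bullet> i) * \<phi> x \<partial>lebesgue_on \<Omega>)"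
      by simp
    then show "(\<integral>x. (G x \<bullet> i - H x \<bullet> i) * \<phi> x \<partial>lebesgue_on \<Omega>) = 0"
      using int\<phi> by (simp add: left_diff_distrib)
  qed
  then have "AE x in lebesgue_on \<Omega>. \<forall>i\<in>Basis. G x \<bullet> i - H x \<bullet> i = 0"
    by (simp add: AE_ball_countable countable_finite)
  then show ?thesis by eventually_elim (auto intro: euclidean_eqI)
qed

lemma weak_grad: "v \<in> H1 \<Omega> \<Longrightarrow> is_weak_gradient \<Omega> v (weak_grad \<Omega> v)"
  unfolding weak_grad_def H1_def by (auto intro: someI[of "is_weak_gradient \<Omega> _"])

lemma integrable_inner_weak_gradient:
  assumes "is_weak_gradient \<Omega> u G" "is_weak_gradient \<Omega> v H"
  shows "integrable (lebesgue_on \<Omega>) (\<lambda>x. G x \<bullet> H x)"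
proof (rule Bochner_Integration.integrable_bound)
  show "integrable (lebesgue_on \<Omega>) (\<lambda>x. norm (G x) * norm (H x))"
    using assms by (intro integrable_mult_L2) (auto simp: L2_def is_weak_gradient_def)
  show "(\<lambda>x. G x \<bullet> H x) \<in> borel_measurable (lebesgue_on \<Omega>)"
    using assms by (intro borel_measurable_inner) (auto simp: is_weak_gradient_def)
qed (auto simp: Cauchy_Schwarz_ineq2)

lemma is_weak_gradient_add:
  assumes u: "u \<in> L2 (lebesgue_on \<Omega>)" "is_weak_gradient \<Omega> u G"
    and v: "v \<in> L2 (lebesgue_on \<Omega>)" "is_weak_gradient \<Omega> v H"
  shows "is_weak_gradient \<Omega> (\<lambda>x. u x + v x) (\<lambda>x. G x + H x)"
  unfolding is_weak_gradient_def
proof (intro conjI allI impI)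
  have meas: "G \<in> borel_measurable (lebesgue_on \<Omega>)" "H \<in> borel_measurable (lebesgue_on \<Omega>)"
    using u v by (auto simp: is_weak_gradient_def)
  then show "(\<lambda>x. G x + H x) \<in> borel_measurable (lebesgue_on \<Omega>)" by auto
  show "integrable (lebesgue_on \<Omega>) (\<lambda>x. (norm (G x + H x))\<^sup>2)"
    using integrable_inner_weak_gradient[OF u(2) u(2)] integrable_inner_weak_gradient[OF u(2) v(2)]
      integrable_inner_weak_gradient[OF v(2) u(2)] integrable_inner_weak_gradient[OF v(2) v(2)]
    by (simp add: power2_norm_eq_inner inner_add_left inner_add_right)
  fix \<phi> and i :: 'a assume "test_function \<Omega> \<phi> \<and> i \<in> Basis"
  then have \<phi>: "test_function \<Omega> \<phi>" and i: "i \<in> Basis" by auto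
  have 1: "integrable (lebesgue_on \<Omega>) (\<lambda>x. f x * frechet_derivative \<phi> (at x) i)"
    if "f \<in> L2 (lebesgue_on \<Omega>)" for f
    using test_function_derivative[OF \<phi> i] L2_imp_integrable[OF finite_measure_\<Omega> that]
    by (intro integrable_mult_continuous_bounded sets_\<Omega>)
  have 2: "integrable (lebesgue_on \<Omega>) (\<lambda>x. (F x \<bullet> i) * \<phi> x)" if "is_weak_gradient \<Omega> f F" for f F
    using integrable_weak_gradient_component[OF that]
    by (intro integrable_mult_continuous_bounded sets_\<Omega> test_function_continuous[OF \<phi>] test_function_bounded[OF \<phi>])
  have "(\<integral>x. u x * frechet_derivative \<phi> (at x) i \<partial>lebesgue_on \<Omega>) = - (\<integral>x. (G x \<bullet> i) * \<phi> x \<partial>lebesgue_on \<Omega>)"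
    "(\<integral>x. v x * frechet_derivative \<phi> (at x) i \<partial>lebesgue_on \<Omega>) = - (\<integral>x. (H x \<bullet> i) * \<phi> x \<partial>lebesgue_on \<Omega>)"
    using u(2) v(2) \<phi> i by (auto simp: is_weak_gradient_def)
  then show "(\<integral>x. (u x + v x) * frechet_derivative \<phi> (at x) i \<partial>lebesgue_on \<Omega>) =
      - (\<integral>x. ((G x + H x) \<bullet> i) * \<phi> x \<partial>lebesgue_on \<Omega>)"
    using 1[OF u(1)] 1[OF v(1)] 2[OF u(2)] 2[OF v(2)]
    by (simp add: distrib_right inner_add_left)
qed

lemma is_weak_gradient_scale:
  assumes "is_weak_gradient \<Omega> u G"
  shows "is_weak_gradient \<Omega> (\<lambda>x. c * u x) (\<lambda>x. c *\<^sub>R G x)"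
  using assms unfolding is_weak_gradient_def
  by (auto simp: power_mult_distrib mult.assoc)

lemma H1_add: "u \<in> H1 \<Omega> \<Longrightarrow> v \<in> H1 \<Omega> \<Longrightarrow> (\<lambda>x. u x + v x) \<in> H1 \<Omega>"
  unfolding H1_def using L2.add_mem is_weak_gradient_add by blast

lemma H1_scale: "u \<in> H1 \<Omega> \<Longrightarrow> (\<lambda>x. c * u x) \<in> H1 \<Omega>"
  unfolding H1_def using L2.scale_mem is_weak_gradient_scale by blast

lemma H1_imp_L2: "u \<in> H1 \<Omega> \<Longrightarrow> u \<in> L2 (lebesgue_on \<Omega>)"
  by (simp add: H1_def)

text \<open>\<open>weak_grad\<close> is a choice and not literally linear. Being free to use any
  weak gradient, such as the sum of two chosen ones, is what yields bilinearity.\<close>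

lemma dirichlet_form_eq:
  assumes "is_weak_gradient \<Omega> u G" "is_weak_gradient \<Omega> v H"
  shows "dirichlet_form \<Omega> u v = (\<integral>x. G x \<bullet> H x \<partial>lebesgue_on \<Omega>)"
proof -
  have w: "is_weak_gradient \<Omega> u (weak_grad \<Omega> u)" "is_weak_gradient \<Omega> v (weak_grad \<Omega> v)"
    unfolding weak_grad_def using assms by (auto intro: someI[of "is_weak_gradient \<Omega> _"])
  have "AE x in lebesgue_on \<Omega>. weak_grad \<Omega> u x \<bullet> weak_grad \<Omega> v x = G x \<bullet> H x"
    using weak_gradient_AE_unique[OF w(1) assms(1)] weak_gradient_AE_unique[OF w(2) assms(2)]
    by eventually_elim simp
  then show ?thesis unfolding dirichlet_form_def
    using integrable_inner_weak_gradient[OF w] integrable_inner_weak_gradient[OF assms]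
    by (intro integral_cong_AE) auto
qed

sublocale dirichlet: semi_inner_space "H1 \<Omega>" "dirichlet_form \<Omega>"
proof
  have "is_weak_gradient \<Omega> (\<lambda>x. 0) (\<lambda>x. 0)"
    by (simp add: is_weak_gradient_def)
  then show "(\<lambda>x. 0) \<in> H1 \<Omega>" using L2.zero_mem by (auto simp: H1_def)
  fix u v w :: "'a \<Rightarrow> real" and c :: real
  assume u: "u \<in> H1 \<Omega>"
  show "(\<lambda>x. c * u x) \<in> H1 \<Omega>" using u by (rule H1_scale)
  show "0 \<le> dirichlet_form \<Omega> u u" by (simp add: dirichlet_form_def)
  assume v: "v \<in> H1 \<Omega>"
  show "(\<lambda>x. u x + v x) \<in> H1 \<Omega>" using u v by (rule H1_add)
  show "dirichlet_form \<Omega> u v = dirichlet_form \<Omega> v u"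
    by (simp add: dirichlet_form_def inner_commute)
  show "dirichlet_form \<Omega> (\<lambda>x. c * u x) v = c * dirichlet_form \<Omega> u v"
    by (subst dirichlet_form_eq[OF is_weak_gradient_scale[OF weak_grad[OF u]] weak_grad[OF v]])
      (simp add: dirichlet_form_def)
  assume w: "w \<in> H1 \<Omega>"
  show "dirichlet_form \<Omega> (\<lambda>x. u x + v x) w = dirichlet_form \<Omega> u w + dirichlet_form \<Omega> v w"
    using integrable_inner_weak_gradient[OF weak_grad[OF u] weak_grad[OF w]]
      integrable_inner_weak_gradient[OF weak_grad[OF v] weak_grad[OF w]]
    by (subst dirichlet_form_eq[OF is_weak_gradient_add[OF H1_imp_L2[OF u] weak_grad[OF u]
            H1_imp_L2[OF v] weak_grad[OF v]] weak_grad[OF w]])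
      (simp add: dirichlet_form_def inner_add_left)
qed

text \<open>Exhibits \<open>H1_norm\<close> as the seminorm of a semi-inner product, so the triangle
  inequality comes from the locale.\<close>

definition H1_inner :: "('a \<Rightarrow> real) \<Rightarrow> ('a \<Rightarrow> real) \<Rightarrow> real" where
  "H1_inner u v = L2_inner (lebesgue_on \<Omega>) u v + dirichlet_form \<Omega> u v"

lemma H1_norm_eq: "sqrt (H1_inner v v) = H1_norm \<Omega> v"
  using L2.inner_nonneg
  by (simp add: H1_inner_def H1_norm_def L2_norm_def L2_inner_def dirichlet_form_def
      power2_eq_square[symmetric] power2_norm_eq_inner)

sublocale H1: semi_inner_space "H1 \<Omega>" H1_inner
  rewrites "\<And>v. sqrt (H1_inner v v) = H1_norm \<Omega> v"
proof -
  show "semi_inner_space (H1 \<Omega>) H1_inner"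
    by standard
      (auto simp: H1_inner_def H1_imp_L2 L2.inner_add L2.inner_scale dirichlet.inner_add
        dirichlet.inner_scale distrib_left L2.inner_nonneg dirichlet.inner_nonneg
        L2.inner_commute dirichlet.inner_commute)
qed (rule H1_norm_eq)

lemma L2_norm_le_H1_norm: "L2_norm (lebesgue_on \<Omega>) v \<le> H1_norm \<Omega> v"
  by (auto simp: H1_norm_def intro!: real_le_rsqrt)

end

section \<open>Bochner functions with values in a seminormed space and its dual\<close>

lemma complete_measure_lebesgue_on:
  assumes "S \<in> sets lebesgue"
  shows "complete_measure (lebesgue_on S)"
proof
  fix A B :: "'a set" assume "B \<subseteq> A" "A \<in> null_sets (lebesgue_on S)"
  then show "B \<in> sets (lebesgue_on S)"
    using assms completion.complete2[of B A lborel]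
    by (auto simp: null_sets_restrict_space sets_restrict_space_iff)
qed

lemma (in complete_measure) borel_measurable_AE_eq:
  assumes f: "f \<in> borel_measurable M" and eq: "AE x in M. f x = g x"
  shows "g \<in> borel_measurable M"
proof (rule measurableI)
  fix A :: "'b set" assume "A \<in> sets borel"
  then have "f -` A \<inter> space M \<in> sets M" using f by (rule measurable_sets[rotated])
  then show "g -` A \<inter> space M \<in> sets M"
    by (rule in_sets_AE[rotated]) (use eq AE_space[of M] in \<open>auto elim!: eventually_elim2\<close>)
qed simp

text \<open>Strong measurability provides only almost-everywhere limits of simple functions. The
  total operator \<open>lim\<close> gives a measurable candidate, and completeness transfers
  measurability across the null set.\<close>

lemma (in complete_measure) borel_measurable_AE_limit:
  fixes f :: "'a \<Rightarrow> real"
  assumes s: "\<And>k. s k \<in> borel_measurable M" and lim: "AE x in M. (\<lambda>k. s k x) \<longlonglongrightarrow> f x"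
  shows "f \<in> borel_measurable M"
proof (rule borel_measurable_AE_eq)
  show "(\<lambda>x. lim (\<lambda>k. s k x)) \<in> borel_measurable M"
    using s by (rule borel_measurable_lim_metric)
  show "AE x in M. lim (\<lambda>k. s k x) = f x"
    using lim by eventually_elim (rule limI)
qed

text \<open>Finitely many values stay finitely many under any map, so the composite is again simple,
  whatever \<open>N\<close> is.\<close>

lemma borel_measurable_compose_simple_function:
  fixes N :: "'c \<Rightarrow> real"
  assumes "simple_function M s"
  shows "(\<lambda>t. N (s t)) \<in> borel_measurable M"
  using simple_function_compose1[OF assms, of N] by (rule borel_measurable_simple_function)

context seminormed_space
begin

lemma tendsto_norm:
  assumes "(\<lambda>k. N (s k - f)) \<longlonglongrightarrow> 0" "\<And>k. s k \<in> X" "f \<in> X"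
  shows "(\<lambda>k. N (s k)) \<longlonglongrightarrow> N f"
proof -
  have "(\<lambda>k. N (s k) - N f) \<longlonglongrightarrow> 0"
    by (rule Lim_null_comparison[OF always_eventually assms(1)])
       (use norm_reverse_triangle assms in auto)
  then show ?thesis by (simp add: LIM_zero_iff)
qed

lemma strongly_measurable_norm:
  assumes M: "complete_measure M" and f: "strongly_measurable M X N f"
  shows "(\<lambda>t. N (f t)) \<in> borel_measurable M"
proof -
  interpret complete_measure M by fact
  obtain s where s: "\<And>k. simple_function M (s k)" "\<And>k. s k ` space M \<subseteq> X"
    and lim: "AE t in M. (\<lambda>k. N (s k t - f t)) \<longlonglongrightarrow> 0" and fX: "AE t in M. f t \<in> X"
    using f unfolding strongly_measurable_def by blast
  show ?thesis
  proof (rule borel_measurable_AE_limit)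
    show "(\<lambda>t. N (s k t)) \<in> borel_measurable M" for k
      using s(1) by (rule borel_measurable_compose_simple_function)
    show "AE t in M. (\<lambda>k. N (s k t)) \<longlonglongrightarrow> N (f t)"
      using lim fX AE_space by eventually_elim (rule tendsto_norm, use s in auto)
  qed
qed

lemma strongly_measurable_diff_simple:
  assumes f: "strongly_measurable M X N f"
    and s: "simple_function M s" "s ` space M \<subseteq> X"
  shows "strongly_measurable M X N (\<lambda>t. f t - s t)"
proof -
  obtain r where r: "\<And>k. simple_function M (r k)" "\<And>k. r k ` space M \<subseteq> X"
    and lim: "AE t in M. (\<lambda>k. N (r k t - f t)) \<longlonglongrightarrow> 0" and fX: "AE t in M. f t \<in> X"
    using f unfolding strongly_measurable_def by blast
  have "AE t in M. f t - s t \<in> X"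
    using fX AE_space by eventually_elim (use s diff_mem in auto)
  moreover have "simple_function M (\<lambda>t. r k t - s t)" for k
    using simple_function_compose2[OF r(1)[of k] s(1), of "(-)"] .
  moreover have "(\<lambda>t. r k t - s t) ` space M \<subseteq> X" for k
    using r(2)[of k] s(2) diff_mem by auto
  moreover have "AE t in M. (\<lambda>k. N (r k t - s t - (f t - s t))) \<longlonglongrightarrow> 0"
    using lim by eventually_elim (simp add: fun_diff_def)
  ultimately have "(AE t in M. f t - s t \<in> X) \<and> (\<forall>k. simple_function M (\<lambda>t. r k t - s t) \<and>
      (\<lambda>t. r k t - s t) ` space M \<subseteq> X) \<and>
      (AE t in M. (\<lambda>k. N (r k t - s t - (f t - s t))) \<longlonglongrightarrow> 0)"
    by blast
  then show ?thesis
    unfolding strongly_measurable_def by (intro conjI exI[of _ "\<lambda>k t. r k t - s t"]) simp_all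
qed

lemma bochner_L2_norm:
  assumes "complete_measure M" "f \<in> bochner_L2 M X N"
  shows "(\<lambda>t. N (f t)) \<in> L2 M"
proof -
  have m: "(\<lambda>t. N (f t)) \<in> borel_measurable M"
    using assms strongly_measurable_norm by (auto simp: bochner_L2_def)
  then show ?thesis
    using assms(2) by (auto simp: L2_def bochner_L2_def intro!: integrableI_nonneg)
qed

text \<open>The approximating simple functions are cut off where their norm exceeds twice that of the
  limit, which makes dominated convergence applicable.\<close>

lemma bochner_L2_simple_approximation:
  assumes M: "complete_measure M" and f: "f \<in> bochner_L2 M X N" and \<epsilon>: "\<epsilon> > 0"
  obtains s where "simple_function M s" "s ` space M \<subseteq> X"
    "(\<lambda>t. N (f t - s t)) \<in> L2 M" "L2_norm M (\<lambda>t. N (f t - s t)) \<le> \<epsilon>"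
proof -
  have sm: "strongly_measurable M X N f" using f by (simp add: bochner_L2_def)
  obtain r where r: "\<And>k. simple_function M (r k)" "\<And>k. r k ` space M \<subseteq> X"
    and lim: "AE t in M. (\<lambda>k. N (r k t - f t)) \<longlonglongrightarrow> 0" and fX: "AE t in M. f t \<in> X"
    using sm unfolding strongly_measurable_def by blast
  note Nf = bochner_L2_norm[OF M f]
  then have [measurable]: "(\<lambda>t. N (f t)) \<in> borel_measurable M" by (simp add: L2_def)
  define s where "s k t = (if N (r k t) \<le> 2 * N (f t) then r k t else (\<lambda>x. 0))" for k t
  have s_simple: "simple_function M (s k)" for k
  proof -
    have [measurable]: "(\<lambda>t. N (r k t)) \<in> borel_measurable M"
      using r(1) by (rule borel_measurable_compose_simple_function)
    show ?thesis unfolding s_def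
      by (rule simple_function_If[OF r(1) simple_function_const]) measurable
  qed
  have s_X: "s k ` space M \<subseteq> X" for k
    using r(2)[of k] zero_mem by (auto simp: s_def)
  have meas: "(\<lambda>t. N (f t - s k t)) \<in> borel_measurable M" for k
    by (intro strongly_measurable_norm M strongly_measurable_diff_simple sm s_simple s_X)
  \<comment> \<open>Where \<open>r k t\<close> is kept its norm is at most \<open>2 N (f t)\<close>,
    and the triangle inequality adds one more; where it is cut off only \<open>N (f t)\<close>
    remains. The factor 9 below is the square of 3.\<close>
  have bound: "N (f t - s k t) \<le> 3 * N (f t)" if "f t \<in> X" "t \<in> space M" for k t
    using norm_diff_le[of "f t" "r k t"] norm_nonneg[of "f t"] r(2)[of k] that
    by (auto simp: s_def fun_diff_def)
  have L2k: "(\<lambda>t. N (f t - s k t)) \<in> L2 M" for k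
    unfolding L2_def
  proof (intro CollectI conjI meas, rule Bochner_Integration.integrable_bound)
    show "integrable M (\<lambda>t. 9 * (N (f t))\<^sup>2)" using Nf by (simp add: L2_def)
    show "AE t in M. norm ((N (f t - s k t))\<^sup>2) \<le> norm (9 * (N (f t))\<^sup>2)"
      using fX AE_space
    proof eventually_elim
      case (elim t)
      have "0 \<le> N (f t - s k t)"
        using elim s_X by (intro norm_nonneg diff_mem) auto
      then have "(N (f t - s k t))\<^sup>2 \<le> (3 * N (f t))\<^sup>2"
        using bound[OF elim, of k] by (intro power_mono)
      then show ?case by (simp add: power_mult_distrib)
    qed
  qed (use meas in measurable)
  have "(\<lambda>k. \<integral>t. (N (f t - s k t))\<^sup>2 \<partial>M) \<longlonglongrightarrow> (\<integral>t. 0 \<partial>M)"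
  proof (rule integral_dominated_convergence[where w = "\<lambda>t. 9 * (N (f t))\<^sup>2"])
    show "integrable M (\<lambda>t. 9 * (N (f t))\<^sup>2)" using Nf by (simp add: L2_def)
    show "(\<lambda>t. (N (f t - s k t))\<^sup>2) \<in> borel_measurable M" for k using meas by measurable
    show "AE t in M. norm ((N (f t - s k t))\<^sup>2) \<le> 9 * (N (f t))\<^sup>2" for k
      using fX AE_space
    proof eventually_elim
      case (elim t)
      have "0 \<le> N (f t - s k t)"
        using elim s_X by (intro norm_nonneg diff_mem) auto
      then have "(N (f t - s k t))\<^sup>2 \<le> (3 * N (f t))\<^sup>2"
        using bound[OF elim, of k] by (intro power_mono)
      then show ?case by (simp add: power_mult_distrib)
    qed
    show "AE t in M. (\<lambda>k. (N (f t - s k t))\<^sup>2) \<longlonglongrightarrow> 0"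
      using fX lim AE_space
    proof eventually_elim
      case (elim t)
      have rX: "r k t \<in> X" for k using r(2) elim by auto
      have "(\<lambda>k. N (f t - s k t)) \<longlonglongrightarrow> 0"
      \<comment> \<open>If \<open>N (f t) > 0\<close>, the norms \<open>N (r k t)\<close> eventually
        fall below \<open>2 N (f t)\<close> and the cut-off becomes inactive. If
        \<open>N (f t) = 0\<close> it may stay active, but \<open>bound\<close> then forces the
        error to be 0.\<close>
      proof (cases "N (f t) = 0")
        case True
        have "f t - s k t \<in> X" for k
          using elim s_X by (intro diff_mem) auto
        then have "N (f t - s k t) = 0" for k
          using True bound[OF elim(1,3), of k] norm_nonneg[of "f t - s k t"] by fastforce
        then show ?thesis by simp
      next
        case False
        then have "N (f t) < 2 * N (f t)" using norm_nonneg[of "f t"] elim by simp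
        moreover have "(\<lambda>k. N (r k t)) \<longlonglongrightarrow> N (f t)"
          using elim rX by (intro tendsto_norm) auto
        ultimately have "\<forall>\<^sub>F k in sequentially. N (r k t) < 2 * N (f t)"
          using order_tendstoD(2) by blast
        then have "\<forall>\<^sub>F k in sequentially. N (r k t - f t) = N (f t - s k t)"
          by eventually_elim (simp add: s_def norm_diff_commute[OF rX elim(1)])
        with elim(2) show ?thesis by (rule Lim_transform_eventually)
      qed
      from tendsto_power[OF this, of 2] show ?case by simp
    qed
  qed simp
  then have "\<forall>\<^sub>F k in sequentially. (\<integral>t. (N (f t - s k t))\<^sup>2 \<partial>M) < \<epsilon>\<^sup>2"
    using \<epsilon> by (intro order_tendstoD) auto
  then obtain k where "(\<integral>t. (N (f t - s k t))\<^sup>2 \<partial>M) < \<epsilon>\<^sup>2"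
    using eventually_happens by fastforce
  then have "L2_norm M (\<lambda>t. N (f t - s k t)) \<le> \<epsilon>"
    unfolding L2_norm_def using \<epsilon> by (intro real_le_lsqrt) auto
  then show ?thesis using that s_simple s_X L2k by blast
qed

text \<open>Used to pass from \<open>u - vb\<close>, which the evolution problem controls, to
  \<open>u - u_inf\<close>: the two differ by the fixed element \<open>u_inf - vb\<close> of
  \<open>V0\<close>.\<close>

lemma bochner_L2_diff_const:
  assumes M: "finite_measure M" and f: "f \<in> bochner_L2 M X N" and c: "c \<in> X"
    and Mc: "complete_measure M"
  shows "(\<lambda>t. f t - c) \<in> bochner_L2 M X N"
proof -
  have sm: "strongly_measurable M X N (\<lambda>t. f t - c)"
    using f c by (intro strongly_measurable_diff_simple) (auto simp: bochner_L2_def)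
  interpret finite_measure M by fact
  have Nf: "(\<lambda>t. N (f t)) \<in> L2 M" using bochner_L2_norm[OF Mc f] .
  have cL: "(\<lambda>t. N c) \<in> L2 M" by (simp add: L2_def)
  have i: "integrable M (\<lambda>t. (N (f t) + N c)\<^sup>2)"
    using L2.add_mem[OF Nf cL] by (simp add: L2_def)
  have "AE t in M. ennreal ((N (f t - c))\<^sup>2) \<le> ennreal ((N (f t) + N c)\<^sup>2)"
  proof -
    have "AE t in M. f t \<in> X" using f by (simp add: bochner_L2_def strongly_measurable_def)
    then show ?thesis
      by eventually_elim (use c norm_diff_le norm_nonneg diff_mem in \<open>auto intro!: ennreal_leI power_mono\<close>)
  qed
  then have "(\<integral>\<^sup>+t. ennreal ((N (f t - c))\<^sup>2) \<partial>M) \<le> (\<integral>\<^sup>+t. ennreal ((N (f t) + N c)\<^sup>2) \<partial>M)"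
    by (rule nn_integral_mono_AE)
  also have "\<dots> < \<infinity>"
    by (subst nn_integral_eq_integral[OF i]) auto
  finally show ?thesis using sm by (simp add: bochner_L2_def)
qed

text \<open>Meant for the exponential weight, which is not simple: weight and function are
  approximated simultaneously, with \<open>q r - p f = q (r - f) + (q - p) f\<close>.\<close>

lemma bochner_L2_scale:
  assumes M: "complete_measure M" and f: "f \<in> bochner_L2 M X N"
    and p: "p \<in> borel_measurable M" "\<And>t. t \<in> space M \<Longrightarrow> \<bar>p t\<bar> \<le> C"
  shows "(\<lambda>t x. p t * f t x) \<in> bochner_L2 M X N"
proof -
  obtain r where r: "\<And>k. simple_function M (r k)" "\<And>k. r k ` space M \<subseteq> X"
    and lim: "AE t in M. (\<lambda>k. N (r k t - f t)) \<longlonglongrightarrow> 0" and fX: "AE t in M. f t \<in> X"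
    using f unfolding strongly_measurable_def bochner_L2_def by blast
  obtain q where q: "\<And>k. simple_function M (q k)" "\<And>t. t \<in> space M \<Longrightarrow> (\<lambda>k. q k t) \<longlonglongrightarrow> p t"
    using borel_measurable_implies_sequence_metric[OF p(1), of 0] by blast
  have "strongly_measurable M X N (\<lambda>t x. p t * f t x)"
    unfolding strongly_measurable_def
  proof (intro conjI exI[of _ "\<lambda>k t x. q k t * r k t x"] allI)
    show "AE t in M. (\<lambda>x. p t * f t x) \<in> X" using fX by eventually_elim (rule scale_mem)
    fix k
    show "simple_function M (\<lambda>t x. q k t * r k t x)"
      using simple_function_compose2[OF q(1)[of k] r(1)[of k], of "\<lambda>a v x. a * v x"] .
    show "(\<lambda>t x. q k t * r k t x) ` space M \<subseteq> X" using r(2)[of k] scale_mem by auto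
  next
    show "AE t in M. (\<lambda>k. N ((\<lambda>x. q k t * r k t x) - (\<lambda>x. p t * f t x))) \<longlonglongrightarrow> 0"
      using lim fX AE_space
    proof eventually_elim
      case (elim t)
      have rX: "r k t \<in> X" for k using r(2) elim by auto
      have "(\<lambda>k. \<bar>q k t\<bar> * N (r k t - f t) + \<bar>q k t - p t\<bar> * N (f t)) \<longlonglongrightarrow> \<bar>p t\<bar> * 0 + \<bar>p t - p t\<bar> * N (f t)"
        using q(2)[OF elim(3)] elim(1) by (intro tendsto_intros)
      then have l: "(\<lambda>k. \<bar>q k t\<bar> * N (r k t - f t) + \<bar>q k t - p t\<bar> * N (f t)) \<longlonglongrightarrow> 0" by simp
      have "N ((\<lambda>x. q k t * r k t x) - (\<lambda>x. p t * f t x)) \<le>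
          \<bar>q k t\<bar> * N (r k t - f t) + \<bar>q k t - p t\<bar> * N (f t)" for k
      proof -
        have "(\<lambda>x. q k t * r k t x) - (\<lambda>x. p t * f t x) =
            (\<lambda>x. q k t * (r k t - f t) x + (q k t - p t) * f t x)"
          by (auto simp: algebra_simps)
        then show ?thesis
          using norm_triangle[OF scale_mem[OF diff_mem[OF rX elim(2)]] scale_mem[OF elim(2)],
              of "q k t" k "q k t - p t"]
            norm_scale[OF diff_mem[OF rX elim(2)]] norm_scale[OF elim(2)] by simp
      qed
      moreover have "0 \<le> N ((\<lambda>x. q k t * r k t x) - (\<lambda>x. p t * f t x))" for k
        using rX elim by (intro norm_nonneg diff_mem scale_mem)
      ultimately show ?case
        by (intro Lim_null_comparison[OF always_eventually l]) auto
    qed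
  qed
  moreover have "(\<integral>\<^sup>+t. ennreal ((N (\<lambda>x. p t * f t x))\<^sup>2) \<partial>M) < \<infinity>"
  proof -
    have i: "integrable M (\<lambda>t. C\<^sup>2 * (N (f t))\<^sup>2)"
      using bochner_L2_norm[OF M f] by (simp add: L2_def)
    have "AE t in M. ennreal ((N (\<lambda>x. p t * f t x))\<^sup>2) \<le> ennreal (C\<^sup>2 * (N (f t))\<^sup>2)"
      using fX AE_space
    proof eventually_elim
      case (elim t)
      have "(p t)\<^sup>2 \<le> C\<^sup>2" using p(2)[OF elim(2)] abs_le_square_iff[of "p t" C] by auto
      then show ?case
        using norm_scale[OF elim(1)] by (auto intro!: ennreal_leI mult_right_mono simp: power_mult_distrib)
    qed
    then have "(\<integral>\<^sup>+t. ennreal ((N (\<lambda>x. p t * f t x))\<^sup>2) \<partial>M) \<le> (\<integral>\<^sup>+t. ennreal (C\<^sup>2 * (N (f t))\<^sup>2) \<partial>M)"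
      by (rule nn_integral_mono_AE)
    also have "\<dots> < \<infinity>" by (subst nn_integral_eq_integral[OF i]) auto
    finally show ?thesis .
  qed
  ultimately show ?thesis by (simp add: bochner_L2_def)
qed

section \<open>Functionals and the dual norm\<close>

lemma dual_bdd_above: "F \<in> dual_space X N \<Longrightarrow> bdd_above ((\<lambda>v. \<bar>F v\<bar>) ` {v \<in> X. N v \<le> 1})"
proof -
  assume "F \<in> dual_space X N"
  then obtain C where C: "\<And>v. v \<in> X \<Longrightarrow> \<bar>F v\<bar> \<le> C * N v" unfolding dual_space_def by blast
  \<comment> \<open>The bounding constant of a functional may be negative when all norms vanish,
    hence the absolute value.\<close>
  have "\<bar>F v\<bar> \<le> \<bar>C\<bar>" if "v \<in> X" "N v \<le> 1" for v
  proof -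
    have "C * N v \<le> \<bar>C\<bar> * 1"
      using norm_nonneg[OF that(1)] that(2) by (intro mult_mono) auto
    then show ?thesis using C[OF that(1)] by simp
  qed
  then show ?thesis by (intro bdd_aboveI2) auto
qed

lemma dual_norm_upper: "F \<in> dual_space X N \<Longrightarrow> v \<in> X \<Longrightarrow> N v \<le> 1 \<Longrightarrow> \<bar>F v\<bar> \<le> dual_norm X N F"
  unfolding dual_norm_def by (rule cSUP_upper) (auto intro: dual_bdd_above)

lemma dual_norm_least: "(\<And>v. v \<in> X \<Longrightarrow> N v \<le> 1 \<Longrightarrow> \<bar>F v\<bar> \<le> C) \<Longrightarrow> dual_norm X N F \<le> C"
  unfolding dual_norm_def using zero_mem norm_zero by (intro cSUP_least) auto

lemma dual_norm_bound:
  assumes F: "F \<in> dual_space X N" and v: "v \<in> X"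
  shows "\<bar>F v\<bar> \<le> dual_norm X N F * N v"
proof (cases "N v = 0")
  \<comment> \<open>Vectors of norm 0 cannot be normalised; here the bound in
    \<open>dual_space\<close> gives \<open>F v = 0\<close> directly.\<close>
  case True
  then show ?thesis using F v by (auto simp: dual_space_def)
next
  case False
  then have pos: "N v > 0" using norm_nonneg[OF v] by simp
  have "\<bar>F (\<lambda>x. inverse (N v) * v x)\<bar> \<le> dual_norm X N F"
    using pos norm_scale[OF v] by (intro dual_norm_upper F scale_mem v) simp
  moreover have "F (\<lambda>x. inverse (N v) * v x) = inverse (N v) * F v"
    using F v by (auto simp: dual_space_def)
  then have "\<bar>F v\<bar> = N v * \<bar>F (\<lambda>x. inverse (N v) * v x)\<bar>"
    using pos by (simp add: abs_mult)
  ultimately show ?thesis using pos by (simp add: mult.commute)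
qed

lemma dual_space_scale:
  assumes F: "F \<in> dual_space X N"
  shows "(\<lambda>v. c * F v) \<in> dual_space X N"
proof -
  obtain C where C: "\<And>v. v \<in> X \<Longrightarrow> \<bar>F v\<bar> \<le> C * N v" using F unfolding dual_space_def by blast
  have "\<bar>c * F v\<bar> \<le> (\<bar>c\<bar> * C) * N v" if "v \<in> X" for v
    using mult_left_mono[OF C[OF that], of "\<bar>c\<bar>"] by (simp add: abs_mult mult.assoc)
  then have "\<exists>C. \<forall>v\<in>X. \<bar>c * F v\<bar> \<le> C * N v" by blast
  then show ?thesis using F by (auto simp: dual_space_def algebra_simps)
qed

lemma dual_norm_scale_le:
  assumes F: "F \<in> dual_space X N"
  shows "dual_norm X N (\<lambda>v. c * F v) \<le> \<bar>c\<bar> * dual_norm X N F"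
  by (rule dual_norm_least) (auto simp: abs_mult intro!: mult_left_mono dual_norm_upper F)

text \<open>Makes the results on Bochner functions available for the time derivative, whose values
  are functionals. Homogeneity needs \<open>dual_norm_scale_le\<close> twice, the second time with
  the factor \<open>inverse c\<close>.\<close>

lemma seminormed_space_dual: "seminormed_space (dual_space X N) (dual_norm X N)"
proof
  show z: "(\<lambda>v. 0) \<in> dual_space X N"
    by (auto simp: dual_space_def intro!: exI[of _ 0])
  fix F G and c :: real
  assume F: "F \<in> dual_space X N"
  show "(\<lambda>v. c * F v) \<in> dual_space X N" using F by (rule dual_space_scale)
  show "dual_norm X N (\<lambda>v. c * F v) = \<bar>c\<bar> * dual_norm X N F"
  proof (cases "c = 0")
    case True
    have "0 \<le> dual_norm X N (\<lambda>v. 0)"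
      using dual_norm_upper[OF z zero_mem] norm_zero by simp
    then show ?thesis using dual_norm_scale_le[OF F, of c] True by simp
  next
    case False
    have "dual_norm X N (\<lambda>v. inverse c * (c * F v)) \<le> \<bar>inverse c\<bar> * dual_norm X N (\<lambda>v. c * F v)"
      by (rule dual_norm_scale_le[OF dual_space_scale[OF F]])
    then have "\<bar>c\<bar> * dual_norm X N F \<le> dual_norm X N (\<lambda>v. c * F v)"
      using False by (simp add: mult.assoc[symmetric] field_simps)
    then show ?thesis using dual_norm_scale_le[OF F, of c] by simp
  qed
  assume G: "G \<in> dual_space X N"
  obtain C D where "\<And>v. v \<in> X \<Longrightarrow> \<bar>F v\<bar> \<le> C * N v" "\<And>v. v \<in> X \<Longrightarrow> \<bar>G v\<bar> \<le> D * N v"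
    using F G unfolding dual_space_def by blast
  then have "\<bar>F v + G v\<bar> \<le> (C + D) * N v" if "v \<in> X" for v
    using that by (fastforce simp: distrib_right)
  then have "\<exists>C. \<forall>v\<in>X. \<bar>F v + G v\<bar> \<le> C * N v" by blast
  then show "(\<lambda>v. F v + G v) \<in> dual_space X N"
    using F G by (auto simp: dual_space_def algebra_simps)
  show "dual_norm X N (\<lambda>v. F v + G v) \<le> dual_norm X N F + dual_norm X N G"
  proof (rule dual_norm_least)
    fix v assume v: "v \<in> X" "N v \<le> 1"
    show "\<bar>F v + G v\<bar> \<le> dual_norm X N F + dual_norm X N G"
      using dual_norm_upper[OF F v] dual_norm_upper[OF G v] by linarith
  qed
qed

lemma strongly_measurable_dual_apply:
  assumes M: "complete_measure M"
    and l: "strongly_measurable M (dual_space X N) (dual_norm X N) l" and v: "v \<in> X"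
  shows "(\<lambda>t. l t v) \<in> borel_measurable M"
proof -
  interpret complete_measure M by fact
  interpret dual: seminormed_space "dual_space X N" "dual_norm X N" by (rule seminormed_space_dual)
  obtain s where s: "\<And>k. simple_function M (s k)" "\<And>k. s k ` space M \<subseteq> dual_space X N"
    and lim: "AE t in M. (\<lambda>k. dual_norm X N (s k t - l t)) \<longlonglongrightarrow> 0"
    and lX: "AE t in M. l t \<in> dual_space X N"
    using l unfolding strongly_measurable_def by blast
  show ?thesis
  proof (rule borel_measurable_AE_limit)
    show "(\<lambda>t. s k t v) \<in> borel_measurable M" for k
      using borel_measurable_compose_simple_function[OF s(1)[of k], of "\<lambda>F. F v"] .
    show "AE t in M. (\<lambda>k. s k t v) \<longlonglongrightarrow> l t v"
      using lim lX AE_space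
    proof eventually_elim
      case (elim t)
      have "(\<lambda>k. dual_norm X N (s k t - l t) * N v) \<longlonglongrightarrow> 0"
        using tendsto_mult_right[OF elim(1), of "N v"] by simp
      moreover have "\<forall>k. norm (s k t v - l t v) \<le> dual_norm X N (s k t - l t) * N v"
      proof
        fix k
        have "s k t - l t \<in> dual_space X N"
          using s(2)[of k] elim by (intro dual.diff_mem) auto
        from dual_norm_bound[OF this v]
        show "norm (s k t v - l t v) \<le> dual_norm X N (s k t - l t) * N v" by simp
      qed
      ultimately have "(\<lambda>k. s k t v - l t v) \<longlonglongrightarrow> 0"
        by (rule Lim_null_comparison[OF always_eventually, rotated])
      then show ?case by (simp add: LIM_zero_iff)
    qed
  qed
qed

lemma bochner_L2_dual_apply:
  assumes M: "complete_measure M"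
    and l: "l \<in> bochner_L2 M (dual_space X N) (dual_norm X N)" and v: "v \<in> X"
  shows "(\<lambda>t. l t v) \<in> L2 M"
  unfolding L2_def
proof (intro CollectI conjI, goal_cases)
  interpret dual: seminormed_space "dual_space X N" "dual_norm X N" by (rule seminormed_space_dual)
  case 1
  show m: ?case
    using strongly_measurable_dual_apply[OF M _ v] l by (simp add: bochner_L2_def)
  case 2
  have "integrable M (\<lambda>t. (N v)\<^sup>2 * (dual_norm X N (l t))\<^sup>2)"
    using dual.bochner_L2_norm[OF M l] by (simp add: L2_def)
  then show ?case
  proof (rule Bochner_Integration.integrable_bound)
    have "AE t in M. l t \<in> dual_space X N" using l by (simp add: bochner_L2_def strongly_measurable_def)
    then show "AE t in M. norm ((l t v)\<^sup>2) \<le> norm ((N v)\<^sup>2 * (dual_norm X N (l t))\<^sup>2)"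
    proof eventually_elim
      case (elim t)
      have "\<bar>l t v\<bar>\<^sup>2 \<le> (dual_norm X N (l t) * N v)\<^sup>2"
        using dual_norm_bound[OF elim v] by (intro power_mono) auto
      then show ?case by (simp add: power_mult_distrib mult.commute)
    qed
  qed (use m in simp)
qed

end

section \<open>The du Bois-Reymond lemma\<close>

lemma smooth_step_derivative:
  shows "(smooth_step has_real_derivative deriv smooth_step x) (at x)"
    and "continuous_on UNIV (deriv smooth_step)"
    and "0 \<le> deriv smooth_step x"
    and "x \<notin> {0..1} \<Longrightarrow> deriv smooth_step x = 0"
proof -
  note C1 = Ck_smooth_step[of "Suc 0"]
  show d: "(smooth_step has_real_derivative deriv smooth_step x) (at x)" for x
    using C1 by (simp add: DERIV_deriv_iff_real_differentiable)
  have "frechet_derivative smooth_step (at x) 1 = deriv smooth_step x" for x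
    using frechet_derivative_at[OF d[of x, unfolded has_field_derivative_def]] by (metis mult.right_neutral)
  then show "continuous_on UNIV (deriv smooth_step)"
    using C1 by simp
  show "0 \<le> deriv smooth_step x"
    using d mono_smooth_step by (intro mono_on_imp_deriv_nonneg[of UNIV smooth_step _ x]) (auto simp: mono_on_def)
  have c: "deriv smooth_step x = 0" if "open S" "x \<in> S" "\<And>y. y \<in> S \<Longrightarrow> c = smooth_step y" for S c
    by (rule DERIV_imp_deriv, rule has_field_derivative_transform_within_open[OF DERIV_const that])
  show "deriv smooth_step x = 0" if "x \<notin> {0..1}"
  proof (cases "x < 0")
    case True
    then show ?thesis by (intro c[of "{..<0}" 0]) (auto simp: smooth_step_eq_0)
  next
    case False
    then show ?thesis using that by (intro c[of "{1<..}" 1]) (auto simp: smooth_step_eq_1)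
  qed
qed

lemma smooth_step_scaled_derivative:
  assumes "\<delta> > 0"
  shows "((\<lambda>x. smooth_step ((x - s) / \<delta>)) has_real_derivative deriv smooth_step ((x - s) / \<delta>) / \<delta>) (at x)"
proof -
  have "((\<lambda>x. (x - s) / \<delta>) has_real_derivative 1 / \<delta>) (at x)"
    using assms by (auto intro!: derivative_eq_intros)
  from DERIV_chain2[OF smooth_step_derivative(1) this] show ?thesis by simp
qed

lemma integrable_restrict_space_subset:
  fixes f :: "'a \<Rightarrow> real"
  assumes "integrable (restrict_space M S) f" "A \<subseteq> S" "A \<in> sets M" "S \<in> sets M"
  shows "integrable (restrict_space M A) f"
  using assms set_integrable_subset[of M S f A]
  by (simp add: integrable_restrict_space set_integrable_def)

lemma integral_restrict_space_mono:
  fixes f :: "'a \<Rightarrow> real"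
  assumes "integrable (restrict_space M S) f" "A \<subseteq> S" "A \<in> sets M" "S \<in> sets M" "\<And>x. 0 \<le> f x"
  shows "(\<integral>x. f x \<partial>restrict_space M A) \<le> (\<integral>x. f x \<partial>restrict_space M S)"
  using assms integrable_restrict_space_subset[OF assms(1-4)]
  by (auto simp: integral_restrict_space integrable_restrict_space indicator_def intro!: integral_mono)

text \<open>The derivative of a steep smooth step acts like a point mass.\<close>

lemma smooth_step_average:
  fixes c :: "real \<Rightarrow> real"
  assumes s: "0 < s" "s + \<delta> < T" and \<delta>: "\<delta> > 0" and c: "continuous_on {0<..<T} c"
    and near: "\<And>x. x \<in> {s..s + \<delta>} \<Longrightarrow> \<bar>c x - c s\<bar> \<le> \<epsilon>"
  defines "d \<equiv> \<lambda>x. deriv smooth_step ((x - s) / \<delta>) / \<delta>"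
  shows "integrable (lebesgue_on {0<..<T}) (\<lambda>x. c x * d x)"
    and "\<bar>(\<integral>x. c x * d x \<partial>lebesgue_on {0<..<T}) - c s\<bar> \<le> \<epsilon>"
proof -
  let ?I = "{s..s + \<delta>}"
  have I: "?I \<subseteq> {0<..<T}" using s by auto
  have d0: "d x = 0" if "x \<notin> ?I" for x
    using that \<delta> smooth_step_derivative(4)[of "(x - s) / \<delta>"] by (auto simp: d_def field_simps)
  have dpos: "0 \<le> d x" for x using \<delta> smooth_step_derivative(3) by (simp add: d_def)
  have dcont: "continuous_on A d" for A
    unfolding d_def using \<delta>
    by (intro continuous_intros continuous_on_compose2[OF smooth_step_derivative(2)]) auto
  \<comment> \<open>The weight vanishes off the compact interval, so nothing is asked of
    \<open>c\<close> near the ends of \<open>(0,T)\<close>.\<close>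
  have eq: "(\<lambda>x. indicator {0<..<T} x *\<^sub>R (c x * d x)) = (\<lambda>x. indicator ?I x *\<^sub>R (c x * d x))"
    using d0 I by (auto simp: indicator_def fun_eq_iff)
  have ci: "continuous_on ?I c" using c I by (rule continuous_on_subset)
  have i: "integrable (lebesgue_on ?I) (\<lambda>x. f x * d x)" if "continuous_on ?I f" for f
    by (intro continuous_imp_integrable_real continuous_intros that dcont)
  show "integrable (lebesgue_on {0<..<T}) (\<lambda>x. c x * d x)"
    using i[OF ci] unfolding integrable_restrict_space[of _ lebesgue, simplified]
    by (subst (asm) integrable_restrict_space, simp, subst integrable_restrict_space, simp, subst eq)
  \<comment> \<open>The step climbs from 0 to 1 across the interval, so \<open>d\<close> has mass
    one.\<close>
  have "(d has_integral (smooth_step ((s + \<delta> - s) / \<delta>) - smooth_step ((s - s) / \<delta>))) ?I"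
  proof (rule fundamental_theorem_of_calculus)
    fix x
    have "((\<lambda>x. smooth_step ((x - s) / \<delta>)) has_real_derivative d x) (at x)"
      unfolding d_def by (rule smooth_step_scaled_derivative[OF \<delta>])
    then show "((\<lambda>x. smooth_step ((x - s) / \<delta>)) has_vector_derivative d x) (at x within ?I)"
      by (auto simp: has_real_derivative_iff_has_vector_derivative intro: has_vector_derivative_at_within)
  qed (use \<delta> in auto)
  then have "integral ?I d = 1"
    using \<delta> smooth_step_eq_0[of 0] smooth_step_eq_1[of 1] by (simp add: integral_unique)
  then have d1: "(\<integral>x. d x \<partial>lebesgue_on ?I) = 1"
    using lebesgue_integral_eq_integral[of ?I d] i[of "\<lambda>_. 1"] by simp
  have "(\<integral>x. c x * d x \<partial>lebesgue_on {0<..<T}) = (\<integral>x. c x * d x \<partial>lebesgue_on ?I)"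
    using eq by (simp add: integral_restrict_space)
  then have "(\<integral>x. c x * d x \<partial>lebesgue_on {0<..<T}) - c s =
      (\<integral>x. c x * d x \<partial>lebesgue_on ?I) - (\<integral>x. c s * d x \<partial>lebesgue_on ?I)"
    using d1 by simp
  also have "\<dots> = (\<integral>x. (c x - c s) * d x \<partial>lebesgue_on ?I)"
    using i[OF ci] i[of "\<lambda>_. c s"] by (simp add: left_diff_distrib)
  also have "\<bar>\<dots>\<bar> \<le> (\<integral>x. \<epsilon> * d x \<partial>lebesgue_on ?I)"
  proof (rule integral_abs_bound_integral)
    show "integrable (lebesgue_on ?I) (\<lambda>x. (c x - c s) * d x)"
      by (intro i continuous_intros ci)
    show "integrable (lebesgue_on ?I) (\<lambda>x. \<epsilon> * d x)"
      by (intro i continuous_intros)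
    show "\<bar>(c x - c s) * d x\<bar> \<le> \<epsilon> * d x" if "x \<in> space (lebesgue_on ?I)" for x
      using near[of x] that dpos[of x] by (simp add: abs_mult mult_right_mono)
  qed
  also have "\<dots> = \<epsilon>" using d1 by simp
  finally show "\<bar>(\<integral>x. c x * d x \<partial>lebesgue_on {0<..<T}) - c s\<bar> \<le> \<epsilon>" .
qed

text \<open>The test functions are differences of steep steps at \<open>s\<close> and
  \<open>t\<close>. They tend to an indicator, while their derivatives tend to a point mass at
  \<open>s\<close> minus one at \<open>t\<close>; the integral of \<open>k\<close> against them thus
  has two limits, and these must agree. Continuity of \<open>c\<close> gives the point masses their
  meaning.\<close>

lemma du_Bois_Reymond:
  fixes c k :: "real \<Rightarrow> real"
  assumes c: "continuous_on {0<..<T} c" and k: "integrable (lebesgue_on {0<..<T}) k"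
    and weak: "\<And>\<phi>. test_function {0<..<T} \<phi> \<Longrightarrow>
      (\<integral>t. k t * \<phi> t \<partial>lebesgue_on {0<..<T}) = - (\<integral>t. c t * deriv \<phi> t \<partial>lebesgue_on {0<..<T})"
    and st: "0 < s" "s < t" "t < T"
  shows "c t - c s = integral {s..t} k"
proof -
  \<comment> \<open>The shift by 2 keeps \<open>h n\<close> at most \<open>(T - t) / 2\<close>, so
    the supports, which reach up to \<open>t + h n\<close>, stay inside
    \<open>(0,T)\<close>.\<close>
  define h where "h n = (T - t) / real (n + 2)" for n
  have h0: "h n > 0" and hT: "t + h n < T" "s + h n < T" for n
  proof -
    show "h n > 0" using st by (simp add: h_def)
    have "h n \<le> (T - t) / 2" unfolding h_def by (rule divide_left_mono) (use st in auto)
    then show "t + h n < T" using st by (simp add: field_simps)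
    then show "s + h n < T" using st by simp
  qed
  have hlim: "h \<longlonglongrightarrow> 0"
    unfolding h_def using LIMSEQ_ignore_initial_segment
        [OF tendsto_divide_0[OF tendsto_const filterlim_real_at_infinity_sequentially], of "T - t" 2]
    by simp
  define \<phi> where "\<phi> n x = smooth_step ((x - s) / h n) - smooth_step ((x - t) / h n)" for n x
  define d where "d n r x = deriv smooth_step ((x - r) / h n) / h n" for n r x
  have d\<phi>: "deriv (\<phi> n) x = d n s x - d n t x" for n x
  proof (rule DERIV_imp_deriv)
    have "((\<lambda>x. smooth_step ((x - r) / h n)) has_real_derivative d n r x) (at x)" for r
      unfolding d_def by (rule smooth_step_scaled_derivative[OF h0])
    from DERIV_diff[OF this this] show "(\<phi> n has_real_derivative d n s x - d n t x) (at x)"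
      unfolding \<phi>_def[abs_def] .
  qed
  have \<phi>_bounds: "0 \<le> \<phi> n x" "\<phi> n x \<le> 1" for n x
  proof -
    have "(x - t) / h n \<le> (x - s) / h n" using st h0[of n] by (auto intro!: divide_right_mono)
    then show "0 \<le> \<phi> n x" using mono_smooth_step by (simp add: \<phi>_def)
    show "\<phi> n x \<le> 1"
      using smooth_step_bounds(1)[of "(x - t) / h n"] smooth_step_bounds(2)[of "(x - s) / h n"]
      by (simp add: \<phi>_def)
  qed
  have test: "test_function {0<..<T} (\<phi> n)" for n
  proof -
    have "Ck m (\<lambda>x. smooth_step ((x - r) / h n))" for m r
      using Ck_compose_affine[OF Ck_smooth_step, of m "inverse (h n)" "- r / h n"]
      by (simp add: divide_inverse algebra_simps)
    from Ck_add[OF this[of _ s] Ck_minus[OF this[of _ t]]] have "Ck m (\<phi> n)" for m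
      unfolding \<phi>_def[abs_def] by simp
    moreover have "\<phi> n x = 0" if "x \<notin> {s..t + h n}" for x
      using that h0[of n] st
      by (auto simp: \<phi>_def smooth_step_eq_0 smooth_step_eq_1 not_le divide_le_0_iff le_divide_eq)
    then have "{x. \<phi> n x \<noteq> 0} \<subseteq> {s..t + h n}" by blast
    then have "closure {x. \<phi> n x \<noteq> 0} \<subseteq> {s..t + h n}"
      by (rule closure_minimal) simp
    moreover have "{s..t + h n} \<subseteq> {0<..<T}" using st hT[of n] by auto
    ultimately show ?thesis
      unfolding test_function_def
      by (metis (no_types, lifting) bounded_closed_interval bounded_subset closed_closure compact_eq_bounded_closed subset_trans)
  qed
  have lim1: "(\<lambda>n. \<integral>x. k x * \<phi> n x \<partial>lebesgue_on {0<..<T}) \<longlonglongrightarrow>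
      (\<integral>x. k x * indicator {s<..t} x \<partial>lebesgue_on {0<..<T})"
  proof (rule integral_dominated_convergence[where w = "\<lambda>x. \<bar>k x\<bar>"])
    have "\<phi> n \<in> borel_measurable (lebesgue_on {0<..<T})" for n
      using test_function_continuous[OF test, of n] continuous_on_subset
      by (intro continuous_imp_measurable_on_sets_lebesgue) auto
    then show "(\<lambda>x. k x * \<phi> n x) \<in> borel_measurable (lebesgue_on {0<..<T})" for n
      using k by auto
    have "indicat_real {s<..t} \<in> borel_measurable (lebesgue_on {0<..<T})"
      by (intro measurable_restrict_space1 borel_measurable_indicator) auto
    then show "(\<lambda>x. k x * indicator {s<..t} x) \<in> borel_measurable (lebesgue_on {0<..<T})"
      using k by auto
    show "AE x in lebesgue_on {0<..<T}. (\<lambda>n. k x * \<phi> n x) \<longlonglongrightarrow> k x * indicator {s<..t} x"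
    proof (intro AE_I2 tendsto_intros)
      fix x
      \<comment> \<open>The step is 0 at its left end, so the limit excludes \<open>r\<close>
        itself; this is why the limiting interval is half-open.\<close>
      have ev: "\<forall>\<^sub>F n in sequentially. smooth_step ((x - r) / h n) = indicator {r<..} x" for r
      proof (cases "x > r")
        case True
        then have "\<forall>\<^sub>F n in sequentially. h n < x - r"
          using order_tendstoD(2)[OF hlim] by simp
        then show ?thesis
        proof eventually_elim
          case (elim n)
          then show ?case using True h0[of n] by (simp add: smooth_step_eq_1)
        qed
      next
        case False
        then have "(x - r) / h n \<le> 0" for n using h0[of n] by (simp add: divide_le_0_iff)
        then show ?thesis using False by (simp add: smooth_step_eq_0)
      qed
      have "\<forall>\<^sub>F n in sequentially. indicator {s<..t} x = \<phi> n x"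
        using ev[of s] ev[of t]
        by eventually_elim (use st in \<open>auto simp: \<phi>_def indicator_def\<close>)
      then show "(\<lambda>n. \<phi> n x) \<longlonglongrightarrow> indicator {s<..t} x"
        by (rule Lim_transform_eventually[OF tendsto_const])
    qed
    show "AE x in lebesgue_on {0<..<T}. norm (k x * \<phi> n x) \<le> \<bar>k x\<bar>" for n
      by (intro AE_I2) (simp add: abs_mult \<phi>_bounds mult_left_le)
  qed (use k in auto)
  have lim2: "(\<lambda>n. \<integral>x. k x * \<phi> n x \<partial>lebesgue_on {0<..<T}) \<longlonglongrightarrow> c t - c s"
  proof (rule LIMSEQ_I)
    fix e :: real assume e: "e > 0"
    have near: "\<forall>\<^sub>F n in sequentially. \<forall>x\<in>{r..r + h n}. \<bar>c x - c r\<bar> \<le> e / 3" if r: "r \<in> {0<..<T}" for r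
    proof -
      obtain \<delta> where \<delta>: "\<delta> > 0" "\<And>x. x \<in> {0<..<T} \<Longrightarrow> dist x r < \<delta> \<Longrightarrow> dist (c x) (c r) < e / 3"
        using c r e unfolding continuous_on_iff by (metis divide_pos_pos zero_less_numeral)
      have "\<forall>\<^sub>F n in sequentially. h n < min \<delta> (T - r)"
        using order_tendstoD(2)[OF hlim, of "min \<delta> (T - r)"] \<delta>(1) r by simp
      then show ?thesis
        by eventually_elim (use \<delta> r in \<open>force simp: dist_real_def intro!: less_imp_le\<close>)
    qed
    have "s \<in> {0<..<T}" "t \<in> {0<..<T}" using st by auto
    from this[THEN near]
    have "\<forall>\<^sub>F n in sequentially. norm ((\<integral>x. k x * \<phi> n x \<partial>lebesgue_on {0<..<T}) - (c t - c s)) < e"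
    proof eventually_elim
      case (elim n)
      have ns: "\<bar>c x - c s\<bar> \<le> e / 3" if "x \<in> {s..s + h n}" for x using elim st that by auto
      have nt: "\<bar>c x - c t\<bar> \<le> e / 3" if "x \<in> {t..t + h n}" for x using elim st that by auto
      note S = smooth_step_average[OF st(1) hT(2) h0 c ns, of n, folded d_def]
      have "0 < t" using st by simp
      note T = smooth_step_average[OF this hT(1) h0 c nt, of n, folded d_def]
      \<comment> \<open>The minus sign of the weak identity turns "mass at \<open>s\<close> minus
        mass at \<open>t\<close>" into an approximation of \<open>c t - c s\<close>, with an error
        of at most \<open>e / 3\<close> from each step.\<close>
      have "(\<integral>x. k x * \<phi> n x \<partial>lebesgue_on {0<..<T}) =
          - ((\<integral>x. c x * d n s x \<partial>lebesgue_on {0<..<T}) - (\<integral>x. c x * d n t x \<partial>lebesgue_on {0<..<T}))"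
        using S(1) T(1) unfolding weak[OF test] d\<phi> by (simp add: right_diff_distrib)
      then show ?case using S(2) T(2) e by (simp add: abs_if split: if_splits)
    qed
    then show "\<exists>n0. \<forall>n\<ge>n0. norm ((\<integral>x. k x * \<phi> n x \<partial>lebesgue_on {0<..<T}) - (c t - c s)) < e"
      by (simp add: eventually_sequentially)
  qed
  have ks: "integrable (lebesgue_on {s<..t}) k"
    using st by (intro integrable_restrict_space_subset[OF k]) auto
  have "c t - c s = (\<integral>x. k x * indicator {s<..t} x \<partial>lebesgue_on {0<..<T})"
    using lim1 lim2 LIMSEQ_unique by blast
  also have "\<dots> = (\<integral>x. k x \<partial>lebesgue_on {s<..t})"
    unfolding integral_restrict_space[of "{0<..<T}" lebesgue, simplified]
      integral_restrict_space[of "{s<..t}" lebesgue, simplified]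
    by (rule Bochner_Integration.integral_cong) (use st in \<open>auto simp: indicator_def\<close>)
  also have "\<dots> = integral {s<..t} k"
    using lebesgue_integral_eq_integral[OF ks] by simp
  also have "\<dots> = integral {s..t} k"
    by (rule integral_spike_set) (auto intro: negligible_subset[of "{s}"])
  finally show ?thesis .
qed

section \<open>Backward averages\<close>

lemma indicator_L2:
  assumes "finite_measure M" "A \<in> sets M"
  shows "indicat_real A \<in> L2 M" "L2_norm M (indicator A) = sqrt (measure M A)"
proof -
  interpret finite_measure M by fact
  have sq: "(indicat_real A x)\<^sup>2 = indicator A x" for x by (simp add: indicator_def)
  show "indicat_real A \<in> L2 M" "L2_norm M (indicator A) = sqrt (measure M A)"
    using assms(2) sets.sets_into_space[OF assms(2)]
    by (simp_all add: L2_def L2_norm_def sq emeasure_finite less_top[symmetric] Int_absorb2)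
qed

text \<open>Bounded sequences in \<open>L\<^sup>2\<close> are equi-integrable, so convergence of the integrals over
  intervals extends to all measurable sets.\<close>

lemma L2_weak_convergence_on_sets:
  fixes q :: "nat \<Rightarrow> real \<Rightarrow> real" and a b C :: real
  defines "M \<equiv> lebesgue_on {a<..<b}"
  assumes q: "\<And>n. q n \<in> L2 M" "\<And>n. L2_norm M (q n) \<le> C"
    and k: "k \<in> L2 M" "L2_norm M k \<le> C"
    and interval: "\<And>c d. (\<lambda>n. \<integral>t. indicator (box c d) t * q n t \<partial>M) \<longlonglongrightarrow> (\<integral>t. indicator (box c d) t * k t \<partial>M)"
    and A: "A \<in> sets lebesgue"
  shows "(\<lambda>n. \<integral>t. indicator A t * q n t \<partial>M) \<longlonglongrightarrow> (\<integral>t. indicator A t * k t \<partial>M)"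
  using A
proof (induction rule: lebesgue_set_induct_box)
  interpret finite_measure M unfolding M_def by (rule finite_measure_lebesgue_on) simp
  have M_sets: "A \<inter> {a<..<b} \<in> sets M" if "A \<in> sets lebesgue" for A
    using that unfolding M_def by (auto simp: sets_restrict_space_iff)
  have spM: "space M = {a<..<b}" by (simp add: M_def)
  have ind: "indicat_real A \<in> L2 M" "L2_norm M (indicat_real A) = sqrt (measure M (A \<inter> {a<..<b}))"
    if "A \<in> sets lebesgue" for A
  proof -
    note I = indicator_L2[OF finite_measure_axioms M_sets[OF that]]
    have e: "indicat_real (A \<inter> {a<..<b}) t = indicator A t" if "t \<in> space M" for t
      using that by (auto simp: spM indicator_def)
    have "indicat_real A \<in> borel_measurable M \<longleftrightarrow> indicat_real (A \<inter> {a<..<b}) \<in> borel_measurable M"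
      by (intro measurable_cong) (simp add: e)
    moreover have "integrable M (\<lambda>t. (indicat_real A t)\<^sup>2) \<longleftrightarrow> integrable M (\<lambda>t. (indicat_real (A \<inter> {a<..<b}) t)\<^sup>2)"
      by (intro Bochner_Integration.integrable_cong) (simp_all add: e)
    moreover have "L2_norm M (indicat_real A) = L2_norm M (indicat_real (A \<inter> {a<..<b}))"
      unfolding L2_norm_def by (intro arg_cong[where f = sqrt] Bochner_Integration.integral_cong) (simp_all add: e)
    ultimately show "indicat_real A \<in> L2 M" "L2_norm M (indicat_real A) = sqrt (measure M (A \<inter> {a<..<b}))"
      using I by (auto simp: L2_def)
  qed
  have int: "integrable M (\<lambda>t. indicator A t * f t)" if "A \<in> sets lebesgue" "f \<in> L2 M" for A f
    using integrable_mult_L2[OF ind(1)[OF that(1)] that(2)] .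
  {
    case (box c d)
    show ?case by (rule interval)
  next
    case empty
    show ?case by simp
  next
    case (compl A)
    \<comment> \<open>On the support of \<open>M\<close> the whole space is the box from
      \<open>a\<close> to \<open>b\<close>, so the interval hypothesis supplies the total
      integral.\<close>
    have e: "(\<integral>t. indicator (- A) t * f t \<partial>M) =
        (\<integral>t. indicator (box a b) t * f t \<partial>M) - (\<integral>t. indicator A t * f t \<partial>M)" if f: "f \<in> L2 M" for f
    proof -
      have "(\<integral>t. indicator (- A) t * f t \<partial>M) = (\<integral>t. indicator (box a b) t * f t - indicator A t * f t \<partial>M)"
        by (intro Bochner_Integration.integral_cong) (auto simp: indicator_def spM)
      also have "\<dots> = (\<integral>t. indicator (box a b) t * f t \<partial>M) - (\<integral>t. indicator A t * f t \<partial>M)"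
        using compl f by (intro Bochner_Integration.integral_diff int) auto
      finally show ?thesis .
    qed
    show ?case
      unfolding e[OF q(1)] e[OF k(1)] by (intro tendsto_diff interval compl(2))
  next
    case (union A)
    let ?U = "\<Union>i. A i" and ?S = "\<lambda>m. \<Union>i<m. A i"
    have A_leb: "A i \<in> sets lebesgue" for i using union(2) by auto
    then have U_leb: "?U \<in> sets lebesgue" and S_leb: "?S m \<in> sets lebesgue" for m by auto
    have "C \<ge> 0" using k(2) L2.norm_nonneg[OF k(1)] by simp
    \<comment> \<open>Cauchy-Schwarz on the tail of the union. The bound involves only
      \<open>C\<close> and the measure of the tail, so one \<open>m\<close> works for
      \<open>k\<close> and for all \<open>q n\<close> at once.\<close>
    have split: "\<bar>(\<integral>t. indicator ?U t * f t \<partial>M) - (\<Sum>i<m. \<integral>t. indicator (A i) t * f t \<partial>M)\<bar> \<le>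
        sqrt (measure M ((?U - ?S m) \<inter> {a<..<b})) * C" if f: "f \<in> L2 M" "L2_norm M f \<le> C" for f m
    proof -
      have "indicat_real (?S m) t = (\<Sum>i<m. indicator (A i) t)" for t
        by (rule indicator_UN_disjoint) (auto intro: disjoint_family_on_mono[OF _ union(1)])
      then have s: "(\<integral>t. indicator (?S m) t * f t \<partial>M) = (\<Sum>i<m. \<integral>t. indicator (A i) t * f t \<partial>M)"
        using Bochner_Integration.integral_sum[of "{..<m}" M "\<lambda>i t. indicator (A i) t * f t"]
          int[OF A_leb f(1)] by (simp only: sum_distrib_right)
      have "(\<integral>t. indicator ?U t * f t \<partial>M) - (\<integral>t. indicator (?S m) t * f t \<partial>M) =
          (\<integral>t. indicator ?U t * f t - indicator (?S m) t * f t \<partial>M)"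
        by (intro Bochner_Integration.integral_diff[symmetric] int U_leb S_leb f)
      also have "\<dots> = L2_inner M (indicator (?U - ?S m)) f"
        unfolding L2_inner_def by (intro Bochner_Integration.integral_cong) (auto simp: indicator_def)
      also have "\<bar>\<dots>\<bar> \<le> L2_norm M (indicator (?U - ?S m)) * L2_norm M f"
        by (intro L2.Cauchy_Schwarz ind f sets.Diff U_leb S_leb)
      also have "\<dots> \<le> sqrt (measure M ((?U - ?S m) \<inter> {a<..<b})) * C"
        using f(2) ind(2)[OF sets.Diff[OF U_leb S_leb]] by (simp add: mult_left_mono)
      finally show ?thesis unfolding s .
    qed
    have tail: "(\<lambda>m. sqrt (measure M ((?U - ?S m) \<inter> {a<..<b})) * C) \<longlonglongrightarrow> 0"
    proof -
      have "(\<lambda>m. measure M ((?U - ?S m) \<inter> {a<..<b})) \<longlonglongrightarrow> measure M (\<Inter>m. (?U - ?S m) \<inter> {a<..<b})"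
        by (intro finite_Lim_measure_decseq)
          (auto intro!: M_sets sets.Diff U_leb S_leb simp: decseq_def)
      moreover have "(\<Inter>m. (?U - ?S m) \<inter> {a<..<b}) = {}" by blast
      ultimately have "(\<lambda>m. measure M ((?U - ?S m) \<inter> {a<..<b})) \<longlonglongrightarrow> 0" by simp
      from tendsto_mult_right[OF tendsto_real_sqrt[OF this], of C] show ?thesis by simp
    qed
    show ?case
    proof (rule LIMSEQ_I)
      fix e :: real assume e: "e > 0"
      obtain m where m: "sqrt (measure M ((?U - ?S m) \<inter> {a<..<b})) * C < e / 3"
        using eventually_happens[OF order_tendstoD(2)[OF tail, of "e / 3"]] e by auto
      have "(\<lambda>n. \<Sum>i<m. \<integral>t. indicator (A i) t * q n t \<partial>M) \<longlonglongrightarrow> (\<Sum>i<m. \<integral>t. indicator (A i) t * k t \<partial>M)"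
        by (intro tendsto_sum union)
      from LIMSEQ_D[OF this, of "e / 3"] e obtain n0 where n0: "\<And>n. n \<ge> n0 \<Longrightarrow>
          norm ((\<Sum>i<m. \<integral>t. indicator (A i) t * q n t \<partial>M) - (\<Sum>i<m. \<integral>t. indicator (A i) t * k t \<partial>M)) < e / 3"
        by auto
      have "norm ((\<integral>t. indicator ?U t * q n t \<partial>M) - (\<integral>t. indicator ?U t * k t \<partial>M)) < e" if "n \<ge> n0" for n
        using n0[OF that] split[OF q(1,2)[of n], of m] split[OF k, of m] m
        unfolding real_norm_def by linarith
      then show "\<exists>n0. \<forall>n\<ge>n0. norm ((\<integral>t. indicator ?U t * q n t \<partial>M) - (\<integral>t. indicator ?U t * k t \<partial>M)) < e"
        by blast
    qed
  next
    case (null A B)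
    have "AE t in M. t \<in> A \<longleftrightarrow> t \<in> B"
      using null(3) unfolding M_def by (auto simp: AE_restrict_space_iff elim!: eventually_mono)
    then have "(\<integral>t. indicator A t * f t \<partial>M) = (\<integral>t. indicator B t * f t \<partial>M)" if "f \<in> L2 M" for f
      using int[OF null(1) that] int[OF null(2) that]
      by (intro integral_cong_AE) (auto elim!: eventually_mono simp: indicator_def)
    then show ?case using null(4) q(1) k(1) by simp
  }
qed

section \<open>Integrals of difference quotients and of averages\<close>

lemma antiderivative_Icc:
  fixes F :: "real \<Rightarrow> real"
  assumes "continuous_on {0..T} F"
  obtains G :: "real \<Rightarrow> real" where "\<And>t. t \<in> {0<..<T} \<Longrightarrow> (G has_real_derivative F t) (at t)"
proof
  fix t assume t: "t \<in> {0<..<T}"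
  have "((\<lambda>x. integral {0..x} F) has_real_derivative F t) (at t within {0..T})"
    using t by (intro integral_has_real_derivative assms) auto
  moreover have "at t within {0..T} = at t"
    using t by (intro at_within_interior) simp
  ultimately show "((\<lambda>x. integral {0..x} F) has_real_derivative F t) (at t)" by simp
qed

lemma integral_difference_quotient:
  fixes F G :: "real \<Rightarrow> real"
  assumes G: "\<And>t. t \<in> {0<..<T} \<Longrightarrow> (G has_real_derivative F t) (at t)"
    and h: "0 < h" "h < a" "a \<le> b" "b < T"
  shows "((\<lambda>t. (F t - F (t - h)) / h) has_integral ((G b - G (b - h)) / h - (G a - G (a - h)) / h)) {a..b}"
proof (rule fundamental_theorem_of_calculus)
  fix t assume t: "t \<in> {a..b}"
  have "((\<lambda>t. G (t - h)) has_real_derivative F (t - h) * 1) (at t)"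
    by (rule DERIV_chain2[OF G]) (use t h in \<open>auto intro!: derivative_eq_intros\<close>)
  then have "((\<lambda>t. (G t - G (t - h)) / h) has_real_derivative (F t - F (t - h)) / h) (at t)"
    using t h by (auto intro!: derivative_eq_intros G)
  then show "((\<lambda>t. (G t - G (t - h)) / h) has_vector_derivative (F t - F (t - h)) / h) (at t within {a..b})"
    by (auto simp: has_real_derivative_iff_has_vector_derivative intro: has_vector_derivative_at_within)
qed (rule h)

text \<open>Continuity of \<open>F\<close> is enough: the integral of its difference quotients
  equals the difference of those of an antiderivative \<open>G\<close> at \<open>b\<close> and
  \<open>a\<close>, and \<open>G\<close> is differentiable there.\<close>

lemma integral_difference_quotient_tendsto:
  fixes F :: "real \<Rightarrow> real"
  assumes F: "continuous_on {0..T} F" and ab: "0 < a" "a \<le> b" "b < T"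
    and h: "\<And>n. 0 < h n" "\<And>n. h n < a" "h \<longlonglongrightarrow> 0"
  shows "(\<lambda>n. integral {a..b} (\<lambda>t. (F t - F (t - h n)) / h n)) \<longlonglongrightarrow> F b - F a"
proof -
  obtain G where G: "\<And>t. t \<in> {0<..<T} \<Longrightarrow> (G has_real_derivative F t) (at t)"
    using antiderivative_Icc[OF F] by blast
  have lim: "(\<lambda>n. (G t - G (t - h n)) / h n) \<longlonglongrightarrow> F t" if "t \<in> {0<..<T}" for t
  proof -
    have "((\<lambda>x. (G (t + x) - G t) / x) \<longlongrightarrow> F t) (at 0)"
      using G[OF that] by (simp add: DERIV_def)
    moreover have "filterlim (\<lambda>n. - h n) (at 0) sequentially"
      using tendsto_minus[OF h(3)] h(1)[THEN less_imp_neq] by (auto simp: filterlim_at)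
    ultimately have "(\<lambda>n. (G (t + - h n) - G t) / - h n) \<longlonglongrightarrow> F t"
      by (rule filterlim_compose)
    moreover have "(G (t + - h n) - G t) / - h n = (G t - G (t - h n)) / h n" for n
      using h(1)[of n] by (simp add: field_simps)
    ultimately show ?thesis by simp
  qed
  have "integral {a..b} (\<lambda>t. (F t - F (t - h n)) / h n) = (G b - G (b - h n)) / h n - (G a - G (a - h n)) / h n" for n
    using integral_difference_quotient[OF G h(1,2) ab(2,3)] by (rule integral_unique)
  then show ?thesis using lim[of a] lim[of b] ab by (auto intro!: tendsto_diff)
qed

text \<open>Since the indefinite integral of \<open>f \<ge> 0\<close> increases, its backward averages have no larger
  integral than \<open>f\<close>.\<close>

lemma integral_average_le:
  fixes f :: "real \<Rightarrow> real"
  assumes f: "f integrable_on {0..T}" "\<And>t. 0 \<le> f t" and h: "0 < h" "h < a" "a \<le> b" "b < T"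
  shows "(\<lambda>t. integral {t - h..t} f / h) integrable_on {a..b}"
    and "integral {a..b} (\<lambda>t. integral {t - h..t} f / h) \<le> integral {0..T} f"
proof -
  define J where "J t = integral {0..t} f" for t
  have sub: "f integrable_on {s..t}" if "0 \<le> s" "t \<le> T" for s t
    using f(1) that by (intro integrable_subinterval_real[OF f(1)]) auto
  have diff: "integral {t - h..t} f = J t - J (t - h)" if "t \<in> {a..b}" for t
    using Henstock_Kurzweil_Integration.integral_combine[where f = f and a = 0 and c = "t - h" and b = t]
      sub[of 0 t] h that by (simp add: J_def)
  have J_mono: "J s \<le> J t" if "0 \<le> s" "s \<le> t" "t \<le> T" for s t
    unfolding J_def using that f(2) sub by (intro integral_subset_le) auto
  \<comment> \<open>Beyond \<open>T\<close> the function need not be integrable; the integral then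
    has the default value 0.\<close>
  have J_nonneg: "0 \<le> J t" for t unfolding J_def using f(2) integral_nonneg[of f "{0..t}"]
    by (cases "f integrable_on {0..t}") (auto simp: not_integrable_integral)
  have "continuous_on {0..T} J"
    unfolding J_def by (rule indefinite_integral_continuous_1[OF f(1)])
  then obtain G where G: "\<And>t. t \<in> {0<..<T} \<Longrightarrow> (G has_real_derivative J t) (at t)"
    using antiderivative_Icc by blast
  note hi = integral_difference_quotient[OF G h]
  have int: "((\<lambda>t. integral {t - h..t} f / h) has_integral ((G b - G (b - h)) / h - (G a - G (a - h)) / h)) {a..b}"
    by (rule has_integral_eq[OF _ hi]) (simp add: diff)
  then show "(\<lambda>t. integral {t - h..t} f / h) integrable_on {a..b}"
    by (rule has_integral_integrable)
  \<comment> \<open>The average of \<open>J\<close> over a short interval is a value of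
    \<open>J\<close>, so the integral of the averages becomes \<open>J z - J y\<close> with
    \<open>J y\<close> nonnegative and \<open>J z\<close> at most \<open>J T\<close>.\<close>
  have mvt: "\<exists>z. t - h < z \<and> z < t \<and> (G t - G (t - h)) / h = J z" if "t \<in> {a..b}" for t
  proof -
    have "\<And>x. t - h \<le> x \<Longrightarrow> x \<le> t \<Longrightarrow> (G has_real_derivative J x) (at x)"
      using G h that by auto
    then obtain z where "t - h < z" "z < t" "G t - G (t - h) = (t - (t - h)) * J z"
      using MVT2[of "t - h" t G J] h by auto
    then show ?thesis using h by (intro exI[of _ z]) simp
  qed
  obtain y z where yz: "a - h < y" "y < a" "(G a - G (a - h)) / h = J y"
    "b - h < z" "z < b" "(G b - G (b - h)) / h = J z"
    using mvt[of a] mvt[of b] h by auto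
  then have "integral {a..b} (\<lambda>t. integral {t - h..t} f / h) = J z - J y"
    using integral_unique[OF int] by simp
  then show "integral {a..b} (\<lambda>t. integral {t - h..t} f / h) \<le> integral {0..T} f"
    using J_nonneg[of y] J_mono[of z T] yz h by (simp add: J_def)
qed

lemma L2_restrict_space_subset:
  assumes k: "k \<in> L2 (restrict_space M S)" and A: "A \<subseteq> S" "A \<in> sets M" "S \<in> sets M"
  shows "k \<in> L2 (restrict_space M A)" "L2_norm (restrict_space M A) k \<le> L2_norm (restrict_space M S) k"
proof -
  have "k \<in> borel_measurable (restrict_space M A)"
    using k by (intro measurable_restrict_mono[OF _ A(1)]) (simp add: L2_def)
  moreover have i: "integrable (restrict_space M S) (\<lambda>x. (k x)\<^sup>2)" using k by (simp add: L2_def)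
  ultimately show "k \<in> L2 (restrict_space M A)"
    using integrable_restrict_space_subset[OF i A] by (simp add: L2_def)
  show "L2_norm (restrict_space M A) k \<le> L2_norm (restrict_space M S) k"
    using integral_restrict_space_mono[OF i A] by (simp add: L2_norm_def)
qed

text \<open>Bridges the Lebesgue integral on open intervals, used for the function spaces, and the
  gauge integral on closed ones, used for calculus; endpoints are null.\<close>

lemma integrable_lebesgue_on_Ioo:
  fixes f :: "real \<Rightarrow> real"
  assumes "integrable (lebesgue_on {a<..<b}) f"
  shows "f integrable_on {a..b}" "(\<integral>t. f t \<partial>lebesgue_on {a<..<b}) = integral {a..b} f"
proof -
  show "f integrable_on {a..b}"
    using integrable_on_lebesgue_on[OF assms] by (simp add: integrable_on_open_interval_real)
  show "(\<integral>t. f t \<partial>lebesgue_on {a<..<b}) = integral {a..b} f"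
    using lebesgue_integral_eq_integral[OF assms] by (simp add: integral_open_interval_real)
qed

lemma continuous_integrable_Ioo:
  fixes f :: "real \<Rightarrow> real"
  assumes "continuous_on {a..b} f"
  shows "integrable (lebesgue_on {a<..<b}) f"
  by (rule integrable_restrict_space_subset[OF continuous_imp_integrable_real[OF assms]]) auto

lemma integral_square_le:
  fixes k :: "real \<Rightarrow> real"
  assumes k: "k \<in> L2 (lebesgue_on {s<..<t})" and st: "s \<le> t"
  shows "(integral {s..t} k)\<^sup>2 \<le> (t - s) * integral {s..t} (\<lambda>x. (k x)\<^sup>2)"
proof -
  let ?M = "lebesgue_on {s<..<t}"
  have fin: "finite_measure ?M" by (rule finite_measure_lebesgue_on) simp
  then interpret finite_measure ?M .
  have one: "(\<lambda>x. 1) \<in> L2 ?M" by (simp add: L2_def)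
  have "(L2_inner ?M k (\<lambda>x. 1))\<^sup>2 \<le> L2_inner ?M k k * L2_inner ?M (\<lambda>x. 1) (\<lambda>x. 1)"
    by (rule L2.Cauchy_Schwarz_square[OF k one])
  moreover have "L2_inner ?M k (\<lambda>x. 1) = integral {s..t} k"
    using integrable_lebesgue_on_Ioo[OF L2_imp_integrable[OF fin k]] by (simp add: L2_inner_def)
  moreover have "L2_inner ?M k k = integral {s..t} (\<lambda>x. (k x)\<^sup>2)"
    using integrable_lebesgue_on_Ioo[of s t "\<lambda>x. (k x)\<^sup>2"] k
    by (simp add: L2_inner_def L2_def power2_eq_square)
  moreover have "L2_inner ?M (\<lambda>x. 1) (\<lambda>x. 1) = t - s"
    using st by (simp add: L2_inner_def measure_restrict_space)
  ultimately show ?thesis by (simp add: mult.commute)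
qed

lemma L2_imp_integrable_Icc:
  fixes k :: "real \<Rightarrow> real"
  assumes k: "k \<in> L2 (lebesgue_on {0<..<T})"
  shows "k integrable_on {0..T}" "(\<lambda>t. (k t)\<^sup>2) integrable_on {0..T}"
    "integral {0..T} (\<lambda>t. (k t)\<^sup>2) = (L2_norm (lebesgue_on {0<..<T}) k)\<^sup>2"
proof -
  have fin: "finite_measure (lebesgue_on {0<..<T})" by (rule finite_measure_lebesgue_on) simp
  show "k integrable_on {0..T}"
    by (rule integrable_lebesgue_on_Ioo[OF L2_imp_integrable[OF fin k]])
  have "integrable (lebesgue_on {0<..<T}) (\<lambda>t. (k t)\<^sup>2)" using k by (simp add: L2_def)
  note i = integrable_lebesgue_on_Ioo[OF this]
  show "(\<lambda>t. (k t)\<^sup>2) integrable_on {0..T}"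
    "integral {0..T} (\<lambda>t. (k t)\<^sup>2) = (L2_norm (lebesgue_on {0<..<T}) k)\<^sup>2"
    using i by (simp_all add: L2_norm_def integral_nonneg flip: i(2))
qed

text \<open>For \<open>k r = l r v\<close> this is the increment of \<open>B (w t) v\<close> over
  \<open>[t - h, t]\<close> divided by \<open>h\<close>.\<close>

definition backward_average :: "real \<Rightarrow> (real \<Rightarrow> real) \<Rightarrow> real \<Rightarrow> real" where
  "backward_average h k t = integral {t - h..t} k / h"

context
  fixes T a b :: real and k :: "real \<Rightarrow> real"
  assumes k: "k \<in> L2 (lebesgue_on {0<..<T})" and ab: "0 < a" "a \<le> b" "b < T"
begin

lemma backward_average_eq:
  assumes "0 < h" "h < a" "t \<in> {a..b}"
  shows "backward_average h k t = (integral {0..t} k - integral {0..t - h} k) / h"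
proof -
  have "k integrable_on {0..t}"
    using ab assms by (intro integrable_subinterval_real[OF L2_imp_integrable_Icc(1)[OF k]]) auto
  then show ?thesis
    using Henstock_Kurzweil_Integration.integral_combine[where f = k and a = 0 and c = "t - h" and b = t] assms
    by (simp add: backward_average_def)
qed

lemma continuous_on_indefinite_integral: "continuous_on {0..T} (\<lambda>t. integral {0..t} k)"
  by (rule indefinite_integral_continuous_1[OF L2_imp_integrable_Icc(1)[OF k]])

lemma continuous_on_backward_average:
  assumes "0 < h" "h < a"
  shows "continuous_on {a..b} (backward_average h k)"
proof -
  have "continuous_on {a..b} (\<lambda>t. (integral {0..t} k - integral {0..t - h} k) / h)"
    using assms ab
    by (intro continuous_intros continuous_on_compose2[OF continuous_on_indefinite_integral]) auto
  then show ?thesis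
    by (rule continuous_on_eq) (rule backward_average_eq[OF assms, symmetric])
qed

text \<open>By Cauchy-Schwarz the square of an average is at most the average of the square, and
  averaging does not increase the integral of a nonnegative function.\<close>

lemma backward_average_L2:
  assumes h: "0 < h" "h < a"
  shows "backward_average h k \<in> L2 (lebesgue_on {a<..<b})"
    and "L2_norm (lebesgue_on {a<..<b}) (backward_average h k) \<le> L2_norm (lebesgue_on {0<..<T}) k"
proof -
  let ?A = "backward_average h k" and ?M = "lebesgue_on {a<..<b}"
  note c = continuous_on_backward_average[OF h]
  have i2: "integrable ?M (\<lambda>t. (?A t)\<^sup>2)"
    by (intro continuous_integrable_Ioo continuous_intros c)
  then show "?A \<in> L2 ?M"
    using continuous_integrable_Ioo[OF c] by (auto simp: L2_def)
  note avg = integral_average_le[OF L2_imp_integrable_Icc(2)[OF k] zero_le_power2 h ab(2,3)]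
  have "(\<integral>t. (?A t)\<^sup>2 \<partial>?M) = integral {a..b} (\<lambda>t. (?A t)\<^sup>2)"
    by (rule integrable_lebesgue_on_Ioo(2)[OF i2])
  also have "\<dots> \<le> integral {a..b} (\<lambda>t. integral {t - h..t} (\<lambda>x. (k x)\<^sup>2) / h)"
  proof (rule integral_le)
    show "(\<lambda>t. (?A t)\<^sup>2) integrable_on {a..b}" by (rule integrable_lebesgue_on_Ioo(1)[OF i2])
    fix t assume t: "t \<in> {a..b}"
    have "k \<in> L2 (lebesgue_on {t - h<..<t})"
      using t ab h by (intro L2_restrict_space_subset[OF k]) auto
    then have "(integral {t - h..t} k)\<^sup>2 \<le> h * integral {t - h..t} (\<lambda>x. (k x)\<^sup>2)"
      using integral_square_le[of k "t - h" t] h by simp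
    then show "(?A t)\<^sup>2 \<le> integral {t - h..t} (\<lambda>x. (k x)\<^sup>2) / h"
      using h by (simp add: backward_average_def power_divide power2_eq_square field_simps)
  qed (rule avg)
  also have "\<dots> \<le> integral {0..T} (\<lambda>t. (k t)\<^sup>2)" by (rule avg)
  also have "\<dots> = (L2_norm (lebesgue_on {0<..<T}) k)\<^sup>2" by (rule L2_imp_integrable_Icc[OF k])
  finally show "L2_norm ?M ?A \<le> L2_norm (lebesgue_on {0<..<T}) k"
    unfolding L2_norm_def[of ?M] using L2.norm_nonneg[OF k] by (intro real_le_lsqrt) auto
qed

text \<open>On an interval the averages are difference quotients of the indefinite integral, whose
  integrals converge. The contraction property gives the uniform bound that carries this over to
  measurable sets, later the level sets of a simple function.\<close>

lemma backward_average_weak_convergence: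
  assumes h: "\<And>n. 0 < h n" "\<And>n. h n < a" "h \<longlonglongrightarrow> 0" and E: "E \<in> sets lebesgue"
  shows "(\<lambda>n. \<integral>t. indicator E t * backward_average (h n) k t \<partial>lebesgue_on {a<..<b}) \<longlonglongrightarrow>
    (\<integral>t. indicator E t * k t \<partial>lebesgue_on {a<..<b})"
proof (rule L2_weak_convergence_on_sets[OF backward_average_L2[OF h(1,2)] _ _ _ E])
  have sub: "{a<..<b} \<subseteq> {0<..<T}" using ab by auto
  show "k \<in> L2 (lebesgue_on {a<..<b})"
    "L2_norm (lebesgue_on {a<..<b}) k \<le> L2_norm (lebesgue_on {0<..<T}) k"
    using L2_restrict_space_subset[OF k sub] by auto
  fix c d
  define p r where "p = max a c" and "r = min b d"
  show "(\<lambda>n. \<integral>t. indicator (box c d) t * backward_average (h n) k t \<partial>lebesgue_on {a<..<b}) \<longlonglongrightarrow>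
    (\<integral>t. indicator (box c d) t * k t \<partial>lebesgue_on {a<..<b})"
  proof (cases "p \<le> r")
    case True
    have e: "(\<integral>t. indicator (box c d) t * f t \<partial>lebesgue_on {a<..<b}) = (\<integral>t. f t \<partial>lebesgue_on {p<..<r})" for f :: "real \<Rightarrow> real"
      unfolding integral_restrict_space[of "{a<..<b}" lebesgue, simplified]
        integral_restrict_space[of "{p<..<r}" lebesgue, simplified]
      by (rule Bochner_Integration.integral_cong) (auto simp: indicator_def p_def r_def)
    have pr: "0 < p" "p \<le> r" "r < T" "h n < p" "{p..r} \<subseteq> {a..b}" for n
      using ab True h(2)[of n] by (auto simp: p_def r_def)
    have 1: "(\<integral>t. backward_average (h n) k t \<partial>lebesgue_on {p<..<r}) =
        integral {p..r} (\<lambda>t. (integral {0..t} k - integral {0..t - h n} k) / h n)" for n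
    proof -
      have "continuous_on {p..r} (backward_average (h n) k)"
        using continuous_on_subset[OF continuous_on_backward_average[OF h(1,2)] pr(5)] .
      then have "(\<integral>t. backward_average (h n) k t \<partial>lebesgue_on {p<..<r}) = integral {p..r} (backward_average (h n) k)"
        by (intro integrable_lebesgue_on_Ioo(2) continuous_integrable_Ioo)
      also have "\<dots> = integral {p..r} (\<lambda>t. (integral {0..t} k - integral {0..t - h n} k) / h n)"
        using pr(5) by (intro Henstock_Kurzweil_Integration.integral_cong backward_average_eq h) auto
      finally show ?thesis .
    qed
    have kpr: "k integrable_on {0..r}"
      using ab by (intro integrable_subinterval_real[OF L2_imp_integrable_Icc(1)[OF k]]) (auto simp: r_def)
    have "{p<..<r} \<subseteq> {0<..<T}" using pr by auto
    from L2_restrict_space_subset(1)[OF k this]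
    have "(\<integral>t. k t \<partial>lebesgue_on {p<..<r}) = integral {p..r} k"
      by (intro integrable_lebesgue_on_Ioo(2) L2_imp_integrable finite_measure_lebesgue_on) auto
    also have "\<dots> = integral {0..r} k - integral {0..p} k"
      using Henstock_Kurzweil_Integration.integral_combine[where f = k and a = 0 and c = p and b = r] pr kpr by simp
    finally show ?thesis
      unfolding e 1 using integral_difference_quotient_tendsto[OF continuous_on_indefinite_integral pr(1-3) h(1) pr(4) h(3)]
      by simp
  next
    case False
    have "(\<integral>t. indicator (box c d) t * f t \<partial>lebesgue_on {a<..<b}) = 0" for f :: "real \<Rightarrow> real"
    proof -
      have "(\<integral>t. indicator (box c d) t * f t \<partial>lebesgue_on {a<..<b}) = (\<integral>t. 0 \<partial>lebesgue_on {a<..<b})"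
        by (rule Bochner_Integration.integral_cong)
          (use False in \<open>auto simp: indicator_def p_def r_def\<close>)
      then show ?thesis by simp
    qed
    then show ?thesis by simp
  qed
qed

end

section \<open>The energy inequality\<close>

lemma indicator_L2_lebesgue_on:
  assumes "S \<in> lmeasurable" "A \<in> sets lebesgue"
  shows "indicat_real A \<in> L2 (lebesgue_on S)"
proof -
  interpret finite_measure "lebesgue_on S" using assms(1) by (rule finite_measure_lebesgue_on)
  have [measurable]: "indicat_real A \<in> borel_measurable (lebesgue_on S)"
    using assms(2) by (intro measurable_restrict_space1 borel_measurable_indicator)
  have "integrable (lebesgue_on S) (\<lambda>x. (indicat_real A x)\<^sup>2)"
    by (rule integrable_const_bound[where B = 1]) (auto simp: power2_eq_square abs_mult intro!: mult_le_one)
  then show ?thesis by (simp add: L2_def)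
qed

text \<open>The left side equals \<open>2 B (u - v) u - B (u - v) (u - v)\<close>; the last term is
  dropped.\<close>

lemma (in semi_inner_space) inner_self_diff_le:
  assumes "u \<in> X" "v \<in> X"
  shows "B u u - B v v \<le> 2 * B (u - v) u"
proof -
  have "B (u - v) (u - v) = B u u - 2 * B v u + B v v"
    using inner_add_self[OF assms, of "- 1"] inner_commute[OF assms] by (simp add: fun_diff_def)
  then show ?thesis
    using inner_nonneg[OF diff_mem[OF assms]] inner_diff[OF assms assms(1)] by simp
qed

text \<open>The third space of the triple is the dual of \<open>X\<close>; an element
  \<open>y\<close> of \<open>Y\<close> acts on \<open>X\<close> as the functional
  \<open>B y\<close>.\<close>

locale gelfand_triple = X: seminormed_space X N + Y: semi_inner_space Y B
  for X N Y B +
  assumes X_subset_Y: "X \<subseteq> Y"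
begin

lemma continuous_on_inner_self:
  assumes Y: "\<And>t. t \<in> S \<Longrightarrow> w t \<in> Y"
    and cont: "\<And>t. t \<in> S \<Longrightarrow> ((\<lambda>s. sqrt (B (w s - w t) (w s - w t))) \<longlongrightarrow> 0) (at t within S)"
  shows "continuous_on S (\<lambda>t. B (w t) (w t))"
proof -
  have "continuous_on S (\<lambda>t. sqrt (B (w t) (w t)))"
    unfolding continuous_on_def
  proof
    fix t assume t: "t \<in> S"
    have "\<forall>\<^sub>F s in at t within S. s \<in> S"
      by (simp add: eventually_at_filter)
    then have "\<forall>\<^sub>F s in at t within S.
        norm (sqrt (B (w s) (w s)) - sqrt (B (w t) (w t))) \<le> sqrt (B (w s - w t) (w s - w t))"
      by eventually_elim (use Y.norm_reverse_triangle Y t in simp)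
    from Lim_null_comparison[OF this cont[OF t]]
    show "((\<lambda>t. sqrt (B (w t) (w t))) \<longlongrightarrow> sqrt (B (w t) (w t))) (at t within S)"
      by (rule LIM_zero_cancel)
  qed
  then have "continuous_on S (\<lambda>t. (sqrt (B (w t) (w t)))\<^sup>2)"
    by (rule continuous_on_power)
  then show ?thesis
    by (rule continuous_on_eq) (use Y Y.inner_nonneg in auto)
qed

text \<open>Formally, with \<open>p = exp(kappa t)\<close>, the derivative of
  \<open>p B(w,w)\<close> is \<open>p (2 l(w) + kappa B(w,w))\<close>, at most \<open>p m\<close>:
  the weight cancels the dissipation term. Only \<open>deriv\<close> ties \<open>l\<close> to
  \<open>w\<close>, and only for \<open>v\<close> constant in time.\<close>

lemma energy_inequality:
  fixes w :: "real \<Rightarrow> 'a \<Rightarrow> real" and l :: "real \<Rightarrow> ('a \<Rightarrow> real) \<Rightarrow> real" and m :: "real \<Rightarrow> real" and T a b \<kappa> :: real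
  defines "M \<equiv> lebesgue_on {0<..<T}"
  assumes ab: "0 < a" "a \<le> b" "b < T"
    and wY: "\<And>t. t \<in> {0..T} \<Longrightarrow> w t \<in> Y"
    and cont: "\<And>t. t \<in> {0..T} \<Longrightarrow>
      ((\<lambda>s. sqrt (B (w s - w t) (w s - w t))) \<longlongrightarrow> 0) (at t within {0..T})"
    and w: "w \<in> bochner_L2 M X N"
    and l: "l \<in> bochner_L2 M (dual_space X N) (dual_norm X N)"
    and deriv: "\<And>v s t. v \<in> X \<Longrightarrow> 0 < s \<Longrightarrow> s < t \<Longrightarrow> t < T \<Longrightarrow>
      B (w t) v - B (w s) v = integral {s..t} (\<lambda>r. l r v)"
    and diss: "AE t in M. 2 * l t (w t) \<le> m t - \<kappa> * B (w t) (w t)"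
    and m: "integrable M (\<lambda>t. exp (\<kappa> * t) * m t)"
  shows "exp (\<kappa> * b) * B (w b) (w b) - exp (\<kappa> * a) * B (w a) (w a) \<le>
    (\<integral>t. exp (\<kappa> * t) * m t \<partial>lebesgue_on {a<..<b})"
proof -
  let ?Mab = "lebesgue_on {a<..<b}"
  have sub: "{a<..<b} \<subseteq> {0<..<T}" using ab by auto
  have cM: "complete_measure M" unfolding M_def by (rule complete_measure_lebesgue_on) simp
  interpret dual: seminormed_space "dual_space X N" "dual_norm X N" by (rule X.seminormed_space_dual)
  have AE_ab: "AE t in ?Mab. P t" if "AE t in M. P t" for P
    using that ab unfolding M_def by (auto simp: AE_restrict_space_iff elim!: eventually_mono)
  define p where "p t = exp (\<kappa> * t)" for t
  define e where "e t = p t * B (w t) (w t)" for t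
  define D where "D t = dual_norm X N (l t)" for t
  \<comment> \<open>The weight joins \<open>w\<close> before approximation, so the simple function
    approximates \<open>p w\<close> and its finitely many values need no time-dependent
    factor.\<close>
  define W where "W t = (\<lambda>x. p t * w t x)" for t
  \<comment> \<open>Any null sequence below \<open>a\<close> would do; then \<open>t - h n\<close>
    stays positive for \<open>t\<close> beyond \<open>a\<close>.\<close>
  define h where "h n = a / real (n + 2)" for n
  define C where "C = L2_norm M D"
  have h: "0 < h n" "h n < a" for n
    using ab by (auto simp: h_def field_simps intro!: add_strict_increasing)
  have h0: "h \<longlonglongrightarrow> 0"
    unfolding h_def using LIMSEQ_ignore_initial_segment
        [OF tendsto_divide_0[OF tendsto_const filterlim_real_at_infinity_sequentially], of a 2]
    by simp
  have \<phi>: "continuous_on {0..T} (\<lambda>t. B (w t) (w t))"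
    by (rule continuous_on_inner_self[OF wY cont])
  have e: "continuous_on {0..T} e"
    unfolding e_def p_def by (intro continuous_intros \<phi>)
  have D: "D \<in> L2 M" unfolding D_def by (rule dual.bochner_L2_norm[OF cM l])
  have C: "C \<ge> 0" unfolding C_def by (rule L2.norm_nonneg[OF D])
  have lX: "AE t in M. l t \<in> dual_space X N" and wX: "AE t in M. w t \<in> X"
    using l w by (auto simp: bochner_L2_def strongly_measurable_def)
  have lv: "(\<lambda>t. l t v) \<in> L2 M" if "v \<in> X" for v
    by (rule X.bochner_L2_dual_apply[OF cM l that])
  note fin = finite_measure_lebesgue_on[OF lmeasurable_interval(2)[of a b]]
  have W: "W \<in> bochner_L2 M X N"
    unfolding W_def
  proof (rule X.bochner_L2_scale[OF cM w])
    show "p \<in> borel_measurable M"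
      unfolding M_def p_def by (intro continuous_imp_measurable_on_sets_lebesgue continuous_intros) auto
    show "\<bar>p t\<bar> \<le> exp (\<bar>\<kappa>\<bar> * T)" if "t \<in> space M" for t
    proof -
      have "\<kappa> * t \<le> \<bar>\<kappa>\<bar> * T" using that by (intro mult_mono) (auto simp: M_def)
      then show ?thesis by (simp add: p_def)
    qed
  qed
  have avg_bound: "\<bar>backward_average (h n) (\<lambda>r. l r v) t\<bar> \<le> backward_average (h n) D t * N v"
    if v: "v \<in> X" and t: "t \<in> {a<..<b}" for v n t
  proof -
    let ?I = "lebesgue_on {t - h n<..<t}"
    have sI: "{t - h n<..<t} \<subseteq> {0<..<T}" using t ab h[of n] by auto
    note finI = finite_measure_lebesgue_on[OF lmeasurable_interval(2)[of "t - h n" t]]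
    have iv: "integrable ?I (\<lambda>r. l r v)" and iD: "integrable ?I D"
      using L2_restrict_space_subset(1)[OF lv[OF v, unfolded M_def] sI]
        L2_restrict_space_subset(1)[OF D[unfolded M_def] sI] finI
      by (auto intro: L2_imp_integrable)
    have "\<bar>integral {t - h n..t} (\<lambda>r. l r v)\<bar> = \<bar>\<integral>r. l r v \<partial>?I\<bar>"
      using integrable_lebesgue_on_Ioo(2)[OF iv] by simp
    also have "\<dots> \<le> (\<integral>r. \<bar>l r v\<bar> \<partial>?I)"
      by (rule integral_abs_bound)
    also have "\<dots> \<le> (\<integral>r. D r * N v \<partial>?I)"
    proof (rule integral_mono_AE)
      have "AE r in ?I. l r \<in> dual_space X N"
        using lX sI unfolding M_def by (auto simp: AE_restrict_space_iff elim!: eventually_mono)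
      then show "AE r in ?I. \<bar>l r v\<bar> \<le> D r * N v"
        by eventually_elim (use X.dual_norm_bound v in \<open>auto simp: D_def\<close>)
    qed (use iv iD in auto)
    also have "\<dots> = integral {t - h n..t} D * N v"
      using integrable_lebesgue_on_Ioo(2)[OF iD] by simp
    finally show ?thesis using h(1)[of n] by (simp add: backward_average_def field_simps)
  qed
  \<comment> \<open>Replacing \<open>W\<close> by a simple function costs
    \<open>2 * C * \<epsilon>\<close> before the limit, with averages, and again
    \<open>2 * C * \<epsilon>\<close> after it, when returning to \<open>W\<close>.\<close>
  have key: "e b - e a \<le> (\<integral>t. p t * m t \<partial>?Mab) + 4 * C * \<epsilon>" if \<epsilon>: "\<epsilon> > 0" for \<epsilon>
  proof -
    obtain s where s: "simple_function M s" "s ` space M \<subseteq> X"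
      and z: "(\<lambda>t. N (W t - s t)) \<in> L2 M" "L2_norm M (\<lambda>t. N (W t - s t)) \<le> \<epsilon>"
      using X.bochner_L2_simple_approximation[OF cM W \<epsilon>] by blast
    define R where "R = s ` {0<..<T}"
    \<comment> \<open>On each level set the test vector is constant, so the time-dependent pairing
      becomes a finite sum of indicators times scalar functions.\<close>
    define E where "E c = {t \<in> {0<..<T}. s t = c}" for c
    have R: "finite R" "R \<subseteq> X" using s simple_functionD(1)[OF s(1)] by (auto simp: R_def M_def)
    have E_leb: "E c \<in> sets lebesgue" for c
    proof -
      have "s -` {c} \<inter> space M \<in> sets M" using simple_functionD(2)[OF s(1)] .
      moreover have "s -` {c} \<inter> space M = E c" by (auto simp: E_def M_def)
      ultimately show ?thesis by (simp add: M_def sets_restrict_space_iff)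
    qed
    have pick: "(\<Sum>c\<in>R. indicator (E c) t * f c) = f (s t)" if "t \<in> {0<..<T}" for t and f :: "('a \<Rightarrow> real) \<Rightarrow> real"
    proof -
      have "(\<Sum>c\<in>R. indicator (E c) t * f c) = (\<Sum>c\<in>R. if c = s t then f c else 0)"
        using that by (intro sum.cong) (auto simp: E_def indicator_def)
      then show ?thesis using R that by (simp add: R_def)
    qed
    define k where "k c t = l t c" for c t
    have kL2: "k c \<in> L2 M" if "c \<in> R" for c using lv[of c] R that by (auto simp: k_def[abs_def])
    define A where "A n = backward_average (h n)" for n
    have AL2: "A n f \<in> L2 ?Mab" "L2_norm ?Mab (A n f) \<le> L2_norm M f" if "f \<in> L2 M" for n f
      unfolding A_def M_def using backward_average_L2[OF that[unfolded M_def] ab h] .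
    have zab: "(\<lambda>t. N (W t - s t)) \<in> L2 ?Mab" "L2_norm ?Mab (\<lambda>t. N (W t - s t)) \<le> \<epsilon>"
      using L2_restrict_space_subset[OF z(1)[unfolded M_def] sub] z(2) by (auto simp: M_def)
    have Dab: "D \<in> L2 ?Mab" "L2_norm ?Mab D \<le> C"
      using L2_restrict_space_subset[OF D[unfolded M_def] sub] by (auto simp: M_def C_def)
    have int_E: "integrable ?Mab (\<lambda>t. indicator (E c) t * f t)" if "f \<in> L2 ?Mab" for c f
      by (intro integrable_mult_L2 indicator_L2_lebesgue_on E_leb that) simp
    have err: "integrable ?Mab (\<lambda>t. f t * N (W t - s t))" "(\<integral>t. f t * N (W t - s t) \<partial>?Mab) \<le> C * \<epsilon>"
      if f: "f \<in> L2 ?Mab" "L2_norm ?Mab f \<le> C" for f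
    proof -
      show "integrable ?Mab (\<lambda>t. f t * N (W t - s t))" by (rule integrable_mult_L2[OF f(1) zab(1)])
      have "\<bar>L2_inner ?Mab f (\<lambda>t. N (W t - s t))\<bar> \<le> L2_norm ?Mab f * L2_norm ?Mab (\<lambda>t. N (W t - s t))"
        by (rule L2.Cauchy_Schwarz[OF f(1) zab(1)])
      also have "\<dots> \<le> C * \<epsilon>" using f(2) zab C L2.norm_nonneg[OF zab(1)] by (intro mult_mono) auto
      finally show "(\<integral>t. f t * N (W t - s t) \<partial>?Mab) \<le> C * \<epsilon>" by (simp add: L2_inner_def)
    qed
    have WX: "AE t in M. W t \<in> X"
      using wX by eventually_elim (auto simp: W_def intro: X.scale_mem)
    define q where "q n t = p t * (B (w t) (w t) - B (w (t - h n)) (w (t - h n))) / h n" for n t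
    have q_le: "AE t in ?Mab. q n t \<le>
        2 * (\<Sum>c\<in>R. indicator (E c) t * A n (k c) t) + 2 * (A n D t * N (W t - s t))" for n
      using AE_ab[OF wX] AE_ab[OF WX] AE_space
    proof eventually_elim
      case (elim t)
      then have t: "t \<in> {a<..<b}" by simp
      have tT: "t \<in> {0<..<T}" using t sub by auto
      have sX: "s t \<in> X" using s(2) tT by (auto simp: M_def)
      have Yt: "w t \<in> Y" "w (t - h n) \<in> Y" using wY t ab h[of n] by auto
      note dY = Y.diff_mem[OF Yt]
      \<comment> \<open>With \<open>t\<close> held fixed, \<open>v\<close> may be taken as
        \<open>s t\<close> or \<open>W t - s t\<close>, although \<open>deriv\<close> speaks of
        constant vectors.\<close>
      have B_eq: "B (w t - w (t - h n)) v = h n * A n (k v) t" if v: "v \<in> X" for v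
      proof -
        have "v \<in> Y" using v X_subset_Y by blast
        then have "B (w t - w (t - h n)) v = B (w t) v - B (w (t - h n)) v"
          by (rule Y.inner_diff[OF Yt])
        also have "\<dots> = integral {t - h n..t} (k v)"
          unfolding k_def using t ab h[of n] by (intro deriv v) auto
        finally show ?thesis using h(1)[of n] by (simp add: A_def backward_average_def)
      qed
      have dX: "W t - s t \<in> X" using elim(2) sX by (rule X.diff_mem)
      have in_Y: "W t \<in> Y" "s t \<in> Y" using elim(2) sX X_subset_Y by auto
      have "q n t \<le> p t * (2 * B (w t - w (t - h n)) (w t)) / h n"
        unfolding q_def using Y.inner_self_diff_le[OF Yt] h(1)[of n]
        by (intro divide_right_mono mult_left_mono) (auto simp: p_def)
      also have "p t * (2 * B (w t - w (t - h n)) (w t)) = 2 * B (w t - w (t - h n)) (W t)"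
        unfolding W_def using Y.inner_scale[OF Yt(1) dY] Y.inner_commute[OF dY] Y.scale_mem Yt by simp
      also have "B (w t - w (t - h n)) (W t) =
          B (w t - w (t - h n)) (s t) + B (w t - w (t - h n)) (W t - s t)"
        using Y.inner_diff[OF in_Y dY] Y.inner_commute[OF dY] in_Y Y.diff_mem by simp
      also have "2 * \<dots> / h n = 2 * A n (k (s t)) t + 2 * A n (k (W t - s t)) t"
        using h(1)[of n] by (simp add: B_eq[OF sX] B_eq[OF dX] add_divide_distrib)
      also have "\<dots> \<le> 2 * A n (k (s t)) t + 2 * (A n D t * N (W t - s t))"
        using avg_bound[OF dX t, of n] by (simp add: A_def k_def[abs_def])
      also have "A n (k (s t)) t = (\<Sum>c\<in>R. indicator (E c) t * A n (k c) t)"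
        by (rule pick[OF tT, symmetric])
      finally show ?case .
    qed
    \<comment> \<open>A discrete product rule: the quotient of \<open>e\<close> minus the quotient
      of the weight times \<open>e (t - h n)\<close>. The latter is rewritten through
      \<open>e t\<close> and the quotient of \<open>e\<close>, whose integrals have known
      limits.\<close>
    have q_eq: "q n t = (e t - e (t - h n)) / h n -
        (exp (\<kappa> * h n) - 1) / h n * (e t - h n * ((e t - e (t - h n)) / h n))" for n t
    proof -
      have "p t = exp (\<kappa> * h n) * p (t - h n)"
        by (simp add: p_def exp_add[symmetric] algebra_simps)
      then show ?thesis using h(1)[of n] by (simp add: q_def e_def field_simps)
    qed
    have e_ab: "continuous_on {a..b} e" using e by (rule continuous_on_subset) (use ab in auto)
    have dq: "continuous_on {a..b} (\<lambda>t. (e t - e (t - h n)) / h n)" for n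
      using ab h[of n] by (intro continuous_intros e_ab continuous_on_compose2[OF e]) auto
    have q_cont: "continuous_on {a..b} (q n)" for n
    proof -
      have "continuous_on {a..b} (\<lambda>t. (e t - e (t - h n)) / h n -
        (exp (\<kappa> * h n) - 1) / h n * (e t - h n * ((e t - e (t - h n)) / h n)))"
        by (rule continuous_intros dq e_ab)+
      then show ?thesis unfolding q_eq[symmetric] .
    qed
    \<comment> \<open>The term \<open>0 * (e b - e a)\<close> is kept in this form as the limit of
      \<open>h n * ?d n\<close>.\<close>
    have q_lim: "(\<lambda>n. \<integral>t. q n t \<partial>?Mab) \<longlonglongrightarrow> (e b - e a) - \<kappa> * (integral {a..b} e - 0 * (e b - e a))"
    proof -
      let ?d = "\<lambda>n. integral {a..b} (\<lambda>t. (e t - e (t - h n)) / h n)"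
      have eq: "(\<integral>t. q n t \<partial>?Mab) = ?d n - (exp (\<kappa> * h n) - 1) / h n * (integral {a..b} e - h n * ?d n)" for n
      proof -
        have "(\<integral>t. q n t \<partial>?Mab) = integral {a..b} (q n)"
          by (intro integrable_lebesgue_on_Ioo continuous_integrable_Ioo q_cont)
        also have "(q n has_integral ?d n - (exp (\<kappa> * h n) - 1) / h n * (integral {a..b} e - h n * ?d n)) {a..b}"
          unfolding q_eq[abs_def]
          by (intro has_integral_diff has_integral_mult_right integrable_integral
              integrable_continuous_interval dq e_ab)
        then have "integral {a..b} (q n) = ?d n - (exp (\<kappa> * h n) - 1) / h n * (integral {a..b} e - h n * ?d n)"
          by (rule integral_unique)
        finally show ?thesis .
      qed
      have d: "?d \<longlonglongrightarrow> e b - e a"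
        by (rule integral_difference_quotient_tendsto[OF e ab h h0])
      have "((\<lambda>x. (exp (\<kappa> * x) - 1) / x) \<longlongrightarrow> \<kappa>) (at 0)"
      proof -
        have "((\<lambda>x. exp (\<kappa> * x)) has_real_derivative \<kappa>) (at 0)"
          by (auto intro!: derivative_eq_intros)
        then show ?thesis by (simp add: DERIV_def)
      qed
      moreover have "h n \<noteq> 0" for n using h(1)[of n] by simp
      then have "filterlim h (at 0) sequentially"
        using h0 by (simp add: filterlim_at)
      ultimately have x: "(\<lambda>n. (exp (\<kappa> * h n) - 1) / h n) \<longlonglongrightarrow> \<kappa>"
        by (rule filterlim_compose)
      show ?thesis unfolding eq by (intro tendsto_intros d x h0)
    qed
    have sum_lim: "(\<lambda>n. 2 * (\<Sum>c\<in>R. \<integral>t. indicator (E c) t * A n (k c) t \<partial>?Mab) + 2 * (C * \<epsilon>)) \<longlonglongrightarrow>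
        2 * (\<Sum>c\<in>R. \<integral>t. indicator (E c) t * k c t \<partial>?Mab) + 2 * (C * \<epsilon>)"
    proof -
      have "(\<lambda>n. \<integral>t. indicator (E c) t * A n (k c) t \<partial>?Mab) \<longlonglongrightarrow>
          (\<integral>t. indicator (E c) t * k c t \<partial>?Mab)" if "c \<in> R" for c
        unfolding A_def
        by (rule backward_average_weak_convergence[OF kL2[OF that, unfolded M_def] ab h h0 E_leb])
      then show ?thesis by (intro tendsto_add tendsto_mult tendsto_const tendsto_sum)
    qed
    \<comment> \<open>Contraction bounds the averages of \<open>D\<close> by \<open>C\<close> in
      norm, so the remainder contributes at most \<open>C * \<epsilon>\<close> uniformly in
      \<open>n\<close>.\<close>
    have q_int_le: "(\<integral>t. q n t \<partial>?Mab) \<le>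
        2 * (\<Sum>c\<in>R. \<integral>t. indicator (E c) t * A n (k c) t \<partial>?Mab) + 2 * (C * \<epsilon>)" for n
    proof -
      have iS: "integrable ?Mab (\<lambda>t. \<Sum>c\<in>R. indicator (E c) t * A n (k c) t)"
        by (intro Bochner_Integration.integrable_sum int_E AL2 kL2)
      have AD: "A n D \<in> L2 ?Mab" "L2_norm ?Mab (A n D) \<le> C" using AL2[OF D] by (auto simp: C_def)
      have "(\<integral>t. q n t \<partial>?Mab) \<le>
          (\<integral>t. 2 * (\<Sum>c\<in>R. indicator (E c) t * A n (k c) t) + 2 * (A n D t * N (W t - s t)) \<partial>?Mab)"
        by (rule integral_mono_AE[OF continuous_integrable_Ioo[OF q_cont] _ q_le])
           (intro Bochner_Integration.integrable_add integrable_mult_right iS err(1)[OF AD])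
      also have "\<dots> = 2 * (\<integral>t. (\<Sum>c\<in>R. indicator (E c) t * A n (k c) t) \<partial>?Mab) +
          2 * (\<integral>t. A n D t * N (W t - s t) \<partial>?Mab)"
        using iS err(1)[OF AD] by simp
      also have "(\<integral>t. (\<Sum>c\<in>R. indicator (E c) t * A n (k c) t) \<partial>?Mab) =
          (\<Sum>c\<in>R. \<integral>t. indicator (E c) t * A n (k c) t \<partial>?Mab)"
        by (intro Bochner_Integration.integral_sum int_E AL2 kL2)
      finally show ?thesis using err(2)[OF AD] by linarith
    qed
    have lim_le: "(e b - e a) - \<kappa> * integral {a..b} e \<le>
        2 * (\<Sum>c\<in>R. \<integral>t. indicator (E c) t * k c t \<partial>?Mab) + 2 * (C * \<epsilon>)"
      using LIMSEQ_le[OF q_lim sum_lim] q_int_le by auto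
    have kab: "k c \<in> L2 ?Mab" if "c \<in> R" for c
      using L2_restrict_space_subset(1)[OF kL2[OF that, unfolded M_def] sub] by auto
    have pm: "integrable ?Mab (\<lambda>t. p t * m t)"
      unfolding p_def by (rule integrable_restrict_space_subset[OF m[unfolded M_def] sub]) auto
    have ie: "integrable ?Mab e" by (rule continuous_integrable_Ioo[OF e_ab])
    have "2 * (\<Sum>c\<in>R. \<integral>t. indicator (E c) t * k c t \<partial>?Mab) =
        (\<integral>t. 2 * (\<Sum>c\<in>R. indicator (E c) t * k c t) \<partial>?Mab)"
      using int_E kab by (simp add: Bochner_Integration.integral_sum)
    also have "\<dots> \<le> (\<integral>t. p t * m t - \<kappa> * e t + 2 * (D t * N (W t - s t)) \<partial>?Mab)"
    proof (rule integral_mono_AE)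
      show "integrable ?Mab (\<lambda>t. 2 * (\<Sum>c\<in>R. indicator (E c) t * k c t))"
        by (intro integrable_mult_right Bochner_Integration.integrable_sum int_E kab)
      show "integrable ?Mab (\<lambda>t. p t * m t - \<kappa> * e t + 2 * (D t * N (W t - s t)))"
        by (intro Bochner_Integration.integrable_add Bochner_Integration.integrable_diff
            integrable_mult_right pm ie err(1)[OF Dab])
      show "AE t in ?Mab. 2 * (\<Sum>c\<in>R. indicator (E c) t * k c t) \<le> p t * m t - \<kappa> * e t + 2 * (D t * N (W t - s t))"
        using AE_ab[OF wX] AE_ab[OF WX] AE_ab[OF lX] AE_ab[OF diss] AE_space
      proof eventually_elim
        case (elim t)
        then have tT: "t \<in> {0<..<T}" using sub by auto
        have sX: "s t \<in> X" using s(2) tT by (auto simp: M_def)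
        have dX: "W t - s t \<in> X" using elim(2) sX by (rule X.diff_mem)
        \<comment> \<open>Averages are gone at this stage, so the simple function can be traded back
          for \<open>W t = p t * w t\<close>, to which the dissipation hypothesis applies.\<close>
        have "l t (\<lambda>x. (W t - s t) x + s t x) = l t (W t - s t) + l t (s t)"
          using elim(3) dX sX unfolding dual_space_def by blast
        then have "l t (s t) = l t (W t) - l t (W t - s t)" by (simp add: fun_eq_iff)
        moreover have "\<bar>l t (W t - s t)\<bar> \<le> D t * N (W t - s t)"
          unfolding D_def by (rule X.dual_norm_bound[OF elim(3) dX])
        moreover have "l t (W t) = p t * l t (w t)"
          using elim(1,3) by (auto simp: W_def dual_space_def)
        moreover have "p t * (2 * l t (w t)) \<le> p t * (m t - \<kappa> * B (w t) (w t))"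
          using elim(4) by (intro mult_left_mono) (auto simp: p_def)
        ultimately have "2 * l t (s t) \<le> p t * m t - \<kappa> * e t + 2 * (D t * N (W t - s t))"
          by (simp add: e_def algebra_simps)
        moreover have "(\<Sum>c\<in>R. indicator (E c) t * k c t) = l t (s t)"
          using pick[OF tT, of "\<lambda>c. k c t"] by (simp add: k_def)
        ultimately show ?case by simp
      qed
    qed
    also have "\<dots> = (\<integral>t. p t * m t \<partial>?Mab) - \<kappa> * integral {a..b} e + 2 * (\<integral>t. D t * N (W t - s t) \<partial>?Mab)"
      using pm ie err(1)[OF Dab] integrable_lebesgue_on_Ioo(2)[OF ie] by simp
    finally show ?thesis
      using lim_le err(2)[OF Dab] by (simp add: algebra_simps)
  qed
  have "e b - e a \<le> (\<integral>t. p t * m t \<partial>?Mab)"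
  proof (rule field_le_epsilon)
    fix \<delta> :: real assume \<delta>: "\<delta> > 0"
    \<comment> \<open>The added 1 covers \<open>C = 0\<close>.\<close>
    have "4 * C * (\<delta> / (4 * C + 1)) \<le> \<delta>"
      using C \<delta> by (simp add: field_simps)
    then show "e b - e a \<le> (\<integral>t. p t * m t \<partial>?Mab) + \<delta>"
      using key[of "\<delta> / (4 * C + 1)"] C \<delta> by simp
  qed
  then show ?thesis by (simp add: e_def p_def)
qed

end

section \<open>The mixed boundary value problem\<close>

lemma space_hausdorff_measure [simp]: "space (hausdorff_measure k) = UNIV"
  by (simp add: hausdorff_measure_def space_measure_of_conv)

lemma AE_surface_on_subset:
  fixes A S :: "'a::euclidean_space set"
  assumes "AE x in surface_on S. P x" "A \<subseteq> S"
    "A \<in> sets (hausdorff_measure (DIM('a) - 1))" "S \<in> sets (hausdorff_measure (DIM('a) - 1))"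
  shows "AE x in surface_on A. P x"
  using assms unfolding surface_on_def
  by (auto simp: AE_restrict_space_iff elim!: eventually_mono)

locale mixed_boundary = bounded_open_set \<Omega>
  for \<Omega> :: "'a::euclidean_space set" +
  fixes \<Gamma>1 \<Gamma>2 :: "'a set" and \<gamma> :: "('a \<Rightarrow> real) \<Rightarrow> 'a \<Rightarrow> real"
  assumes frontier: "frontier \<Omega> = \<Gamma>1 \<union> \<Gamma>2"
    and sets_\<Gamma>1: "\<Gamma>1 \<in> sets (hausdorff_measure (DIM('a) - 1))"
    and sets_\<Gamma>2: "\<Gamma>2 \<in> sets (hausdorff_measure (DIM('a) - 1))"
    and trace: "is_trace_operator \<Omega> \<gamma>"
begin

lemma sets_frontier: "frontier \<Omega> \<in> sets (hausdorff_measure (DIM('a) - 1))"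
  unfolding frontier using sets_\<Gamma>1 sets_\<Gamma>2 by (rule sets.Un)

lemma trace_add:
  "u \<in> H1 \<Omega> \<Longrightarrow> v \<in> H1 \<Omega> \<Longrightarrow> AE x in surface_on \<Gamma>1. \<gamma> (\<lambda>y. u y + v y) x = \<gamma> u x + \<gamma> v x"
  using trace frontier by (intro AE_surface_on_subset[OF _ _ sets_\<Gamma>1 sets_frontier]) (auto simp: is_trace_operator_def)

lemma trace_scale:
  "v \<in> H1 \<Omega> \<Longrightarrow> AE x in surface_on \<Gamma>1. \<gamma> (\<lambda>y. c * v y) x = c * \<gamma> v x"
  using trace frontier by (intro AE_surface_on_subset[OF _ _ sets_\<Gamma>1 sets_frontier]) (auto simp: is_trace_operator_def)

lemma trace_diff:
  assumes "u \<in> H1 \<Omega>" "v \<in> H1 \<Omega>"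
  shows "AE x in surface_on \<Gamma>1. \<gamma> (u - v) x = \<gamma> u x - \<gamma> v x"
proof -
  have eq: "u - v = (\<lambda>y. u y + (- 1) * v y)" by (simp add: fun_eq_iff)
  show ?thesis
    using trace_add[OF assms(1) H1_scale[OF assms(2), of "- 1"]] trace_scale[OF assms(2), of "- 1"]
    unfolding eq by eventually_elim linarith
qed

lemma V0_subset_H1: "V0 \<Omega> \<Gamma>1 \<gamma> \<subseteq> H1 \<Omega>"
  by (auto simp: V0_def)

lemma diff_mem_V0:
  assumes "u \<in> H1 \<Omega>" "v \<in> H1 \<Omega>"
    and "AE x in surface_on \<Gamma>1. \<gamma> u x = b x" "AE x in surface_on \<Gamma>1. \<gamma> v x = b x"
  shows "u - v \<in> V0 \<Omega> \<Gamma>1 \<gamma>"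
proof -
  have "AE x in surface_on \<Gamma>1. \<gamma> (u - v) x = 0"
    using trace_diff[OF assms(1,2)] assms(3,4) by eventually_elim simp
  then show ?thesis using dirichlet.diff_mem[OF assms(1,2)] by (simp add: V0_def)
qed

sublocale V0: seminormed_space "V0 \<Omega> \<Gamma>1 \<gamma>" "H1_norm \<Omega>"
proof
  show "(\<lambda>x. 0) \<in> V0 \<Omega> \<Gamma>1 \<gamma>"
    using trace_scale[OF dirichlet.zero_mem, of 0] dirichlet.zero_mem by (simp add: V0_def)
  fix u v :: "'a \<Rightarrow> real" and c :: real
  assume u: "u \<in> V0 \<Omega> \<Gamma>1 \<gamma>"
  then have u': "u \<in> H1 \<Omega>" "AE x in surface_on \<Gamma>1. \<gamma> u x = 0" by (auto simp: V0_def)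
  have "AE x in surface_on \<Gamma>1. \<gamma> (\<lambda>y. c * u y) x = 0"
    using trace_scale[OF u'(1), of c] u'(2) by eventually_elim simp
  then show "(\<lambda>x. c * u x) \<in> V0 \<Omega> \<Gamma>1 \<gamma>" using H1_scale[OF u'(1)] by (simp add: V0_def)
  show "H1_norm \<Omega> (\<lambda>x. c * u x) = \<bar>c\<bar> * H1_norm \<Omega> u" by (rule H1.norm_scale[OF u'(1)])
  assume v: "v \<in> V0 \<Omega> \<Gamma>1 \<gamma>"
  then have v': "v \<in> H1 \<Omega>" "AE x in surface_on \<Gamma>1. \<gamma> v x = 0" by (auto simp: V0_def)
  have "AE x in surface_on \<Gamma>1. \<gamma> (\<lambda>y. u y + v y) x = 0"
    using trace_add[OF u'(1) v'(1)] u'(2) v'(2) by eventually_elim simp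
  then show "(\<lambda>x. u x + v x) \<in> V0 \<Omega> \<Gamma>1 \<gamma>" using H1_add[OF u'(1) v'(1)] by (simp add: V0_def)
  show "H1_norm \<Omega> (\<lambda>x. u x + v x) \<le> H1_norm \<Omega> u + H1_norm \<Omega> v"
    by (rule H1.norm_triangle[OF u'(1) v'(1)])
qed

sublocale gelfand_triple "V0 \<Omega> \<Gamma>1 \<gamma>" "H1_norm \<Omega>" "L2 (lebesgue_on \<Omega>)" "L2_inner (lebesgue_on \<Omega>)"
  by (intro gelfand_triple.intro gelfand_triple_axioms.intro V0.seminormed_space_axioms semi_inner_space_L2)
    (use V0_subset_H1 H1_imp_L2 in auto)

lemma trace_L2:
  assumes "v \<in> H1 \<Omega>"
  shows "\<gamma> v \<in> L2 (surface_on \<Gamma>2)"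
    and "L2_norm (surface_on \<Gamma>2) (\<gamma> v) \<le> L2_norm (surface_on (frontier \<Omega>)) (\<gamma> v)"
proof -
  have "\<gamma> v \<in> L2 (surface_on (frontier \<Omega>))" using trace assms by (simp add: is_trace_operator_def)
  from L2_restrict_space_subset[OF this[unfolded surface_on_def] _ sets_\<Gamma>2 sets_frontier] frontier
  show "\<gamma> v \<in> L2 (surface_on \<Gamma>2)"
    "L2_norm (surface_on \<Gamma>2) (\<gamma> v) \<le> L2_norm (surface_on (frontier \<Omega>)) (\<gamma> v)"
    by (auto simp: surface_on_def)
qed

text \<open>\<open>trace_norm\<close> is a real supremum, bounded by the constant \<open>C\<close>
  of the trace operator. Functions of norm 0, left out of the supremum, have trace of norm 0 by the
  same \<open>C\<close>.\<close>

lemma trace_norm_bound: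
  assumes v: "v \<in> H1 \<Omega>"
  shows "L2_norm (surface_on \<Gamma>2) (\<gamma> v) \<le> trace_norm \<Omega> \<Gamma>2 \<gamma> * H1_norm \<Omega> v"
proof -
  obtain C where "\<And>v. v \<in> H1 \<Omega> \<Longrightarrow> L2_norm (surface_on (frontier \<Omega>)) (\<gamma> v) \<le> C * H1_norm \<Omega> v"
    using trace unfolding is_trace_operator_def by blast
  then have C: "L2_norm (surface_on \<Gamma>2) (\<gamma> v) \<le> C * H1_norm \<Omega> v" if "v \<in> H1 \<Omega>" for v
    using trace_L2(2)[OF that] that order_trans by blast
  show ?thesis
  proof (cases "H1_norm \<Omega> v = 0")
    case True
    then show ?thesis using C[OF v] by simp
  next
    case False
    have pos: "H1_norm \<Omega> v > 0" if "v \<in> H1 \<Omega>" "H1_norm \<Omega> v \<noteq> 0" for v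
      using H1.norm_nonneg[OF that(1)] that(2) by simp
    have "bdd_above ((\<lambda>v. L2_norm (surface_on \<Gamma>2) (\<gamma> v) / H1_norm \<Omega> v) ` {v \<in> H1 \<Omega>. H1_norm \<Omega> v \<noteq> 0})"
      by (rule bdd_aboveI2[where M = C]) (use C pos in \<open>auto simp: pos_divide_le_eq\<close>)
    then have "L2_norm (surface_on \<Gamma>2) (\<gamma> v) / H1_norm \<Omega> v \<le> trace_norm \<Omega> \<Gamma>2 \<gamma>"
      unfolding trace_norm_def by (rule cSUP_upper[rotated]) (use v False in simp)
    then show ?thesis using pos[OF v False] by (simp add: pos_divide_le_eq)
  qed
qed

end

text \<open>The weights are such that the two data terms together consume half of the coercivity
  \<open>2 \<lambda>\<^sub>0 y\<^sup>2\<close>.\<close>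

lemma Young_coercive:
  fixes x y :: real
  assumes "lambda0 > 0"
  shows "2 * (x * y) \<le> 2 / lambda0 * x\<^sup>2 + lambda0 / 2 * y\<^sup>2"
proof -
  have "0 \<le> (2 * x - lambda0 * y)\<^sup>2 / (2 * lambda0)" using assms by simp
  also have "\<dots> = 2 / lambda0 * x\<^sup>2 + lambda0 / 2 * y\<^sup>2 - 2 * (x * y)"
    using assms by (simp add: power2_eq_square field_simps)
  finally show ?thesis by simp
qed

context mixed_boundary
begin

text \<open>Pointwise in time, with \<open>l\<close> the value of the time derivative on
  \<open>u - u_inf\<close>. Subtracting the stationary equation tested with the same function leaves
  only the differences of the data.\<close>

lemma evolution_dissipation:
  assumes lam: "lambda0 > 0"
    and coercive: "\<And>v. v \<in> V0 \<Omega> \<Gamma>1 \<gamma> \<Longrightarrow> dirichlet_form \<Omega> v v \<ge> lambda0 * (H1_norm \<Omega> v)\<^sup>2"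
    and u: "u \<in> H1 \<Omega>" and w: "u - u_inf \<in> V0 \<Omega> \<Gamma>1 \<gamma>"
    and g: "g \<in> L2 (lebesgue_on \<Omega>)" "g_inf \<in> L2 (lebesgue_on \<Omega>)"
    and q: "q \<in> L2 (surface_on \<Gamma>2)" "q_inf \<in> L2 (surface_on \<Gamma>2)"
    and stat: "stationary_solution \<Omega> \<Gamma>1 \<Gamma>2 \<gamma> b q_inf g_inf u_inf"
    and evol: "l + dirichlet_form \<Omega> u (u - u_inf) =
      L2_inner (lebesgue_on \<Omega>) g (u - u_inf) - L2_inner (surface_on \<Gamma>2) q (\<gamma> (u - u_inf))"
  shows "2 * l \<le> 2 / lambda0 * ((L2_norm (lebesgue_on \<Omega>) (g - g_inf))\<^sup>2 +
      (trace_norm \<Omega> \<Gamma>2 \<gamma>)\<^sup>2 * (L2_norm (surface_on \<Gamma>2) (q - q_inf))\<^sup>2) -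
      lambda0 * L2_inner (lebesgue_on \<Omega>) (u - u_inf) (u - u_inf)"
proof -
  let ?w = "u - u_inf" and ?\<tau> = "trace_norm \<Omega> \<Gamma>2 \<gamma>"
  let ?G = "L2_norm (lebesgue_on \<Omega>) (g - g_inf)" and ?Q = "L2_norm (surface_on \<Gamma>2) (q - q_inf)"
  let ?n = "H1_norm \<Omega> ?w"
  have u_inf: "u_inf \<in> H1 \<Omega>" using stat by (simp add: stationary_solution_def)
  have wH: "?w \<in> H1 \<Omega>" using w V0_subset_H1 by blast
  have wL: "?w \<in> L2 (lebesgue_on \<Omega>)" by (rule H1_imp_L2[OF wH])
  have n: "0 \<le> ?n" by (rule H1.norm_nonneg[OF wH])
  have "dirichlet_form \<Omega> u_inf ?w =
      L2_inner (lebesgue_on \<Omega>) g_inf ?w - L2_inner (surface_on \<Gamma>2) q_inf (\<gamma> ?w)"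
    using stat w by (simp add: stationary_solution_def)
  then have l: "l = - dirichlet_form \<Omega> ?w ?w + L2_inner (lebesgue_on \<Omega>) (g - g_inf) ?w
      - L2_inner (surface_on \<Gamma>2) (q - q_inf) (\<gamma> ?w)"
    using evol dirichlet.inner_diff[OF u u_inf wH] L2.inner_diff[OF g wL]
      L2.inner_diff[OF q trace_L2(1)[OF wH]] by simp
  have "L2_inner (lebesgue_on \<Omega>) (g - g_inf) ?w \<le> ?G * L2_norm (lebesgue_on \<Omega>) ?w"
    using L2.Cauchy_Schwarz[OF L2.diff_mem[OF g] wL] by simp
  also have "\<dots> \<le> ?G * ?n"
    by (intro mult_left_mono L2_norm_le_H1_norm L2.norm_nonneg L2.diff_mem g)
  finally have 1: "L2_inner (lebesgue_on \<Omega>) (g - g_inf) ?w \<le> ?G * ?n" .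
  have "- L2_inner (surface_on \<Gamma>2) (q - q_inf) (\<gamma> ?w) \<le> ?Q * L2_norm (surface_on \<Gamma>2) (\<gamma> ?w)"
    using L2.Cauchy_Schwarz[OF L2.diff_mem[OF q] trace_L2(1)[OF wH]] by simp
  also have "\<dots> \<le> ?Q * (?\<tau> * ?n)"
    by (intro mult_left_mono trace_norm_bound wH L2.norm_nonneg L2.diff_mem q)
  finally have 2: "- L2_inner (surface_on \<Gamma>2) (q - q_inf) (\<gamma> ?w) \<le> (?\<tau> * ?Q) * ?n"
    by (simp add: ac_simps)
  \<comment> \<open>The coercivity left over after Young's inequality is weakened from the norm of V
    to that of H, the quantity the energy inequality follows; this fixes the rate
    \<open>lambda0\<close>.\<close>
  have "L2_inner (lebesgue_on \<Omega>) ?w ?w = (L2_norm (lebesgue_on \<Omega>) ?w)\<^sup>2"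
    using L2.inner_nonneg[OF wL] by (simp add: L2_norm_eq)
  also have "\<dots> \<le> ?n\<^sup>2"
    by (intro power_mono L2_norm_le_H1_norm L2.norm_nonneg wL)
  finally have "lambda0 * L2_inner (lebesgue_on \<Omega>) ?w ?w \<le> lambda0 * ?n\<^sup>2"
    using lam by (simp add: mult_left_mono)
  then show ?thesis
    using 1 2 Young_coercive[OF lam, of ?G ?n] Young_coercive[OF lam, of "?\<tau> * ?Q" ?n] coercive[OF w]
    unfolding l by (simp add: power_mult_distrib distrib_left)
qed

text \<open>Continuity in H makes the pairing with \<open>v\<close> continuous in time, so the
  distributional identity becomes an integral formula for all times, as
  \<open>energy_inequality\<close> requires.\<close>

lemma evolution_weak_derivative:
  assumes T: "T > 0" and uL: "\<And>t. t \<ge> 0 \<Longrightarrow> u t \<in> L2 (lebesgue_on \<Omega>)"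
    and cont: "\<And>t. t \<ge> 0 \<Longrightarrow> ((\<lambda>s. L2_norm (lebesgue_on \<Omega>) (u s - u t)) \<longlongrightarrow> 0) (at t within {0..})"
    and u': "u' \<in> bochner_L2 (lebesgue_on {0<..<T}) (dual_space (V0 \<Omega> \<Gamma>1 \<gamma>) (H1_norm \<Omega>))
               (dual_norm (V0 \<Omega> \<Gamma>1 \<gamma>) (H1_norm \<Omega>))"
    and td: "is_time_derivative \<Omega> (V0 \<Omega> \<Gamma>1 \<gamma>) T u u'"
    and v: "v \<in> V0 \<Omega> \<Gamma>1 \<gamma>" and st: "0 < s" "s < t" "t < T"
  shows "L2_inner (lebesgue_on \<Omega>) (u t) v - L2_inner (lebesgue_on \<Omega>) (u s) v = integral {s..t} (\<lambda>r. u' r v)"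
proof (rule du_Bois_Reymond[OF _ _ _ st])
  have vL: "v \<in> L2 (lebesgue_on \<Omega>)" using v V0_subset_H1 H1_imp_L2 by blast
  show "integrable (lebesgue_on {0<..<T}) (\<lambda>r. u' r v)"
    by (intro L2_imp_integrable V0.bochner_L2_dual_apply[OF _ u' v] finite_measure_lebesgue_on
        complete_measure_lebesgue_on) auto
  show "(\<integral>t. u' t v * \<phi> t \<partial>lebesgue_on {0<..<T}) =
      - (\<integral>t. L2_inner (lebesgue_on \<Omega>) (u t) v * deriv \<phi> t \<partial>lebesgue_on {0<..<T})"
    if "test_function {0<..<T} \<phi>" for \<phi>
    using td that v by (simp add: is_time_derivative_def)
  show "continuous_on {0<..<T} (\<lambda>t. L2_inner (lebesgue_on \<Omega>) (u t) v)"
    unfolding continuous_on_def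
  proof
    fix t assume t: "t \<in> {0<..<T}"
    have "((\<lambda>s. L2_norm (lebesgue_on \<Omega>) (u s - u t) * L2_norm (lebesgue_on \<Omega>) v) \<longlongrightarrow>
        0 * L2_norm (lebesgue_on \<Omega>) v) (at t within {0<..<T})"
      using t by (intro tendsto_mult tendsto_const tendsto_within_subset[OF cont]) auto
    then have lim: "((\<lambda>s. L2_norm (lebesgue_on \<Omega>) (u s - u t) * L2_norm (lebesgue_on \<Omega>) v) \<longlongrightarrow> 0)
        (at t within {0<..<T})" by simp
    have "\<forall>\<^sub>F s in at t within {0<..<T}. s \<in> {0<..<T}"
      by (simp add: eventually_at_filter)
    then have "\<forall>\<^sub>F s in at t within {0<..<T}.
        norm (L2_inner (lebesgue_on \<Omega>) (u s) v - L2_inner (lebesgue_on \<Omega>) (u t) v) \<le>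
        L2_norm (lebesgue_on \<Omega>) (u s - u t) * L2_norm (lebesgue_on \<Omega>) v"
    proof eventually_elim
      case (elim s)
      then have "u s \<in> L2 (lebesgue_on \<Omega>)" "u t \<in> L2 (lebesgue_on \<Omega>)" using t uL by auto
      then show ?case
        using L2.Cauchy_Schwarz[OF L2.diff_mem vL] L2.inner_diff[OF _ _ vL] by fastforce
    qed
    from Lim_null_comparison[OF this lim]
    show "((\<lambda>t. L2_inner (lebesgue_on \<Omega>) (u t) v) \<longlongrightarrow> L2_inner (lebesgue_on \<Omega>) (u t) v) (at t within {0<..<T})"
      by (rule LIM_zero_cancel)
  qed
qed

end

theorem theorem6p1:
  fixes \<Omega> \<Gamma>1 \<Gamma>2 :: "'a::euclidean_space set"
    and \<gamma> :: "('a \<Rightarrow> real) \<Rightarrow> 'a \<Rightarrow> real"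
    and b vb u_inf q_inf g_inf :: "'a \<Rightarrow> real"
    and u q g :: "real \<Rightarrow> 'a \<Rightarrow> real"
    and lambda0 :: real
    and F1 F2 :: "real \<Rightarrow> real"
  assumes domain: "regular_domain \<Omega>"
    and boundary: "frontier \<Omega> = \<Gamma>1 \<union> \<Gamma>2" "\<Gamma>1 \<inter> \<Gamma>2 = {}"
    and meas: "\<Gamma>1 \<in> sets (hausdorff_measure (DIM('a) - 1))"
              "\<Gamma>2 \<in> sets (hausdorff_measure (DIM('a) - 1))"
    and pos: "emeasure (hausdorff_measure (DIM('a) - 1)) \<Gamma>1 > 0"
             "emeasure (hausdorff_measure (DIM('a) - 1)) \<Gamma>2 > 0"
    and trace: "is_trace_operator \<Omega> \<gamma>"
    and coercive: "lambda0 > 0" "\<And>v. v \<in> V0 \<Omega> \<Gamma>1 \<gamma> \<Longrightarrow> dirichlet_form \<Omega> v v \<ge> lambda0 * (H1_norm \<Omega> v)\<^sup>2"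
    and b_half: "b \<in> H_half \<Gamma>1"
    and vb_trace: "vb \<in> H1 \<Omega>" "AE x in surface_on \<Gamma>1. \<gamma> vb x = b x"
    and q_L2: "\<And>T. T > 0 \<Longrightarrow> q \<in> bochner_L2 (lebesgue_on {0<..<T}) (L2 (surface_on \<Gamma>2)) (L2_norm (surface_on \<Gamma>2))"
    and g_L2: "\<And>T. T > 0 \<Longrightarrow> g \<in> bochner_L2 (lebesgue_on {0<..<T}) (L2 (lebesgue_on \<Omega>)) (L2_norm (lebesgue_on \<Omega>))"
    and q_inf_L2: "q_inf \<in> L2 (surface_on \<Gamma>2)"
    and g_inf_L2: "g_inf \<in> L2 (lebesgue_on \<Omega>)"
    and u_sol: "evolution_solution \<Omega> \<Gamma>1 \<Gamma>2 \<gamma> vb q g u"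
    and u_inf_sol: "stationary_solution \<Omega> \<Gamma>1 \<Gamma>2 \<gamma> b q_inf g_inf u_inf"
    and F1_eq: "F1 = (\<lambda>t. exp (lambda0 * t) * (L2_norm (lebesgue_on \<Omega>) (g t - g_inf))\<^sup>2)"
    and F2_eq: "F2 = (\<lambda>t. exp (lambda0 * t) * (trace_norm \<Omega> \<Gamma>2 \<gamma>)\<^sup>2 * (L2_norm (surface_on \<Gamma>2) (q t - q_inf))\<^sup>2)"
    and F1_L1: "integrable (lebesgue_on {0<..}) F1"
    and F2_L1: "integrable (lebesgue_on {0<..}) F2"
  shows "(\<forall>t\<ge>0. (L2_norm (lebesgue_on \<Omega>) (u t - u_inf))\<^sup>2
           \<le> (L2_norm (lebesgue_on \<Omega>) (u 0 - u_inf))\<^sup>2 * exp (- lambda0 * t)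
             + 2 * exp (- lambda0 * t) / lambda0 *
               ((\<integral>t. \<bar>F1 t\<bar> \<partial>lebesgue_on {0<..}) + (\<integral>t. \<bar>F2 t\<bar> \<partial>lebesgue_on {0<..})))
    \<and> ((\<lambda>t. L2_norm (lebesgue_on \<Omega>) (u t - u_inf)) \<longlongrightarrow> 0) at_top
    \<and> (\<exists>C. \<forall>t\<ge>0. L2_norm (lebesgue_on \<Omega>) (u t - u_inf) \<le> C * exp (- (lambda0 / 2) * t))"
proof -
  interpret mixed_boundary \<Omega> \<Gamma>1 \<Gamma>2 \<gamma>
    by standard (use domain boundary meas trace in \<open>auto simp: regular_domain_def\<close>)
  let ?H = "lebesgue_on \<Omega>" and ?X = "V0 \<Omega> \<Gamma>1 \<gamma>"
  define w where "w t = u t - u_inf" for t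
  define e where "e t = exp (lambda0 * t) * L2_inner ?H (w t) (w t)" for t
  define F where "F = 2 / lambda0 * ((\<integral>t. \<bar>F1 t\<bar> \<partial>lebesgue_on {0<..}) + (\<integral>t. \<bar>F2 t\<bar> \<partial>lebesgue_on {0<..}))"
  define m where "m t = 2 / lambda0 * ((L2_norm ?H (g t - g_inf))\<^sup>2 +
      (trace_norm \<Omega> \<Gamma>2 \<gamma>)\<^sup>2 * (L2_norm (surface_on \<Gamma>2) (q t - q_inf))\<^sup>2)" for t
  have u_inf: "u_inf \<in> H1 \<Omega>" "AE x in surface_on \<Gamma>1. \<gamma> u_inf x = b x"
    using u_inf_sol by (auto simp: stationary_solution_def)
  have uL: "\<And>t. t \<ge> 0 \<Longrightarrow> u t \<in> L2 ?H"
    and u_cont: "\<And>t. t \<ge> 0 \<Longrightarrow> ((\<lambda>s. L2_norm ?H (u s - u t)) \<longlongrightarrow> 0) (at t within {0..})"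
    using u_sol by (auto simp: evolution_solution_def)
  obtain u' where u'_all: "\<forall>T>0.
        (\<lambda>t. u t - vb) \<in> bochner_L2 (lebesgue_on {0<..<T}) ?X (H1_norm \<Omega>) \<and>
        u' \<in> bochner_L2 (lebesgue_on {0<..<T}) (dual_space ?X (H1_norm \<Omega>)) (dual_norm ?X (H1_norm \<Omega>)) \<and>
        is_time_derivative \<Omega> ?X T u u' \<and>
        (AE t in lebesgue_on {0<..<T}. \<forall>v\<in>?X.
           u' t v + dirichlet_form \<Omega> (u t) v =
           L2_inner ?H (g t) v - L2_inner (surface_on \<Gamma>2) (q t) (\<gamma> v))"
    using u_sol unfolding evolution_solution_def by blast
  have wL: "w t \<in> L2 ?H" if "t \<ge> 0" for t
    unfolding w_def by (rule L2.diff_mem[OF uL[OF that] H1_imp_L2[OF u_inf(1)]])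
  have w_diff: "w s - w t = u s - u t" for s t by (simp add: w_def fun_eq_iff)
  have w_sq: "L2_inner ?H (w t) (w t) = (L2_norm ?H (w t))\<^sup>2" if "t \<ge> 0" for t
    using L2.inner_nonneg[OF wL[OF that]] by (simp add: L2_norm_eq)
  have w_cont: "((\<lambda>s. sqrt (L2_inner ?H (w s - w t) (w s - w t))) \<longlongrightarrow> 0) (at t within {0..T})"
    if "t \<in> {0..T}" for t T
    using that tendsto_within_subset[OF u_cont, of t "{0..T}"] by (simp add: w_diff L2_norm_eq)
  have m_eq: "exp (lambda0 * t) * m t = 2 / lambda0 * (F1 t + F2 t)" for t
    by (simp add: m_def F1_eq F2_eq algebra_simps)
  have F_nonneg: "0 \<le> F1 t" "0 \<le> F2 t" for t
    by (simp_all add: F1_eq F2_eq)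
  have F0: "0 \<le> F" using coercive(1) by (simp add: F_def)
  have m_int: "integrable (lebesgue_on {0<..}) (\<lambda>t. exp (lambda0 * t) * m t)"
    unfolding m_eq using F1_L1 F2_L1 by simp
  have step: "e t \<le> e a + F" if at: "0 < a" "a \<le> t" for a t
  proof -
    \<comment> \<open>The energy inequality needs its right end strictly below
      \<open>T\<close>.\<close>
    define T where "T = t + 1"
    have T: "T > 0" "t < T" using at by (auto simp: T_def)
    let ?M = "lebesgue_on {0<..<T}"
    have fin: "finite_measure ?M" and cM: "complete_measure ?M"
      by (auto intro: finite_measure_lebesgue_on complete_measure_lebesgue_on)
    have uvb: "(\<lambda>t. u t - vb) \<in> bochner_L2 ?M ?X (H1_norm \<Omega>)"
      and u': "u' \<in> bochner_L2 ?M (dual_space ?X (H1_norm \<Omega>)) (dual_norm ?X (H1_norm \<Omega>))"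
      and td: "is_time_derivative \<Omega> ?X T u u'"
      and eq: "AE t in ?M. \<forall>v\<in>?X. u' t v + dirichlet_form \<Omega> (u t) v =
           L2_inner ?H (g t) v - L2_inner (surface_on \<Gamma>2) (q t) (\<gamma> v)"
      using u'_all T(1) by auto
    \<comment> \<open>\<open>vb\<close> and \<open>u_inf\<close> have the same trace
      \<open>b\<close> on \<open>\<Gamma>1\<close>, so their difference lies in
      \<open>V0\<close>.\<close>
    have "(\<lambda>t. (u t - vb) - (u_inf - vb)) \<in> bochner_L2 ?M ?X (H1_norm \<Omega>)"
      by (rule V0.bochner_L2_diff_const[OF fin uvb diff_mem_V0[OF u_inf(1) vb_trace(1) u_inf(2) vb_trace(2)] cM])
    then have w: "w \<in> bochner_L2 ?M ?X (H1_norm \<Omega>)"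
      by (simp add: w_def[abs_def] fun_diff_def)
    have "e t - e a \<le> (\<integral>t. exp (lambda0 * t) * m t \<partial>lebesgue_on {a<..<t})"
      unfolding e_def
    proof (rule energy_inequality[OF at T(2) _ w_cont w u'])
      show "w t \<in> L2 ?H" if "t \<in> {0..T}" for t using that wL by simp
      show "integrable ?M (\<lambda>t. exp (lambda0 * t) * m t)"
        by (rule integrable_restrict_space_subset[OF m_int]) auto
      show "L2_inner ?H (w t) v - L2_inner ?H (w s) v = integral {s..t} (\<lambda>r. u' r v)"
        if "v \<in> ?X" "0 < s" "s < t" "t < T" for v s t
      proof -
        have vL: "v \<in> L2 ?H" using that V0_subset_H1 H1_imp_L2 by blast
        have "L2_inner ?H (w t) v - L2_inner ?H (w s) v = L2_inner ?H (u t) v - L2_inner ?H (u s) v"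
          unfolding w_def using that L2.inner_diff[OF uL H1_imp_L2[OF u_inf(1)] vL] by simp
        also have "\<dots> = integral {s..t} (\<lambda>r. u' r v)"
          by (rule evolution_weak_derivative[OF T(1) uL u_cont u' td that])
        finally show ?thesis .
      qed
      have wX: "AE t in ?M. w t \<in> ?X" and uX: "AE t in ?M. u t - vb \<in> ?X"
        using w uvb by (auto simp: bochner_L2_def strongly_measurable_def)
      have gL: "AE t in ?M. g t \<in> L2 ?H" and qL: "AE t in ?M. q t \<in> L2 (surface_on \<Gamma>2)"
        using g_L2[OF T(1)] q_L2[OF T(1)] by (auto simp: bochner_L2_def strongly_measurable_def)
      \<comment> \<open>In the evolution equation the null set of times does not depend on
        \<open>v\<close>, which permits the choice \<open>v = w t\<close>.\<close>
      show "AE t in ?M. 2 * u' t (w t) \<le> m t - lambda0 * L2_inner ?H (w t) (w t)"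
        using wX uX gL qL eq
      proof eventually_elim
        case (elim t)
        have "(\<lambda>x. (u t - vb) x + vb x) \<in> H1 \<Omega>"
          by (rule H1_add[OF subsetD[OF V0_subset_H1 elim(2)] vb_trace(1)])
        then have "u t \<in> H1 \<Omega>" by simp
        then show ?case
          using elim unfolding m_def w_def
          by (intro evolution_dissipation[OF coercive _ _ _ g_inf_L2 _ q_inf_L2 u_inf_sol]) auto
      qed
    qed
    \<comment> \<open>The integrand is nonnegative, so enlarging the interval gives a bound
      independent of \<open>a\<close> and \<open>t\<close>.\<close>
    also have "\<dots> \<le> (\<integral>t. exp (lambda0 * t) * m t \<partial>lebesgue_on {0<..})"
      by (rule integral_restrict_space_mono[OF m_int])
        (use at coercive(1) F_nonneg in \<open>auto simp: m_eq\<close>)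
    also have "\<dots> = F"
      unfolding m_eq F_def using F1_L1 F2_L1 F_nonneg by simp
    finally show ?thesis by simp
  qed
  have e_le: "e t \<le> e 0 + F" if "t \<ge> 0" for t
  proof (cases "t = 0")
    case True
    then show ?thesis using F0 by simp
  next
    case False
    then have t: "t > 0" using that by simp
    \<comment> \<open>The step estimate excludes the starting time 0; continuity of \<open>e\<close>
      there allows \<open>a\<close> to tend to 0 from the right.\<close>
    have "continuous_on {0..t} e"
      unfolding e_def by (intro continuous_intros continuous_on_inner_self w_cont wL) auto
    then have "(e \<longlongrightarrow> e 0) (at 0 within {0..t})"
      using t by (auto simp: continuous_on_def)
    then have "(e \<longlongrightarrow> e 0) (at_right 0)"
      using t by (simp add: at_within_Icc_at_right)
    then have "((\<lambda>a. e a + F) \<longlongrightarrow> e 0 + F) (at_right 0)"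
      by (intro tendsto_intros)
    moreover have "\<forall>\<^sub>F a in at_right 0. e t \<le> e a + F"
      using eventually_at_right_less[of 0] eventually_at_right_real[OF t]
      by eventually_elim (use step in auto)
    ultimately show ?thesis
      by (rule tendsto_lowerbound) simp
  qed
  have main: "(L2_norm ?H (w t))\<^sup>2 \<le> ((L2_norm ?H (w 0))\<^sup>2 + F) * exp (- lambda0 * t)" if t: "t \<ge> 0" for t
  proof -
    have "(L2_norm ?H (w t))\<^sup>2 = e t * exp (- lambda0 * t)"
      using w_sq[OF t] by (simp add: e_def exp_minus)
    also have "\<dots> \<le> (e 0 + F) * exp (- lambda0 * t)"
      by (intro mult_right_mono e_le t) simp
    finally show ?thesis using w_sq[of 0] by (simp add: e_def)
  qed
  define C where "C = sqrt ((L2_norm ?H (w 0))\<^sup>2 + F)"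
  have decay: "L2_norm ?H (w t) \<le> C * exp (- (lambda0 / 2) * t)" if t: "t \<ge> 0" for t
  proof -
    have "exp (- lambda0 * t) = (exp (- (lambda0 / 2) * t))\<^sup>2"
      by (simp add: power2_eq_square exp_add[symmetric])
    then have "(L2_norm ?H (w t))\<^sup>2 \<le> (C * exp (- (lambda0 / 2) * t))\<^sup>2"
      using main[OF t] F0 by (simp add: C_def power_mult_distrib)
    then show ?thesis
      by (rule power2_le_imp_le) (use F0 in \<open>simp add: C_def\<close>)
  qed
  have "((\<lambda>t. exp (- (lambda0 / 2) * t)) \<longlongrightarrow> 0) at_top"
    using coercive(1) by real_asymp
  from tendsto_mult_right_zero[OF this]
  have lim: "((\<lambda>t. C * exp (- (lambda0 / 2) * t)) \<longlongrightarrow> 0) at_top" .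
  have "((\<lambda>t. L2_norm ?H (w t)) \<longlongrightarrow> 0) at_top"
  proof (rule Lim_null_comparison[OF _ lim])
    show "\<forall>\<^sub>F t in at_top. norm (L2_norm ?H (w t)) \<le> C * exp (- (lambda0 / 2) * t)"
      using eventually_ge_at_top[of 0]
      by eventually_elim (use decay L2.norm_nonneg[OF wL] in simp)
  qed
  moreover have "\<forall>t\<ge>0. (L2_norm ?H (w t))\<^sup>2 \<le> (L2_norm ?H (w 0))\<^sup>2 * exp (- lambda0 * t)
      + 2 * exp (- lambda0 * t) / lambda0 *
        ((\<integral>t. \<bar>F1 t\<bar> \<partial>lebesgue_on {0<..}) + (\<integral>t. \<bar>F2 t\<bar> \<partial>lebesgue_on {0<..}))"
    using main by (auto simp: F_def algebra_simps)
  ultimately show ?thesis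
    using decay unfolding w_def by blast
qed

end
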